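(* Let $p\in(0,\infty)$, $W\in A_{p,\infty}(\mathbb R^n,\mathbb C^m)$, and $M\in M_m(\mathbb C)$. Then, for any $$r\in\left[1,\,1+\frac{1}{2^{n+1}[W]_{A_{p,\infty}(\mathbb R^n,\mathbb C^m)}^{\mathrm{sc}}-1}\right]$$ and any cube $Q\subset\mathbb R^n$, $$\fint_Q\left\|W^{\frac1p}(x)M\right\|^{pr}\,dx\le2\left[\fint_Q\left\|W^{\frac1p}(x)M\right\|^p\,dx\right]^r.$$
   Context: Fix $m,n\in\mathbb N$. $M_m(\mathbb C)$ is the set of complex $m\times m$ matrices, $O_m$ is the zero matrix, and $\|\cdot\|$ is the operator norm induced by the Euclidean norm of $\mathbb C^m$. A cube in $\mathbb R^n$ has edges parallel to the coordinate axes and finite positive edge length (not necessarily open or closed). $\fint_E f:=\frac1{|E|}\int_E f$, $w(E):=\int_E w$, $\log_+t:=\max\{0,\log t\}$. A matrix weight is a function $W:\mathbb R^n\to M_m(\mathbb C)$ such that $W(x)$ is nonnegative definite for every $x$, $W(x)$ is invertible for almost every $x$, and all entries of $W$ are locally integrable; a scalar weight is a matrix weight with $m=1$. Real powers $W^\alpha(x)$ are defined by the spectral theorem. $A_{p,\infty}(\mathbb R^n,\mathbb C^m)$ is the class of matrix weights $W$ such that, for every cube $Q$, $\log_+\left(\fint_Q\|W^{1/p}(x)W^{-1/p}(\cdot)\|^p\,dx\right)\in L^1(Q)$, and $[W]_{A_{p,\infty}}:=\sup_Q\exp\left(\fint_Q\log\left(\fint_Q\|W^{1/p}(x)W^{-1/p}(y)\|^p\,dx\right)dy\right)<\infty$.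 The Hardy--Littlewood maximal operator is $\mathcal M(f)(x):=\sup_{B\ni x}\fint_B|f(y)|\,dy$, the supremum being over all balls $B\subset\mathbb R^n$ containing $x$. For a scalar weight $w$, $[w]_{A_\infty(\mathbb R^n)}^*:=\sup_Q\frac1{w(Q)}\int_Q\mathcal M(w\mathbf 1_Q)(x)\,dx$, with the supremum over all cubes. For nonzero $M\in M_m(\mathbb C)$ put $w_M:=\|W^{1/p}M\|^p$ (a scalar weight), and $$[W]_{A_{p,\infty}(\mathbb R^n,\mathbb C^m)}^{\mathrm{sc}}:=\sup_{M\in M_m(\mathbb C)\setminus\{O_m\}}[w_M]_{A_\infty(\mathbb R^n)}^*,$$ which is finite for $W\in A_{p,\infty}(\mathbb R^n,\mathbb C^m)$. *)

theory Defs
  imports "HOL-Analysis.Analysis"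
begin

section \<open>Matrices\<close>

definition adj :: "complex ^ 'm ^ 'm \<Rightarrow> complex ^ 'm ^ 'm" where
  "adj A = (\<chi> i j. cnj (A $ j $ i))"

definition unitary :: "complex ^ 'm ^ 'm \<Rightarrow> bool" where
  "unitary U \<longleftrightarrow> adj U ** U = mat 1"

definition diag :: "('m \<Rightarrow> real) \<Rightarrow> complex ^ 'm ^ 'm" where
  "diag d = (\<chi> i j. if i = j then of_real (d i) else 0)"

text \<open>Over the complex numbers, nonnegativity of the quadratic form already forces the
  matrix to be Hermitian.\<close>

definition nonneg_definite :: "complex ^ 'm ^ 'm \<Rightarrow> bool" where
  "nonneg_definite A \<longleftrightarrow>
     (\<forall>v. (\<Sum>i\<in>UNIV. cnj (v $ i) * (A *v v) $ i) \<in> \<real> \<and>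
          0 \<le> Re (\<Sum>i\<in>UNIV. cnj (v $ i) * (A *v v) $ i))"

definition opnorm :: "complex ^ 'm ^ 'm \<Rightarrow> real" where
  "opnorm A = onorm (\<lambda>v. A *v v)"

text \<open>Real powers of a nonnegative definite matrix by the spectral theorem. For a singular
  matrix, \<open>0 powr a = 0\<close> is applied to the zero eigenvalues, also when \<open>a < 0\<close>; a matrix
  weight is singular on a null set only.\<close>

definition mat_powr :: "complex ^ 'm ^ 'm \<Rightarrow> real \<Rightarrow> complex ^ 'm ^ 'm" where
  "mat_powr A a = (THE B. \<exists>U d. unitary U \<and> (\<forall>i. 0 \<le> d i) \<and>
      A = U ** diag d ** adj U \<and> B = U ** diag (\<lambda>i. d i powr a) ** adj U)"

lemma unitary_right: "unitary U \<Longrightarrow> U ** adj U = mat 1"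
  by (simp add: unitary_def matrix_left_right_inverse)

text \<open>The matrix described in \<open>mat_powr_def\<close> does not depend on the diagonalization.\<close>

lemma diagonalization_powr_unique:
  fixes U V :: "complex ^ 'm ^ 'm"
  assumes U: "unitary U" and V: "unitary V"
    and eq: "U ** diag d ** adj U = V ** diag e ** adj V"
  shows "U ** diag (\<lambda>i. d i powr a) ** adj U = V ** diag (\<lambda>i. e i powr a) ** adj V"
proof -
  define S where "S = adj V ** U"
  have L: "(S ** diag f) $ i $ j = S $ i $ j * of_real (f j)" for f i j
    by (simp add: matrix_matrix_mult_def diag_def if_distrib [of "\<lambda>z. _ * z"] cong: if_cong)
  have R: "(diag f ** S) $ i $ j = of_real (f i) * S $ i $ j" for f i j
    by (simp add: matrix_matrix_mult_def diag_def if_distrib [of "\<lambda>z. z * _"] cong: if_cong)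
  have "S ** diag d = adj V ** (U ** diag d ** adj U) ** U"
    using U by (simp add: S_def unitary_def flip: matrix_mul_assoc)
  also have "\<dots> = (adj V ** V) ** diag e ** (adj V ** U)"
    by (simp add: eq matrix_mul_assoc)
  also have "\<dots> = diag e ** S"
    using V by (simp add: S_def unitary_def)
  finally have "S $ i $ j * of_real (d j) = of_real (e i) * S $ i $ j" for i j
    using L R by metis
  then have "S $ i $ j = 0 \<or> d j = e i" for i j
    by (metis mult.commute mult_cancel_left of_real_eq_iff)
  then have *: "S ** diag (\<lambda>i. d i powr a) = diag (\<lambda>i. e i powr a) ** S"
    unfolding vec_eq_iff L R by (metis mult.commute mult_zero_left)
  have "V ** (S ** diag (\<lambda>i. d i powr a)) ** adj U
      = (V ** adj V) ** (U ** diag (\<lambda>i. d i powr a) ** adj U)"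
    by (simp add: S_def matrix_mul_assoc)
  moreover have "V ** (diag (\<lambda>i. e i powr a) ** S) ** adj U
      = V ** diag (\<lambda>i. e i powr a) ** adj V ** (U ** adj U)"
    by (simp add: S_def matrix_mul_assoc)
  ultimately show ?thesis
    using * U V by (simp add: unitary_right)
qed


section \<open>Cubes and averages\<close>

definition cube :: "(real ^ 'n) set \<Rightarrow> bool" where
  "cube Q \<longleftrightarrow> (\<exists>a l I. 0 < l \<and>
      (\<forall>i. {a i<..<a i + l} \<subseteq> I i \<and> I i \<subseteq> {a i..a i + l}) \<and> Q = {x. \<forall>i. x $ i \<in> I i})"

definition avg :: "(real ^ 'n) set \<Rightarrow> (real ^ 'n \<Rightarrow> real) \<Rightarrow> real" where
  "avg E f = (LINT x:E|lebesgue. f x) / measure lebesgue E"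

text \<open>Averages of nonnegative functions that are not known in advance to be integrable.\<close>

definition nnavg :: "(real ^ 'n) set \<Rightarrow> (real ^ 'n \<Rightarrow> ennreal) \<Rightarrow> ennreal" where
  "nnavg E f = (\<integral>\<^sup>+x\<in>E. f x \<partial>lebesgue) / emeasure lebesgue E"


section \<open>Matrix weights\<close>

definition matrix_weight :: "(real ^ 'n \<Rightarrow> complex ^ 'm ^ 'm) \<Rightarrow> bool" where
  "matrix_weight W \<longleftrightarrow>
     (\<forall>x. nonneg_definite (W x)) \<and>
     (AE x in lebesgue. invertible (W x)) \<and>
     (\<forall>i j K. compact K \<longrightarrow> set_integrable lebesgue K (\<lambda>x. W x $ i $ j))"

text \<open>The average over \<open>x\<close> below is always finite for a matrix weight, since
  \<open>opnorm (mat_powr (W x) (1 / p)) powr p = opnorm (W x)\<close> is locally integrable in \<open>x\<close>,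
  and it is positive for almost every \<open>y\<close>.\<close>

definition Ap_avg ::
  "real \<Rightarrow> (real ^ 'n \<Rightarrow> complex ^ 'm ^ 'm) \<Rightarrow> (real ^ 'n) set \<Rightarrow> real ^ 'n \<Rightarrow> real" where
  "Ap_avg p W Q y =
     avg Q (\<lambda>x. opnorm (mat_powr (W x) (1 / p) ** mat_powr (W y) (- 1 / p)) powr p)"

definition Ap_infty_const :: "real \<Rightarrow> (real ^ 'n \<Rightarrow> complex ^ 'm ^ 'm) \<Rightarrow> ennreal" where
  "Ap_infty_const p W =
     (SUP Q\<in>{Q. cube Q}. ennreal (exp (avg Q (\<lambda>y. ln (Ap_avg p W Q y)))))"

text \<open>The first integrability condition concerns the positive part of the logarithm only; the
  negative part is integrable over cubes for every matrix weight, because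
  \<open>Ap_avg p W Q y\<close> is bounded below by a positive multiple of \<open>1 / opnorm (W y)\<close>.\<close>

definition Ap_infty :: "real \<Rightarrow> (real ^ 'n \<Rightarrow> complex ^ 'm ^ 'm) set" where
  "Ap_infty p = {W. matrix_weight W \<and>
     (\<forall>Q. cube Q \<longrightarrow> set_integrable lebesgue Q (\<lambda>y. max 0 (ln (Ap_avg p W Q y)))) \<and>
     Ap_infty_const p W < \<infinity>}"


section \<open>The maximal operator and the scalar constants\<close>

definition HL_maximal :: "(real ^ 'n \<Rightarrow> real) \<Rightarrow> real ^ 'n \<Rightarrow> ennreal" where
  "HL_maximal f x =
     (SUP B\<in>{B. x \<in> B \<and> (\<exists>c \<rho>. 0 < \<rho> \<and> B = ball c \<rho>)}. nnavg B (\<lambda>y. ennreal \<bar>f y\<bar>))"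

definition A_infty_star :: "(real ^ 'n \<Rightarrow> real) \<Rightarrow> ennreal" where
  "A_infty_star w =
     (SUP Q\<in>{Q. cube Q}. (\<integral>\<^sup>+x\<in>Q. HL_maximal (\<lambda>y. w y * indicator Q y) x \<partial>lebesgue)
                          / (\<integral>\<^sup>+x\<in>Q. ennreal (w x) \<partial>lebesgue))"

definition Ap_infty_sc :: "real \<Rightarrow> (real ^ 'n \<Rightarrow> complex ^ 'm ^ 'm) \<Rightarrow> ennreal" where
  "Ap_infty_sc p W =
     (SUP M\<in>UNIV - {0}. A_infty_star (\<lambda>x. opnorm (mat_powr (W x) (1 / p) ** M) powr p))"

end

(*
  The maximal operator is taken over balls, while the Fujii-Wilson constant tests it on cubes. A ball
  containing a cube has (sqrt n / 2)^n * omega_n times its volume, so the classical argument, which compares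
  the dyadic maximal function with M pointwise, loses this factor and does not reach the constant 2^(n+1)
  in high dimensions.

  It is enough to bound the logarithmic energy of w on every dyadic cube P: if the integral of w * ln (m / w_P)
  over P is at most K * w(P), where m is the running maximum of the dyadic averages and w_P the average, then
  the integral of w * m^eps over P is at most 2 * w_P^eps * w(P) as soon as 2 * K + n * ln 2 <= 1 / eps. The
  proof is an induction over the generations.

  For n <= 4 the energy is bounded by the integral of m, because ln t <= g * (1 - 1 / t) for the jumps
  t <= 2^n of the maximum, with a constant g much smaller than 2^n.

  For n >= 5 the energy is obtained by integrating over u a reverse weak type inequality: for large u the
  set E = {M w > u} inside P satisfies w(E) <= 2 * (3 / 2)^n * u * |E|. Every ball touching the
  complement of E has average at most u. Taking the balls B(z, d(z)), where d is the distance to the complement,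
  extended to all of R^n by reflecting at the faces of P, every point of E is covered with total weight
  at least 1 / 2, and the centers z that matter occupy at most (3 / 2)^n * |E|: moving z into P, to twice its
  distance from the faces that separate it from P, lands in E.
*)
theory Submission
  imports Defs
begin

text \<open>The bound \<open>2 ^ (n + 1) * A - 1\<close> for 1 / \<epsilon> leaves no room for a
  further dimensional constant, whereas the volume ratio of the circumscribed ball grows roughly
  like (pi * e / 2)^(n / 2), with base about 2.07. No estimate linear in that ratio can serve all n.
  The logarithm prices a jump by the factor 2^n at about n * ln 2 instead of 2^n; this saves n <= 4
  and fails at n = 5, by about 65.8 against 64.

  From n = 5 on, the ratio must therefore sit inside a logarithm. The levels are split: up to a
  fixed multiple of the average the logarithm is bounded outright, and only there does the ratio
  occur; above it the covering argument works with balls throughout and never compares them with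
  cubes.

  In its constant 2 * (3 / 2)^n, the 2 undoes the covering weight 1 / 2, and each coordinate
  contributes 1 + 1 / 2. Plain reflection would contribute 1 + 1 and end at 4 * 2^n in the final
  estimate; doubling the distance to the face halves the outer part, and 3 / 2 < 2 is what
  counts.\<close>

abbreviation vol :: "'a :: euclidean_space set \<Rightarrow> ennreal" where
  "vol \<equiv> emeasure lborel"

section \<open>Powers of nonnegative definite matrices\<close>

definition hip :: "complex ^ 'm \<Rightarrow> complex ^ 'm \<Rightarrow> complex" where
  "hip u v = (\<Sum>i\<in>UNIV. cnj (u $ i) * v $ i)"

lemma hip_add_left: "hip (u + u') v = hip u v + hip u' v"
  and hip_add_right: "hip u (v + v') = hip u v + hip u v'"
  and hip_diff_right: "hip u (v - v') = hip u v - hip u v'"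
  and hip_scale_left: "hip (c *s u) v = cnj c * hip u v"
  and hip_scale_right: "hip u (c *s v) = c * hip u v"
  and hip_zero_right [simp]: "hip u 0 = 0"
  by (auto simp: hip_def algebra_simps sum.distrib sum_subtractf sum_distrib_left)

lemma hip_sum_right: "hip u (\<Sum>k\<in>S. f k) = (\<Sum>k\<in>S. hip u (f k))"
  by (induction S rule: infinite_finite_induct) (auto simp: hip_add_right)

lemma cnj_hip: "cnj (hip u v) = hip v u"
  by (simp add: hip_def mult.commute)

lemma cnj_mult_self: "cnj z * z = of_real ((cmod z)\<^sup>2)"
  by (metis complex_norm_square mult.commute)

lemma hip_self: "hip v v = of_real ((norm v)\<^sup>2)"
proof -
  have "(norm v)\<^sup>2 = (\<Sum>i\<in>UNIV. (cmod (v $ i))\<^sup>2)"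
    by (simp add: norm_vec_def L2_set_def sum_nonneg)
  then show ?thesis
    unfolding hip_def cnj_mult_self by (metis of_real_sum)
qed

lemma Re_hip: "Re (hip u v) = u \<bullet> v"
  by (simp add: hip_def inner_vec_def inner_complex_def)

lemma nonneg_definite_hip:
  "nonneg_definite A \<longleftrightarrow> (\<forall>v. hip v (A *v v) \<in> \<real> \<and> 0 \<le> Re (hip v (A *v v)))"
  by (simp add: nonneg_definite_def hip_def)

text \<open>Polarization: realness of the quadratic form at \<open>u + v\<close> makes
  \<open>a + b\<close> real, and at \<open>\<i> *s u + v\<close> it makes \<open>b - a\<close>
  purely imaginary.\<close>

lemma nonneg_definite_hermitian:
  assumes "nonneg_definite A"
  shows "hip u (A *v v) = hip (A *v u) v"
proof -
  define a b where "a = hip u (A *v v)" and "b = hip v (A *v u)"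
  have q: "hip x (A *v x) \<in> \<real>" for x
    using assms by (simp add: nonneg_definite_hip)
  have 1: "hip (u + v) (A *v (u + v)) = hip u (A *v u) + hip v (A *v v) + (a + b)"
    by (simp add: a_def b_def hip_add_left hip_add_right matrix_vector_right_distrib)
  have 2: "hip (\<i> *s u + v) (A *v (\<i> *s u + v)) = hip u (A *v u) + hip v (A *v v) + \<i> * (b - a)"
    by (simp add: a_def b_def hip_add_left hip_add_right hip_scale_left hip_scale_right
        matrix_vector_right_distrib vector_scalar_commute algebra_simps)
  have "Im (a + b) = 0"
    using q[of "u + v"] q[of u] q[of v] unfolding 1 complex_is_Real_iff by simp
  moreover have "Im (\<i> * (b - a)) = 0"
    using q[of "\<i> *s u + v"] q[of u] q[of v] unfolding 2 complex_is_Real_iff by simp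
  ultimately have "a = cnj b"
    by (simp add: complex_eq_iff)
  then show ?thesis
    by (simp add: a_def b_def cnj_hip)
qed

text \<open>First-order condition at a maximum: for a small \<open>t\<close> with the sign of
  \<open>b\<close>, the linear term would outweigh the quadratic one.\<close>

lemma quadratic_nonpos_imp_linear_zero:
  fixes b c :: real
  assumes "\<And>t. 2 * t * b + t\<^sup>2 * c \<le> 0"
  shows "b = 0"
proof (rule ccontr)
  assume "b \<noteq> 0"
  define s where "s = 1 / (\<bar>c\<bar> + 1)"
  have s: "s > 0" "s * \<bar>c\<bar> < 1"
    by (auto simp: s_def field_simps)
  have "s * c \<ge> - 1"
    using s by (smt (verit) mult_minus_right mult_left_mono)
  then have "0 < s * b\<^sup>2 * (2 + s * c)"
    using s \<open>b \<noteq> 0\<close> by simp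
  also have "\<dots> = 2 * (s * b) * b + (s * b)\<^sup>2 * c"
    by (simp add: power2_eq_square algebra_simps)
  finally show False
    using assms[of "s * b"] by simp
qed

lemma continuous_on_matrix_vector_mult:
  fixes A :: "complex ^ 'm ^ 'k"
  shows "continuous_on S (\<lambda>v. A *v v)"
  unfolding matrix_vector_mult_def by (intro continuous_on_vec_lambda continuous_intros)

text \<open>Maximize the Rayleigh quotient on the orthogonal complement of the eigenvectors
  found so far.\<close>

lemma next_eigenvector:
  fixes A :: "complex ^ 'm ^ 'm" and f :: "nat \<Rightarrow> complex ^ 'm"
  assumes A: "nonneg_definite A" and k: "k < CARD('m)"
    and on: "\<And>i j. i < k \<Longrightarrow> j < k \<Longrightarrow> hip (f i) (f j) = (if i = j then 1 else 0)"
    and ev: "\<And>i. i < k \<Longrightarrow> A *v f i = of_real (d i) *s f i"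
  shows "\<exists>v \<mu>. (\<forall>i<k. hip (f i) v = 0) \<and> hip v v = 1 \<and> A *v v = of_real \<mu> *s v"
proof -
  define V where "V = {v. \<forall>i<k. hip (f i) v = 0}"
  have "vec.dim (f ` {..<k}) \<le> card (f ` {..<k})"
    by (rule vec.dim_le_card') simp
  also have "\<dots> \<le> k"
    using card_image_le[of "{..<k}" f] by simp
  finally have "vec.span (f ` {..<k}) \<noteq> UNIV"
    using k vec.dim_span[of "f ` {..<k}"] vec_dim_card[where 'a=complex and 'n='m]
    by (metis leD)
  then obtain x where x: "x \<notin> vec.span (f ` {..<k})"
    by auto
  define u where "u = x - (\<Sum>i<k. hip (f i) x *s f i)"
  have "(\<Sum>i<k. hip (f i) x *s f i) \<in> vec.span (f ` {..<k})"
    by (intro vec.span_sum vec.span_scale vec.span_base) auto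
  then have u0: "u \<noteq> 0"
    using x by (auto simp: u_def)
  have "hip (f i) u = 0" if "i < k" for i
  proof -
    have "hip (f i) (\<Sum>j<k. hip (f j) x *s f j) = (\<Sum>j<k. hip (f j) x * (if i = j then 1 else 0))"
      using that on by (auto simp: hip_sum_right hip_scale_right intro!: sum.cong)
    also have "\<dots> = hip (f i) x"
      using that by (simp add: if_distrib [of "\<lambda>z. _ * z"] cong: if_cong)
    finally show ?thesis
      by (simp add: u_def hip_diff_right)
  qed
  then have "u \<in> V"
    by (simp add: V_def)
  have V_scaleR: "c *\<^sub>R v \<in> V" if "v \<in> V" for c :: real and v
  proof -
    have "c *\<^sub>R v = of_real c *s v"
      by (simp add: vec_eq_iff scaleR_conv_of_real[where 'a=complex])
    then show ?thesis
      using that by (simp add: V_def hip_scale_right)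
  qed
  have V_add: "v + v' \<in> V" if "v \<in> V" "v' \<in> V" for v v'
    using that by (simp add: V_def hip_add_right)
  have "V = (\<Inter>i\<in>{..<k}. {v. hip (f i) v = 0})"
    by (auto simp: V_def)
  also have "closed \<dots>"
    unfolding hip_def by (intro closed_INT ballI closed_Collect_eq continuous_intros)
  finally have "closed V" .
  then have comp: "compact (V \<inter> sphere 0 1)"
    by (intro closed_Int_compact compact_sphere)
  have ne: "V \<inter> sphere 0 1 \<noteq> {}"
    using V_scaleR[OF \<open>u \<in> V\<close>, of "1 / norm u"] u0 by auto
  define R where "R v = v \<bullet> (A *v v)" for v
  have "continuous_on (V \<inter> sphere 0 1) R"
    unfolding R_def by (intro continuous_intros continuous_on_matrix_vector_mult)
  from continuous_attains_sup[OF comp ne this] obtain v where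
    v: "v \<in> V" "norm v = 1" and max: "\<And>y. y \<in> V \<Longrightarrow> norm y = 1 \<Longrightarrow> R y \<le> R v"
    by auto
  define \<mu> where "\<mu> = R v"
  have Rle: "R y \<le> \<mu> * (norm y)\<^sup>2" if "y \<in> V" for y
  proof (cases "y = 0")
    case False
    have Rs: "R (c *\<^sub>R y) = c\<^sup>2 * R y" for c
    proof -
      have "A *v (c *\<^sub>R y) = c *\<^sub>R (A *v y)"
        by (simp add: vec_eq_iff matrix_vector_mult_def scaleR_sum_right)
      then show ?thesis
        by (simp add: R_def power2_eq_square)
    qed
    have "R ((1 / norm y) *\<^sub>R y) \<le> \<mu>"
      unfolding \<mu>_def using False V_scaleR[OF that] by (intro max) auto
    then show ?thesis
      using False by (simp add: Rs field_simps)
  qed (simp add: R_def matrix_vector_mult_0_right)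
  have vv: "v \<bullet> v = 1"
    using v(2) by (simp add: dot_square_norm)
  \<comment> \<open>The residual of the eigenvalue equation. It stays in \<open>V\<close> because
    \<open>A\<close> is Hermitian and maps each eigenvector found so far to a multiple of itself.
    Perturbing the maximizer \<open>v\<close> in the direction \<open>z\<close> has the first-order
    term \<open>z \<bullet> z\<close>, which must vanish.\<close>
  define z where "z = A *v v - \<mu> *\<^sub>R v"
  have "A *v v \<in> V"
    using v(1) ev nonneg_definite_hermitian[OF A] by (simp add: V_def hip_scale_left)
  then have zV: "z \<in> V"
    using V_add[OF _ V_scaleR[OF v(1), of "- \<mu>"]] by (simp add: z_def)
  have sym: "a \<bullet> (A *v b) = (A *v a) \<bullet> b" for a b
    using nonneg_definite_hermitian[OF A, of a b] by (metis Re_hip)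
  have "2 * t * (z \<bullet> z) + t\<^sup>2 * (R z - \<mu> * (norm z)\<^sup>2) \<le> 0" for t
  proof -
    have lin: "A *v (v + t *\<^sub>R z) = A *v v + t *\<^sub>R (A *v z)"
      by (simp add: vec_eq_iff matrix_vector_mult_def scaleR_sum_right algebra_simps sum.distrib)
    have "R (v + t *\<^sub>R z) = R v + 2 * t * (z \<bullet> (A *v v)) + t\<^sup>2 * R z"
      unfolding R_def lin using sym[of v z]
      by (simp add: inner_add_left inner_add_right power2_eq_square algebra_simps inner_commute)
    moreover have "(norm (v + t *\<^sub>R z))\<^sup>2 = 1 + 2 * t * (z \<bullet> v) + t\<^sup>2 * (norm z)\<^sup>2"
      unfolding power2_norm_eq_inner
      by (simp add: inner_add_left inner_add_right power2_eq_square algebra_simps inner_commute vv)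
    moreover have "v + t *\<^sub>R z \<in> V"
      using V_add V_scaleR v(1) zV by blast
    moreover have "z \<bullet> z = z \<bullet> (A *v v) - \<mu> * (z \<bullet> v)"
      by (simp add: z_def inner_diff_right)
    ultimately have "R v + 2 * t * (z \<bullet> (A *v v)) + t\<^sup>2 * R z \<le> R v * (1 + 2 * t * (z \<bullet> v) + t\<^sup>2 * (norm z)\<^sup>2)"
      and zz: "z \<bullet> z = z \<bullet> (A *v v) - R v * (z \<bullet> v)"
      using Rle[of "v + t *\<^sub>R z"] by (simp_all add: \<mu>_def)
    then show ?thesis
      unfolding zz \<mu>_def by (simp add: algebra_simps)
  qed
  then have "z \<bullet> z = 0"
    by (rule quadratic_nonpos_imp_linear_zero)
  then have "A *v v = of_real \<mu> *s v"
    by (simp add: z_def vec_eq_iff scaleR_conv_of_real[where 'a=complex])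
  moreover have "hip v v = 1"
    using v(2) by (simp add: hip_self)
  ultimately show ?thesis
    using v(1) by (auto simp: V_def)
qed

lemma orthonormal_eigenvectors:
  fixes A :: "complex ^ 'm ^ 'm"
  assumes A: "nonneg_definite A" and k: "k \<le> CARD('m)"
  shows "\<exists>(f :: nat \<Rightarrow> complex ^ 'm) d. (\<forall>i<k. \<forall>j<k. hip (f i) (f j) = (if i = j then 1 else 0)) \<and>
    (\<forall>i<k. A *v f i = of_real (d i) *s f i)"
  using k
proof (induction k)
  case (Suc k)
  then have "\<exists>(f :: nat \<Rightarrow> complex ^ 'm) d. (\<forall>i<k. \<forall>j<k. hip (f i) (f j) = (if i = j then 1 else 0)) \<and>
    (\<forall>i<k. A *v f i = of_real (d i) *s f i)"
    by simp
  then obtain f :: "nat \<Rightarrow> complex ^ 'm" and d where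
    on: "\<And>i j. i < k \<Longrightarrow> j < k \<Longrightarrow> hip (f i) (f j) = (if i = j then 1 else 0)"
    and ev: "\<And>i. i < k \<Longrightarrow> A *v f i = of_real (d i) *s f i"
    by blast
  obtain v \<mu> where v: "\<And>i. i < k \<Longrightarrow> hip (f i) v = 0" "hip v v = 1" "A *v v = of_real \<mu> *s v"
    using next_eigenvector[OF A Suc_le_lessD[OF Suc.prems] on ev] by blast
  have v': "hip v (f i) = 0" if "i < k" for i
    using v(1)[OF that] cnj_hip[of "f i" v] by simp
  show ?case
    using on ev v v'
    by (intro exI[of _ "f(k := v)"] exI[of _ "d(k := \<mu>)"]) (auto simp: less_Suc_eq)
qed simp

text \<open>\<open>mat_powr\<close> is a definite description: this is the existence half,
  \<open>diagonalization_powr_unique\<close> the uniqueness half.\<close>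

lemma nonneg_definite_diagonalization:
  fixes A :: "complex ^ 'm ^ 'm"
  assumes A: "nonneg_definite A"
  shows "\<exists>U d. unitary U \<and> (\<forall>i. 0 \<le> d i) \<and> A = U ** diag d ** adj U"
proof -
  obtain f :: "nat \<Rightarrow> complex ^ 'm" and d where
    on': "\<forall>i<CARD('m). \<forall>j<CARD('m). hip (f i) (f j) = (if i = j then 1 else 0)"
    and ev': "\<forall>i<CARD('m). A *v f i = of_real (d i) *s f i"
    using orthonormal_eigenvectors[OF A order_refl] by (elim exE conjE)
  note on = on'[rule_format] and ev = ev'[rule_format]
  obtain h :: "'m \<Rightarrow> nat" where "bij_betw h UNIV {0..<CARD('m)}"
    using ex_bij_betw_finite_nat[OF finite_class.finite_UNIV] by (elim exE)
  then have h: "h i < CARD('m)" "h i = h j \<longleftrightarrow> i = j" for i j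
    by (simp_all add: bij_betw_def inj_eq) (metis atLeastLessThan_iff rangeI)
  define U :: "complex ^ 'm ^ 'm" where "U = (\<chi> i j. f (h j) $ i)"
  have U: "unitary U"
  proof -
    have "(adj U ** U) $ i $ j = hip (f (h i)) (f (h j))" for i j
      by (simp add: U_def adj_def matrix_matrix_mult_def hip_def)
    then have "(adj U ** U) $ i $ j = mat 1 $ i $ j" for i j
      using h on[OF h(1) h(1), of i j] by (simp add: mat_def)
    then show ?thesis
      by (simp add: unitary_def vec_eq_iff)
  qed
  have "A ** U = U ** diag (\<lambda>i. d (h i))"
  proof -
    have "(A ** U) $ i $ j = (U ** diag (\<lambda>i. d (h i))) $ i $ j" for i j
    proof -
      have "(A ** U) $ i $ j = (A *v f (h j)) $ i"
        by (simp add: matrix_matrix_mult_def matrix_vector_mult_def U_def)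
      also have "\<dots> = of_real (d (h j)) * f (h j) $ i"
        using h by (simp add: ev)
      also have "\<dots> = (U ** diag (\<lambda>i. d (h i))) $ i $ j"
        by (simp add: matrix_matrix_mult_def diag_def U_def if_distrib [of "\<lambda>z. _ * z"] mult.commute
            cong: if_cong)
      finally show ?thesis .
    qed
    then show ?thesis
      by (simp add: vec_eq_iff)
  qed
  then have "A ** U ** adj U = U ** diag (\<lambda>i. d (h i)) ** adj U"
    by simp
  then have AU: "A = U ** diag (\<lambda>i. d (h i)) ** adj U"
    by (simp add: unitary_right[OF U] matrix_mul_assoc[symmetric])
  have d0: "0 \<le> d (h i)" for i
  proof -
    have "hip (f (h i)) (A *v f (h i)) = of_real (d (h i))"
      using h on by (simp add: ev hip_scale_right)
    moreover have "0 \<le> Re (hip (f (h i)) (A *v f (h i)))"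
      using A by (simp add: nonneg_definite_hip)
    ultimately show ?thesis
      by simp
  qed
  show ?thesis
    by (intro exI[of _ U] exI[of _ "\<lambda>i. d (h i)"] conjI allI U d0 AU)
qed

lemma mat_powr_diag:
  assumes "unitary U" "\<And>i. 0 \<le> d i"
  shows "mat_powr (U ** diag d ** adj U) a = U ** diag (\<lambda>i. d i powr a) ** adj U"
  unfolding mat_powr_def
proof (rule the_equality)
  show "\<exists>V e. unitary V \<and> (\<forall>i. 0 \<le> e i) \<and> U ** diag d ** adj U = V ** diag e ** adj V \<and>
      U ** diag (\<lambda>i. d i powr a) ** adj U = V ** diag (\<lambda>i. e i powr a) ** adj V"
    by (intro exI[of _ U] exI[of _ d] conjI allI assms refl)
next
  fix B
  assume "\<exists>V e. unitary V \<and> (\<forall>i. 0 \<le> e i) \<and> U ** diag d ** adj U = V ** diag e ** adj V \<and>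
      B = V ** diag (\<lambda>i. e i powr a) ** adj V"
  then obtain V e where V: "unitary V" and eq: "U ** diag d ** adj U = V ** diag e ** adj V"
    and B: "B = V ** diag (\<lambda>i. e i powr a) ** adj V"
    by (elim exE conjE)
  show "B = U ** diag (\<lambda>i. d i powr a) ** adj U"
    unfolding B by (rule diagonalization_powr_unique[OF assms(1) V eq, symmetric])
qed

section \<open>Continuity and measurability of matrix powers\<close>

lemma unitary_column_norm:
  fixes U :: "complex ^ 'm ^ 'm"
  assumes "unitary U"
  shows "(\<Sum>i\<in>UNIV. (cmod (U $ i $ j))\<^sup>2) = 1"
proof -
  have 1: "(adj U ** U) $ j $ j = 1"
    using assms unfolding unitary_def by (simp only: mat_def vec_lambda_beta if_True refl simp_thms)
  have "(adj U ** U) $ j $ j = (\<Sum>i\<in>UNIV. cnj (U $ i $ j) * U $ i $ j)"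
    by (simp only: matrix_matrix_mult_def adj_def vec_lambda_beta)
  also have "\<dots> = of_real (\<Sum>i\<in>UNIV. (cmod (U $ i $ j))\<^sup>2)"
    unfolding of_real_sum by (intro sum.cong refl cnj_mult_self)
  finally show ?thesis
    unfolding 1 by (metis of_real_eq_iff of_real_1)
qed

lemma unitary_entry_le:
  fixes U :: "complex ^ 'm ^ 'm"
  assumes "unitary U"
  shows "cmod (U $ i $ j) \<le> 1"
proof -
  have "(cmod (U $ i $ j))\<^sup>2 \<le> (\<Sum>i\<in>UNIV. (cmod (U $ i $ j))\<^sup>2)"
    by (rule member_le_sum) auto
  then have "(cmod (U $ i $ j))\<^sup>2 \<le> 1\<^sup>2"
    unfolding unitary_column_norm[OF assms] by simp
  then show ?thesis
    by (rule power2_le_imp_le) simp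
qed

lemma norm_le_sum_norm_nth: "norm x \<le> (\<Sum>i\<in>UNIV. norm (x $ i))"
  by (simp add: norm_vec_def L2_set_le_sum)

lemma compact_unitary: "compact {U :: complex ^ 'm ^ 'm. unitary U}"
proof (rule compact_eq_bounded_closed[THEN iffD2], intro conjI)
  show "bounded {U :: complex ^ 'm ^ 'm. unitary U}"
    unfolding bounded_iff
  proof (intro exI ballI)
    fix U :: "complex ^ 'm ^ 'm" assume "U \<in> {U. unitary U}"
    then have U: "unitary U"
      by simp
    have "norm U \<le> (\<Sum>i\<in>UNIV. norm (U $ i))"
      by (rule norm_le_sum_norm_nth)
    also have "\<dots> \<le> (\<Sum>i\<in>(UNIV :: 'm set). \<Sum>j\<in>(UNIV :: 'm set). 1)"
      by (intro sum_mono order_trans[OF norm_le_sum_norm_nth] unitary_entry_le[OF U])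
    finally show "norm U \<le> (\<Sum>i\<in>(UNIV :: 'm set). \<Sum>j\<in>(UNIV :: 'm set). 1)" .
  qed
  have "unitary U \<longleftrightarrow> (\<forall>i j. (\<Sum>k\<in>UNIV. cnj (U $ k $ i) * U $ k $ j) = (if i = j then 1 else 0))"
    for U :: "complex ^ 'm ^ 'm"
    by (simp only: unitary_def adj_def matrix_matrix_mult_def mat_def vec_eq_iff vec_lambda_beta)
  then have eq: "{U :: complex ^ 'm ^ 'm. unitary U} =
      {U. \<forall>i j. (\<Sum>k\<in>UNIV. cnj (U $ k $ i) * U $ k $ j) = (if i = j then 1 else 0)}"
    by (simp only:)
  show "closed {U :: complex ^ 'm ^ 'm. unitary U}"
    unfolding eq by (intro closed_Collect_all closed_Collect_eq continuous_on_sum continuous_on_mult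
        continuous_on_cnj continuous_on_component continuous_on_const continuous_on_id)
qed

text \<open>Written through diagonalizations rather than an order on matrices, so that it is visibly
  the image of the unitary matrices times a box.\<close>

definition psd_le :: "real \<Rightarrow> (complex ^ 'm ^ 'm) set" where
  "psd_le R = {U ** diag d ** adj U | U d. unitary U \<and> (\<forall>i. 0 \<le> d i \<and> d i \<le> R)}"

text \<open>The graph of the power function on \<open>psd_le R\<close> is a continuous image of a compact set.\<close>

lemma mat_powr_continuous_on:
  assumes "0 < a"
  shows "continuous_on (psd_le R :: (complex ^ 'm ^ 'm) set) (\<lambda>A. mat_powr A a)"
    and "compact (psd_le R :: (complex ^ 'm ^ 'm) set)"
proof -
  define K where "K = {U :: complex ^ 'm ^ 'm. unitary U} \<times> cbox 0 (\<chi> i. R :: real ^ 'm)"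
  define \<Phi> where "\<Phi> = (\<lambda>(U :: complex ^ 'm ^ 'm, v :: real ^ 'm). U ** diag (($) v) ** adj U)"
  define \<Psi> where "\<Psi> = (\<lambda>(U :: complex ^ 'm ^ 'm, v :: real ^ 'm). U ** diag (\<lambda>i. v $ i powr a) ** adj U)"
  have comp: "compact K"
    unfolding K_def by (intro compact_Times compact_unitary compact_cbox)
  have im: "psd_le R = \<Phi> ` K"
  proof (intro equalityI subsetI)
    fix A :: "complex ^ 'm ^ 'm" assume "A \<in> psd_le R"
    then obtain U d where *: "unitary U" "\<And>i. 0 \<le> d i \<and> d i \<le> R" "A = U ** diag d ** adj U"
      by (auto simp: psd_le_def)
    then have "(U, \<chi> i. d i) \<in> K" "A = \<Phi> (U, \<chi> i. d i)"
      by (auto simp: K_def \<Phi>_def mem_box_cart vec_lambda_inverse)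
    then show "A \<in> \<Phi> ` K"
      by blast
  next
    fix A :: "complex ^ 'm ^ 'm" assume "A \<in> \<Phi> ` K"
    then obtain x where x: "x \<in> K" "A = \<Phi> x"
      by (rule imageE)
    then have "unitary (fst x)" "\<forall>i. 0 \<le> snd x $ i \<and> snd x $ i \<le> R"
      "A = fst x ** diag (($) (snd x)) ** adj (fst x)"
      by (auto simp: K_def \<Phi>_def mem_box_cart case_prod_beta)
    then show "A \<in> psd_le R"
      unfolding psd_le_def by (intro CollectI exI[of _ "fst x"] exI[of _ "($) (snd x)"] conjI) auto
  qed
  have vi: "continuous_on K (\<lambda>x. snd x $ i)" for i
    by (intro continuous_on_component continuous_on_snd continuous_on_id)
  have cont1: "continuous_on K (\<lambda>x. diag (\<lambda>i. snd x $ i) :: complex ^ 'm ^ 'm)"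
    unfolding diag_def
  proof (intro continuous_on_vec_lambda)
    fix i j :: 'm
    show "continuous_on K (\<lambda>x. if i = j then complex_of_real (snd x $ i) else 0)"
      by (cases "i = j") (simp_all add: continuous_on_of_real vi)
  qed
  have cont2: "continuous_on K (\<lambda>x. diag (\<lambda>i. snd x $ i powr a) :: complex ^ 'm ^ 'm)"
    unfolding diag_def
  proof (intro continuous_on_vec_lambda)
    fix i j :: 'm
    \<comment> \<open>Eigenvalues may vanish here; the power is continuous at 0 because
      \<open>0 < a\<close>.\<close>
    have "continuous_on K (\<lambda>x. snd x $ i powr a)"
      using assms
      by (intro continuous_on_powr'[OF vi continuous_on_const]) (auto simp: K_def mem_box_cart)
    then show "continuous_on K (\<lambda>x. if i = j then complex_of_real (snd x $ i powr a) else 0)"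
      by (cases "i = j") (simp_all add: continuous_on_of_real)
  qed
  have mm: "continuous_on K (\<lambda>x. f x ** g x)" if "continuous_on K f" "continuous_on K g"
    for f g :: "_ \<Rightarrow> complex ^ 'm ^ 'm"
    unfolding matrix_matrix_mult_def
    by (intro continuous_on_vec_lambda continuous_on_sum continuous_on_mult continuous_on_component that)
  have fs: "continuous_on K fst"
    by (rule continuous_on_fst[OF continuous_on_id])
  have ad: "continuous_on K (\<lambda>x. adj (fst x))"
    unfolding adj_def
    by (intro continuous_on_vec_lambda continuous_on_cnj continuous_on_component fs)
  have c\<Phi>: "continuous_on K \<Phi>" and c\<Psi>: "continuous_on K \<Psi>"
    unfolding \<Phi>_def \<Psi>_def case_prod_beta
    by (rule mm[OF mm[OF fs cont1] ad], rule mm[OF mm[OF fs cont2] ad])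
  show "compact (psd_le R :: (complex ^ 'm ^ 'm) set)"
    unfolding im by (rule compact_continuous_image[OF c\<Phi> comp])
  have eq: "mat_powr (\<Phi> x) a = \<Psi> x" if "x \<in> K" for x
  proof -
    have "unitary (fst x)" "0 \<le> snd x $ i" for i
      using that by (auto simp: K_def mem_box_cart)
    then show ?thesis
      unfolding \<Phi>_def \<Psi>_def case_prod_beta by (rule mat_powr_diag)
  qed
  show "continuous_on (psd_le R :: (complex ^ 'm ^ 'm) set) (\<lambda>A. mat_powr A a)"
  proof (rule continuous_from_closed_graph)
    show "compact (\<Psi> ` K)"
      by (rule compact_continuous_image[OF c\<Psi> comp])
    show "(\<lambda>A. mat_powr A a) \<in> psd_le R \<rightarrow> \<Psi> ` K"
      unfolding im using eq by auto
    have eq': "(\<lambda>A. (A, mat_powr A a)) ` psd_le R = (\<lambda>x. (\<Phi> x, \<Psi> x)) ` K"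
      unfolding im image_image using eq by (intro image_cong) auto
    have "closed ((\<lambda>x. (\<Phi> x, \<Psi> x)) ` K)"
      by (intro compact_imp_closed compact_continuous_image[OF _ comp] continuous_on_Pair c\<Phi> c\<Psi>)
    then show "closed ((\<lambda>A :: complex ^ 'm ^ 'm. (A, mat_powr A a)) ` psd_le R)"
      unfolding eq' .
  qed
qed

lemma nonneg_definite_psd_le:
  assumes "nonneg_definite A"
  obtains R where "A \<in> psd_le R"
proof -
  obtain U d where *: "unitary U" "\<forall>i. 0 \<le> d i" "A = U ** diag d ** adj U"
    using nonneg_definite_diagonalization[OF assms] by (elim exE conjE)
  have "d i \<le> (\<Sum>i\<in>UNIV. d i)" for i
    using *(2) by (intro member_le_sum) auto
  then have "A \<in> psd_le (\<Sum>i\<in>UNIV. d i)"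
    unfolding psd_le_def using *
    by (intro CollectI exI[of _ U] exI[of _ d] conjI allI) auto
  then show ?thesis
    by (rule that)
qed

text \<open>Continuity of the power is available on the compact sets \<open>psd_le (real k)\<close>,
  which exhaust the nonnegative definite matrices. The functions cut off to these sets are
  eventually constant in \<open>k\<close> at each point.\<close>

lemma borel_measurable_mat_powr:
  fixes W :: "'a \<Rightarrow> complex ^ 'm ^ 'm"
  assumes W: "W \<in> borel_measurable N" and nd: "\<And>x. nonneg_definite (W x)" and a: "0 < a"
  shows "(\<lambda>x. mat_powr (W x) a) \<in> borel_measurable N"
proof (rule borel_measurable_LIMSEQ_metric)
  fix k :: nat
  have "psd_le (real k) \<in> sets (borel :: (complex ^ 'm ^ 'm) measure)"
    by (intro borel_compact mat_powr_continuous_on(2)[OF a])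
  then have "(\<lambda>A :: complex ^ 'm ^ 'm. indicat_real (psd_le (real k)) A *\<^sub>R mat_powr A a) \<in> borel_measurable borel"
    by (intro borel_measurable_continuous_on_indicator mat_powr_continuous_on(1)[OF a])
  then show "(\<lambda>x. indicat_real (psd_le (real k)) (W x) *\<^sub>R mat_powr (W x) a) \<in> borel_measurable N"
    using W by (rule measurable_compose[rotated])
next
  fix x
  obtain R where R: "W x \<in> psd_le R"
    using nonneg_definite_psd_le[OF nd] .
  have "W x \<in> psd_le (real k)" if "k \<ge> nat \<lceil>R\<rceil>" for k
  proof -
    have "R \<le> real k"
      using that by linarith
    obtain U d where Ud: "W x = U ** diag d ** adj U" "unitary U" "\<forall>i. 0 \<le> d i \<and> d i \<le> R"
      using R unfolding psd_le_def by (elim CollectE exE conjE)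
    have "\<forall>i. 0 \<le> d i \<and> d i \<le> real k"
      using Ud(3) \<open>R \<le> real k\<close> by (meson order_trans)
    with Ud show ?thesis
      unfolding psd_le_def by (intro CollectI exI[of _ U] exI[of _ d] conjI)
  qed
  then have "\<forall>\<^sub>F k in sequentially. indicat_real (psd_le (real k)) (W x) *\<^sub>R mat_powr (W x) a = mat_powr (W x) a"
    unfolding eventually_sequentially by (intro exI[of _ "nat \<lceil>R\<rceil>"] allI impI) simp
  then show "(\<lambda>k. indicat_real (psd_le (real k)) (W x) *\<^sub>R mat_powr (W x) a) \<longlonglongrightarrow> mat_powr (W x) a"
    by (rule tendsto_eventually)
qed

section \<open>The operator norm and its control by the trace\<close>

definition entry_sum :: "complex ^ 'm ^ 'm \<Rightarrow> real" where
  "entry_sum A = (\<Sum>i\<in>UNIV. \<Sum>j\<in>UNIV. cmod (A $ i $ j))"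

lemma norm_matrix_vector_le:
  fixes A :: "complex ^ 'm ^ 'm"
  shows "norm (A *v v) \<le> entry_sum A * norm v"
proof -
  have "norm (A *v v) \<le> (\<Sum>i\<in>UNIV. norm ((A *v v) $ i))"
    by (rule norm_le_sum_norm_nth)
  also have "\<dots> \<le> (\<Sum>i\<in>UNIV. \<Sum>j\<in>UNIV. cmod (A $ i $ j) * norm v)"
  proof (rule sum_mono)
    fix i
    have "norm ((A *v v) $ i) \<le> (\<Sum>j\<in>UNIV. cmod (A $ i $ j * v $ j))"
      unfolding matrix_vector_mult_def by (simp add: norm_sum)
    also have "\<dots> \<le> (\<Sum>j\<in>UNIV. cmod (A $ i $ j) * norm v)"
      by (intro sum_mono) (simp add: norm_mult mult_left_mono Finite_Cartesian_Product.norm_nth_le)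
    finally show "norm ((A *v v) $ i) \<le> (\<Sum>j\<in>UNIV. cmod (A $ i $ j) * norm v)" .
  qed
  also have "\<dots> = entry_sum A * norm v"
    by (simp add: entry_sum_def sum_distrib_right)
  finally show ?thesis .
qed

lemma bounded_linear_matrix_vector: "bounded_linear (\<lambda>v. (A :: complex ^ 'm ^ 'm) *v v)"
proof (rule bounded_linear_intro)
  show "A *v (x + y) = A *v x + A *v y" for x y
    by (rule matrix_vector_right_distrib)
  show "A *v (r *\<^sub>R x) = r *\<^sub>R (A *v x)" for r x
    by (simp add: vec_eq_iff matrix_vector_mult_def scaleR_sum_right)
  show "norm (A *v x) \<le> norm x * entry_sum A" for x
    using norm_matrix_vector_le[of A x] by (simp add: mult.commute)
qed

lemma opnorm_nonneg: "0 \<le> opnorm A"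
  unfolding opnorm_def by (rule onorm_pos_le[OF bounded_linear_matrix_vector])

lemma opnorm_le_entry_sum: "opnorm A \<le> entry_sum A"
  unfolding opnorm_def by (rule onorm_le) (rule norm_matrix_vector_le)

lemma opnorm_zero [simp]: "opnorm 0 = 0"
  by (simp add: opnorm_def onorm_zero)

lemma opnorm_diff_le: "opnorm A - opnorm B \<le> entry_sum (A - B)"
proof -
  have "opnorm A = onorm (\<lambda>v. (A - B) *v v + B *v v)"
    by (simp add: opnorm_def matrix_vector_mult_diff_rdistrib)
  also have "\<dots> \<le> opnorm (A - B) + opnorm B"
    unfolding opnorm_def by (intro onorm_triangle bounded_linear_matrix_vector)
  finally show ?thesis
    using opnorm_le_entry_sum[of "A - B"] by simp
qed

lemma continuous_on_opnorm: "continuous_on UNIV (opnorm :: complex ^ 'm ^ 'm \<Rightarrow> real)"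
proof -
  have "isCont (opnorm :: complex ^ 'm ^ 'm \<Rightarrow> real) A" for A :: "complex ^ 'm ^ 'm"
  proof -
    have es: "continuous_on UNIV (\<lambda>B :: complex ^ 'm ^ 'm. entry_sum (A - B) + entry_sum (B - A))"
      unfolding entry_sum_def by (intro continuous_intros)
    have "((\<lambda>B. entry_sum (A - B) + entry_sum (B - A)) \<longlongrightarrow> entry_sum (A - A) + entry_sum (A - A)) (at A)"
      using es unfolding continuous_on_def by (rule bspec) (rule UNIV_I)
    then have 0: "((\<lambda>B. entry_sum (A - B) + entry_sum (B - A)) \<longlongrightarrow> 0) (at A)"
      by (simp add: entry_sum_def)
    have "((\<lambda>B. opnorm B - opnorm A) \<longlongrightarrow> 0) (at A)"
    proof (rule Lim_null_comparison[OF always_eventually 0], rule allI)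
      fix B
      have "0 \<le> entry_sum (A - B)" "0 \<le> entry_sum (B - A)"
        by (auto simp: entry_sum_def intro!: sum_nonneg)
      then show "norm (opnorm B - opnorm A) \<le> entry_sum (A - B) + entry_sum (B - A)"
        using opnorm_diff_le[of A B] opnorm_diff_le[of B A] by simp
    qed
    then show ?thesis
      by (simp add: isCont_def LIM_zero_iff)
  qed
  then show ?thesis
    by (simp add: continuous_at_imp_continuous_on)
qed

text \<open>The trace dominates every eigenvalue, and the exponent \<open>p\<close> undoes the power
  \<open>1 / p\<close>: the bound is linear in the entries of \<open>A\<close>, so local
  integrability passes from \<open>W\<close> to the scalar weights. In the cube of
  \<open>CARD('m)\<close>, one factor comes from the sum over eigenvalues in an entry of
  \<open>P\<close>, two from summing over all entries of the product.\<close>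

lemma opnorm_mat_powr_bound:
  fixes A M :: "complex ^ 'm ^ 'm"
  assumes A: "nonneg_definite A" and p: "0 < p"
  shows "0 \<le> (\<Sum>i\<in>UNIV. Re (A $ i $ i))"
    and "opnorm (mat_powr A (1 / p) ** M) powr p
      \<le> (real CARD('m) ^ 3 * entry_sum M) powr p * (\<Sum>i\<in>UNIV. Re (A $ i $ i))"
proof -
  obtain U d where U: "unitary U" and d': "\<forall>i. 0 \<le> d i" and AU: "A = U ** diag d ** adj U"
    using nonneg_definite_diagonalization[OF A] by (elim exE conjE)
  note d = d'[rule_format]
  have entry: "(U ** diag e ** adj U) $ i $ j = (\<Sum>k\<in>UNIV. U $ i $ k * of_real (e k) * cnj (U $ j $ k))"
    for e i j
    by (simp add: matrix_matrix_mult_def diag_def adj_def if_distrib [of "\<lambda>z. _ * z"] cong: if_cong)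
  define \<tau> where "\<tau> = (\<Sum>i\<in>UNIV. d i)"
  have "(\<Sum>i\<in>UNIV. A $ i $ i) = (\<Sum>i\<in>UNIV. \<Sum>k\<in>UNIV. of_real (d k * (cmod (U $ i $ k))\<^sup>2))"
    unfolding AU entry of_real_mult cnj_mult_self[symmetric]
    by (intro sum.cong refl) (simp only: mult_ac)
  also have "\<dots> = (\<Sum>k\<in>UNIV. of_real (d k * (\<Sum>i\<in>UNIV. (cmod (U $ i $ k))\<^sup>2)))"
    by (subst sum.swap) (simp add: sum_distrib_left)
  also have "\<dots> = of_real \<tau>"
    by (simp add: unitary_column_norm[OF U] \<tau>_def)
  finally have tr: "(\<Sum>i\<in>UNIV. Re (A $ i $ i)) = \<tau>"
    by (metis Re_sum Re_complex_of_real)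
  have \<tau>0: "0 \<le> \<tau>"
    using d by (simp add: \<tau>_def sum_nonneg)
  then show "0 \<le> (\<Sum>i\<in>UNIV. Re (A $ i $ i))"
    by (simp add: tr)
  define P where "P = mat_powr A (1 / p)"
  have P: "P = U ** diag (\<lambda>i. d i powr (1 / p)) ** adj U"
    unfolding P_def AU by (rule mat_powr_diag[OF U d])
  have Pe: "cmod (P $ i $ j) \<le> real CARD('m) * \<tau> powr (1 / p)" for i j
  proof -
    have "cmod (P $ i $ j) \<le> (\<Sum>k\<in>UNIV. cmod (U $ i $ k) * (d k powr (1 / p)) * cmod (U $ j $ k))"
      unfolding P entry by (rule order_trans[OF norm_sum]) (simp add: norm_mult)
    also have "\<dots> \<le> (\<Sum>k\<in>(UNIV :: 'm set). 1 * \<tau> powr (1 / p) * 1)"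
    proof (intro sum_mono mult_mono unitary_entry_le[OF U])
      fix k
      have "d k \<le> \<tau>"
        unfolding \<tau>_def using d by (intro member_le_sum) auto
      then show "d k powr (1 / p) \<le> \<tau> powr (1 / p)"
        using d p by (intro powr_mono2) auto
    qed auto
    finally show ?thesis
      by simp
  qed
  have "opnorm (P ** M) \<le> entry_sum (P ** M)"
    by (rule opnorm_le_entry_sum)
  also have "\<dots> \<le> (\<Sum>i\<in>(UNIV :: 'm set). \<Sum>j\<in>(UNIV :: 'm set). real CARD('m) * \<tau> powr (1 / p) * entry_sum M)"
    unfolding entry_sum_def[of "P ** M"]
  proof (intro sum_mono)
    fix i j
    have "cmod ((P ** M) $ i $ j) \<le> (\<Sum>k\<in>UNIV. cmod (P $ i $ k) * cmod (M $ k $ j))"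
      unfolding matrix_matrix_mult_def by (simp, rule order_trans[OF norm_sum]) (simp add: norm_mult)
    also have "\<dots> \<le> (\<Sum>k\<in>UNIV. (real CARD('m) * \<tau> powr (1 / p)) * (\<Sum>j\<in>UNIV. cmod (M $ k $ j)))"
    proof (intro sum_mono mult_mono Pe)
      show "cmod (M $ k $ j) \<le> (\<Sum>j\<in>UNIV. cmod (M $ k $ j))" for k
        by (rule member_le_sum) auto
    qed auto
    finally show "cmod ((P ** M) $ i $ j) \<le> real CARD('m) * \<tau> powr (1 / p) * entry_sum M"
      by (simp add: entry_sum_def sum_distrib_left)
  qed
  also have "\<dots> = (real CARD('m) ^ 3 * entry_sum M) * \<tau> powr (1 / p)"
    by (simp add: power3_eq_cube)
  finally have "opnorm (P ** M) powr p \<le> ((real CARD('m) ^ 3 * entry_sum M) * \<tau> powr (1 / p)) powr p"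
    using p opnorm_nonneg by (intro powr_mono2) auto
  also have "\<dots> = (real CARD('m) ^ 3 * entry_sum M) powr p * (\<tau> powr (1 / p)) powr p"
    by (rule powr_mult)
  also have "(\<tau> powr (1 / p)) powr p = \<tau>"
    using p \<tau>0 by (simp add: powr_powr)
  finally show "opnorm (mat_powr A (1 / p) ** M) powr p
      \<le> (real CARD('m) ^ 3 * entry_sum M) powr p * (\<Sum>i\<in>UNIV. Re (A $ i $ i))"
    by (simp add: P_def tr)
qed

section \<open>Running maxima of dyadic averages\<close>

text \<open>Half-open, so that the halves of a cube partition it exactly and every point has a
  unique chain of dyadic cubes.\<close>

definition hc :: "real ^ 'n \<Rightarrow> real \<Rightarrow> (real ^ 'n) set" where
  "hc c s = {x. \<forall>i. c $ i \<le> x $ i \<and> x $ i < c $ i + s}"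

definition av :: "(real ^ 'n \<Rightarrow> real) \<Rightarrow> real ^ 'n \<Rightarrow> real \<Rightarrow> real" where
  "av w c s = (LINT x:hc c s|lborel. w x) / s ^ CARD('n)"

text \<open>Makes sense for every \<open>x\<close>, inside the cube or not; therefore
  \<open>Mx\<close> is a Borel function on the whole space and no domain has to be carried
  along.\<close>

definition child :: "real ^ 'n \<Rightarrow> real \<Rightarrow> real ^ 'n \<Rightarrow> real ^ 'n" where
  "child c s x = (\<chi> i. if x $ i < c $ i + s / 2 then c $ i else c $ i + s / 2)"

definition kids :: "real ^ 'n \<Rightarrow> real \<Rightarrow> (real ^ 'n) set" where
  "kids c s = (\<lambda>I. \<chi> i. if i \<in> I then c $ i else c $ i + s / 2) ` UNIV"

text \<open>\<open>Mx w N c s l x\<close> is the maximum of \<open>l\<close> and of the averages of \<open>w\<close> over the dyadic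
  descendants of \<open>hc c s\<close> of the generations \<open>1, \<dots>, N\<close> that contain \<open>x\<close>.\<close>

primrec Mx :: "(real ^ 'n \<Rightarrow> real) \<Rightarrow> nat \<Rightarrow> real ^ 'n \<Rightarrow> real \<Rightarrow> real \<Rightarrow> real ^ 'n \<Rightarrow> real" where
  "Mx w 0 c s l x = l"
| "Mx w (Suc N) c s l x = Mx w N (child c s x) (s / 2) (max l (av w (child c s x) (s / 2))) x"

lemma hc_borel [measurable]: "hc c s \<in> sets borel"
proof -
  have "hc c s = (\<Inter>i. {x. c $ i \<le> x $ i} \<inter> {x. x $ i < c $ i + s})"
    by (auto simp: hc_def)
  also have "\<dots> \<in> sets borel"
    by (intro sets.countable_INT' borel_closed borel_open sets.Int closed_Collect_le open_Collect_less
        continuous_intros) auto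
  finally show ?thesis .
qed

lemma box_subset_hc: "box c (c + vec s) \<subseteq> hc c s"
  and hc_subset_cbox: "hc c s \<subseteq> cbox c (c + vec s)"
  by (auto simp: hc_def mem_box_cart less_imp_le)

lemma emeasure_cube_cart:
  fixes c :: "real ^ 'n"
  assumes "0 \<le> s"
  shows "vol (box c (c + vec s)) = ennreal (s ^ CARD('n))"
    and "vol (cbox c (c + vec s)) = ennreal (s ^ CARD('n))"
proof -
  have *: "vec s \<bullet> b = s" if "b \<in> Basis" for b :: "real ^ 'n"
    using that by (auto simp: Basis_vec_def inner_axis)
  then have p: "(\<Prod>b\<in>(Basis :: (real ^ 'n) set). (c + vec s - c) \<bullet> b) = s ^ CARD('n)"
    by simp
  show "vol (box c (c + vec s)) = ennreal (s ^ CARD('n))"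
    using assms * p by (subst emeasure_lborel_box) (auto simp: inner_add_left)
  show "vol (cbox c (c + vec s)) = ennreal (s ^ CARD('n))"
    using assms * p by (subst emeasure_lborel_cbox) (auto simp: inner_add_left)
qed

lemma emeasure_hc:
  fixes c :: "real ^ 'n"
  assumes "0 \<le> s"
  shows "vol (hc c s) = ennreal (s ^ CARD('n))"
  using emeasure_mono[OF box_subset_hc[of c s], of lborel] emeasure_mono[OF hc_subset_cbox[of c s], of lborel]
  by (simp add: emeasure_cube_cart assms)

lemma child_in_kids: "child c s x \<in> kids c s"
  unfolding child_def kids_def by (rule image_eqI[of _ _ "{i. x $ i < c $ i + s / 2}"]) auto

lemma finite_kids: "finite (kids c s)"
  unfolding kids_def by simp

lemma mem_hc_child: "x \<in> hc c s \<Longrightarrow> x \<in> hc (child c s x) (s / 2)"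
  by (auto simp: hc_def child_def) (metis add.commute)

lemma child_eq:
  assumes "c' \<in> kids c s" "x \<in> hc c' (s / 2)"
  shows "child c s x = c'"
proof -
  obtain I where I: "c' = (\<chi> i. if i \<in> I then c $ i else c $ i + s / 2)"
    using assms(1) by (auto simp: kids_def)
  have "child c s x $ i = c' $ i" for i
    using assms(2)[unfolded hc_def I, simplified, rule_format, of i]
    by (auto simp: child_def I split: if_splits)
  then show ?thesis
    by (simp add: vec_eq_iff)
qed

lemma hc_kid_subset: "c' \<in> kids c s \<Longrightarrow> 0 < s \<Longrightarrow> hc c' (s / 2) \<subseteq> hc c s"
proof
  fix x
  assume c': "c' \<in> kids c s" "0 < s" and x: "x \<in> hc c' (s / 2)"
  obtain I where I: "c' = (\<chi> i. if i \<in> I then c $ i else c $ i + s / 2)"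
    using c'(1) by (auto simp: kids_def)
  have "c $ i \<le> x $ i \<and> x $ i < c $ i + s" for i
    using x[unfolded hc_def I, simplified, rule_format, of i] c'(2)
    by (auto split: if_splits)
  then show "x \<in> hc c s"
    by (simp add: hc_def)
qed

lemma measurable_child [measurable]: "child c s \<in> borel \<rightarrow>\<^sub>M count_space (kids c s)"
proof (subst measurable_count_space_eq2[OF finite_kids], intro conjI ballI)
  show "child c s \<in> space borel \<rightarrow> kids c s"
    using child_in_kids by auto
next
  fix a
  have "child c s -` {a} \<inter> space borel =
      (\<Inter>i. {x. (x $ i < c $ i + s / 2 \<longrightarrow> a $ i = c $ i) \<and> (\<not> x $ i < c $ i + s / 2 \<longrightarrow> a $ i = c $ i + s / 2)})"
    by (auto simp: child_def vec_eq_iff)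
  also have "\<dots> \<in> sets borel"
  proof (intro sets.countable_INT' image_subsetI)
    fix i
    have "(\<lambda>x. x $ i) \<in> borel_measurable (borel :: (real ^ 'a) measure)"
      by (intro borel_measurable_continuous_onI continuous_intros)
    then show "{x. (x $ i < c $ i + s / 2 \<longrightarrow> a $ i = c $ i) \<and> (\<not> x $ i < c $ i + s / 2 \<longrightarrow> a $ i = c $ i + s / 2)} \<in> sets borel"
      by measurable
  qed auto
  finally show "child c s -` {a} \<inter> space borel \<in> sets borel" .
qed

lemma borel_measurable_Mx [measurable]: "Mx w N c s l \<in> borel_measurable borel"
proof (induction N arbitrary: c s l)
  case 0
  have "Mx w 0 c s l = (\<lambda>_. l)"
    by (simp add: fun_eq_iff)
  then show ?case
    by simp
next
  case (Suc N)
  have "(\<lambda>x. (\<lambda>c' x. Mx w N c' (s / 2) (max l (av w c' (s / 2))) x) (child c s x) x) \<in> borel_measurable borel"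
    by (rule measurable_compose_countable'[OF _ measurable_child])
      (use Suc in \<open>auto simp: countable_finite[OF finite_kids]\<close>)
  then show ?case
    by simp
qed

lemma Mx_ge: "l \<le> Mx w N c s l x"
  by (induction N arbitrary: c s l) (auto intro: order_trans[OF max.cobounded1])

lemma Mx_le_Suc: "Mx w N c s l x \<le> Mx w (Suc N) c s l x"
proof (induction N arbitrary: c s l)
  case (Suc N)
  show ?case
    using Suc[of "child c s x" "s / 2"] by (simp only: Mx.simps)
qed simp

lemma Mx_mono: "N \<le> N' \<Longrightarrow> Mx w N c s l x \<le> Mx w N' c s l x"
  by (rule lift_Suc_mono_le[where f = "\<lambda>N. Mx w N c s l x"]) (rule Mx_le_Suc)

lemma Mx_le:
  assumes "l \<le> u" "0 < s" "x \<in> hc c s"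
    and "\<And>c' s'. 0 < s' \<Longrightarrow> hc c' s' \<subseteq> hc c s \<Longrightarrow> x \<in> hc c' s' \<Longrightarrow> av w c' s' \<le> u"
  shows "Mx w N c s l x \<le> u"
  using assms
proof (induction N arbitrary: c s l)
  case (Suc N)
  have sub: "hc (child c s x) (s / 2) \<subseteq> hc c s"
    using Suc.prems hc_kid_subset child_in_kids by blast
  show ?case
    unfolding Mx.simps using Suc.prems sub mem_hc_child[OF Suc.prems(3)]
    by (intro Suc.IH) auto
qed simp

lemma nn_integral_hc_kids:
  fixes f :: "real ^ 'n \<Rightarrow> ennreal"
  assumes [measurable]: "f \<in> borel_measurable borel" and s: "0 < s"
  shows "(\<integral>\<^sup>+x\<in>hc c s. f x \<partial>lborel) = (\<Sum>c'\<in>kids c s. \<integral>\<^sup>+x\<in>hc c' (s / 2). f x \<partial>lborel)"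
proof -
  have ind: "indicator (hc c s) x = (\<Sum>c'\<in>kids c s. indicator (hc c' (s / 2)) x :: ennreal)" for x
  proof (cases "x \<in> hc c s")
    case True
    have "(\<Sum>c'\<in>kids c s. indicator (hc c' (s / 2)) x :: ennreal) =
        (\<Sum>c'\<in>kids c s. if c' = child c s x then 1 else 0)"
      using child_eq mem_hc_child[OF True] by (intro sum.cong) (auto simp: indicator_def)
    then show ?thesis
      using True by (simp add: finite_kids child_in_kids)
  next
    case False
    then have "x \<notin> hc c' (s / 2)" if "c' \<in> kids c s" for c'
      using hc_kid_subset[OF that s] by auto
    with False show ?thesis
      by simp
  qed
  show ?thesis
    unfolding ind by (simp add: sum_distrib_left nn_integral_sum)
qed

text \<open>The setting for a scalar weight after it has been made Borel on a null set and cut off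
  to one cube, hence globally integrable.\<close>

locale weight_density =
  fixes w :: "real ^ 'n \<Rightarrow> real"
  assumes w_nonneg: "0 \<le> w x"
    and w_integrable: "integrable lborel w"
begin

abbreviation wvol :: "(real ^ 'n) set \<Rightarrow> ennreal" where
  "wvol S \<equiv> (\<integral>\<^sup>+x\<in>S. ennreal (w x) \<partial>lborel)"

abbreviation wint :: "(real ^ 'n) set \<Rightarrow> (real ^ 'n \<Rightarrow> real) \<Rightarrow> ennreal" where
  "wint S h \<equiv> (\<integral>\<^sup>+x\<in>S. ennreal (w x * h x) \<partial>lborel)"

lemma w_borel [measurable]: "w \<in> borel_measurable borel"
  using borel_measurable_integrable[OF w_integrable] by simp

lemma set_integrable_w: "B \<in> sets borel \<Longrightarrow> set_integrable lborel B w"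
  unfolding set_integrable_def by (intro integrable_mult_indicator w_integrable) auto

lemma nn_integral_w:
  assumes "B \<in> sets borel"
  shows "wvol B = ennreal (LINT x:B|lborel. w x)"
proof -
  have "wvol B = (\<integral>\<^sup>+x. ennreal (indicator B x *\<^sub>R w x) \<partial>lborel)"
    by (intro nn_integral_cong) (auto simp: indicator_def)
  also have "\<dots> = ennreal (LINT x:B|lborel. w x)"
    unfolding set_lebesgue_integral_def using set_integrable_w[OF assms] w_nonneg
    by (intro nn_integral_eq_integral) (auto simp: set_integrable_def)
  finally show ?thesis .
qed

definition mass :: "real ^ 'n \<Rightarrow> real \<Rightarrow> real" where
  "mass c s = (LINT x:hc c s|lborel. w x)"

lemma mass_nonneg: "0 \<le> mass c s"
  unfolding mass_def set_lebesgue_integral_def using w_nonneg by simp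

lemma av_mass: "av w c s = mass c s / s ^ CARD('n)"
  by (simp add: av_def mass_def)

lemma av_nonneg: "0 < s \<Longrightarrow> 0 \<le> av w c s"
  by (simp add: av_mass mass_nonneg)

lemma mass_av: "0 < s \<Longrightarrow> mass c s = av w c s * s ^ CARD('n)"
  by (simp add: av_mass)

lemma nn_integral_w_hc: "wvol (hc c s) = ennreal (mass c s)"
  by (simp add: nn_integral_w mass_def)

lemma mass_mono: "hc c' s' \<subseteq> hc c s \<Longrightarrow> mass c' s' \<le> mass c s"
proof -
  assume "hc c' s' \<subseteq> hc c s"
  then have "wvol (hc c' s') \<le> (wvol (hc c s))"
    by (intro nn_integral_mono) (auto simp: indicator_def)
  then show ?thesis
    by (simp add: nn_integral_w_hc mass_nonneg)
qed

lemma av_kid_le: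
  assumes "c' \<in> kids c s" "0 < s"
  shows "av w c' (s / 2) \<le> 2 ^ CARD('n) * av w c s"
  using mass_mono[OF hc_kid_subset[OF assms]] assms(2)
  by (simp add: av_mass power_divide field_simps)

text \<open>After the running maximum has jumped from \<open>l\<close> to \<open>l'\<close> an
  induction continues with base \<open>l'\<close>; the jump costs \<open>ln (l' / l)\<close> on the
  whole mass of the cube.\<close>

lemma nn_integral_ln_shift:
  assumes f [measurable]: "f \<in> borel_measurable borel" and f_ge: "\<And>x. l' \<le> f x" and l: "0 < l" "l \<le> l'"
  shows "(wint (hc c s) (\<lambda>x. ln (f x / l))) =
    ennreal (ln (l' / l) * mass c s) + (wint (hc c s) (\<lambda>x. ln (f x / l')))"
proof -
  have "ennreal (w x * ln (f x / l)) = ennreal (ln (l' / l)) * ennreal (w x) + ennreal (w x * ln (f x / l'))" for x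
  proof -
    have "0 < f x"
      using f_ge[of x] l by linarith
    then have "ln (f x / l) = ln (l' / l) + ln (f x / l')"
      using l by (simp add: ln_div)
    moreover have "0 \<le> ln (l' / l)" "0 \<le> ln (f x / l')"
      using l f_ge[of x] by auto
    ultimately show ?thesis
      using w_nonneg by (simp add: ennreal_plus[symmetric] ennreal_mult[symmetric] algebra_simps del: ennreal_plus)
  qed
  then have "(wint (hc c s) (\<lambda>x. ln (f x / l))) =
      (\<integral>\<^sup>+x. ennreal (ln (l' / l)) * (ennreal (w x) * indicator (hc c s) x) + ennreal (w x * ln (f x / l')) * indicator (hc c s) x \<partial>lborel)"
    by (simp add: algebra_simps)
  also have "\<dots> = ennreal (ln (l' / l)) * ennreal (mass c s) + (wint (hc c s) (\<lambda>x. ln (f x / l')))"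
    by (simp add: nn_integral_add nn_integral_cmult nn_integral_w_hc)
  finally show ?thesis
    using l mass_nonneg by (simp add: ennreal_mult)
qed

lemma nn_integral_diff_shift:
  fixes c :: "real ^ 'n"
  assumes f [measurable]: "f \<in> borel_measurable borel" and f_ge: "\<And>x. l' \<le> f x" and l: "l \<le> l'" and s: "0 < s"
  shows "(\<integral>\<^sup>+x\<in>hc c s. ennreal (f x - l) \<partial>lborel) =
    ennreal ((l' - l) * s ^ CARD('n)) + (\<integral>\<^sup>+x\<in>hc c s. ennreal (f x - l') \<partial>lborel)"
proof -
  have "ennreal (f x - l) = ennreal (l' - l) + ennreal (f x - l')" for x
    using l f_ge[of x] by (simp add: ennreal_plus[symmetric] del: ennreal_plus)
  then have "(\<integral>\<^sup>+x\<in>hc c s. ennreal (f x - l) \<partial>lborel) =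
      (\<integral>\<^sup>+x. ennreal (l' - l) * indicator (hc c s) x + ennreal (f x - l') * indicator (hc c s) x \<partial>lborel)"
    by (simp add: algebra_simps)
  also have "\<dots> = ennreal (l' - l) * ennreal (s ^ CARD('n)) + (\<integral>\<^sup>+x\<in>hc c s. ennreal (f x - l') \<partial>lborel)"
    using s by (simp add: nn_integral_add nn_integral_cmult_indicator emeasure_hc)
  finally show ?thesis
    using l s by (simp add: ennreal_mult)
qed

text \<open>On a child where the running maximum jumps from \<open>l\<close> to \<open>t * l\<close>, the logarithm gains
  \<open>ln t\<close> per unit of mass, and the maximum gains \<open>1 - 1 / t\<close>.\<close>

lemma log_maximum_le_maximum:
  assumes g: "\<And>t. 1 \<le> t \<Longrightarrow> t \<le> 2 ^ CARD('n) \<Longrightarrow> t * ln t \<le> g * (t - 1)"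
    and "0 \<le> g" "0 < s" "0 < l" "av w c s \<le> l"
  shows "(wint (hc c s) (\<lambda>x. ln (Mx w N c s l x / l)))
    \<le> ennreal g * (\<integral>\<^sup>+x\<in>hc c s. ennreal (Mx w N c s l x - l) \<partial>lborel)"
  using assms(3-)
proof (induction N arbitrary: c s l)
  case (Suc N)
  have "(wint (hc c' (s / 2)) (\<lambda>x. ln (Mx w (Suc N) c s l x / l)))
      \<le> ennreal g * (\<integral>\<^sup>+x\<in>hc c' (s / 2). ennreal (Mx w (Suc N) c s l x - l) \<partial>lborel)"
    if c': "c' \<in> kids c s" for c'
  proof -
    define a where "a = av w c' (s / 2)"
    define l' where "l' = max l a"
    have s2: "0 < s / 2"
      using Suc.prems by simp
    have l': "0 < l'" "l \<le> l'" "a \<le> l'"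
      using Suc.prems by (auto simp: l'_def)
    have eq: "Mx w (Suc N) c s l x = Mx w N c' (s / 2) l' x" if "x \<in> hc c' (s / 2)" for x
      using child_eq[OF c' that] by (simp add: l'_def a_def)
    have jump: "ln (l' / l) * mass c' (s / 2) \<le> g * ((l' - l) * (s / 2) ^ CARD('n))"
    proof (cases "a \<le> l")
      case False
      then have l'a: "l' = a"
        by (simp add: l'_def)
      \<comment> \<open>The parent has average at most \<open>l\<close>, so a jump never exceeds the
        volume ratio 2^n; this is why \<open>g\<close> is tested on [1, 2^n] only.\<close>
      have "a \<le> 2 ^ CARD('n) * l"
        using av_kid_le[OF c' Suc.prems(1)] Suc.prems(3)
        by (smt (verit) a_def mult_left_mono zero_le_power)
      then have "(a / l) * ln (a / l) \<le> g * (a / l - 1)"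
        using False Suc.prems by (intro g) (auto simp: field_simps)
      then have "(a / l) * ln (a / l) * (l * (s / 2) ^ CARD('n)) \<le> g * (a / l - 1) * (l * (s / 2) ^ CARD('n))"
        using Suc.prems by (intro mult_right_mono) auto
      moreover have "(a / l) * ln (a / l) * (l * (s / 2) ^ CARD('n)) = ln (a / l) * mass c' (s / 2)"
        using Suc.prems mass_av[OF s2, of c'] by (simp add: a_def)
      moreover have "g * (a / l - 1) * (l * (s / 2) ^ CARD('n)) = g * ((a - l) * (s / 2) ^ CARD('n))"
        using Suc.prems by (simp add: field_simps)
      ultimately show ?thesis
        unfolding l'a by linarith
    qed (use Suc.prems in \<open>auto simp: l'_def max_def\<close>)
    have "(wint (hc c' (s / 2)) (\<lambda>x. ln (Mx w (Suc N) c s l x / l))) =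
        (wint (hc c' (s / 2)) (\<lambda>x. ln (Mx w N c' (s / 2) l' x / l)))"
      using eq by (intro nn_integral_cong) (auto simp: indicator_def)
    also have "\<dots> = ennreal (ln (l' / l) * mass c' (s / 2)) +
        (wint (hc c' (s / 2)) (\<lambda>x. ln (Mx w N c' (s / 2) l' x / l')))"
      using Suc.prems l' by (intro nn_integral_ln_shift Mx_ge borel_measurable_Mx)
    also have "\<dots> \<le> ennreal (g * ((l' - l) * (s / 2) ^ CARD('n))) +
        ennreal g * (\<integral>\<^sup>+x\<in>hc c' (s / 2). ennreal (Mx w N c' (s / 2) l' x - l') \<partial>lborel)"
      using Suc.IH[OF s2 l'(1) l'(3)[unfolded a_def]] jump by (intro add_mono ennreal_leI)
    also have "\<dots> = ennreal g * (ennreal ((l' - l) * (s / 2) ^ CARD('n)) +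
        (\<integral>\<^sup>+x\<in>hc c' (s / 2). ennreal (Mx w N c' (s / 2) l' x - l') \<partial>lborel))"
      using \<open>0 \<le> g\<close> l' s2 by (simp add: ennreal_mult distrib_left)
    also have "\<dots> = ennreal g * (\<integral>\<^sup>+x\<in>hc c' (s / 2). ennreal (Mx w N c' (s / 2) l' x - l) \<partial>lborel)"
      using l' s2 by (subst nn_integral_diff_shift) (auto intro: Mx_ge)
    also have "(\<integral>\<^sup>+x\<in>hc c' (s / 2). ennreal (Mx w N c' (s / 2) l' x - l) \<partial>lborel) =
        (\<integral>\<^sup>+x\<in>hc c' (s / 2). ennreal (Mx w (Suc N) c s l x - l) \<partial>lborel)"
      using eq by (intro nn_integral_cong) (auto simp: indicator_def)
    finally show ?thesis .
  qed
  then show ?case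
    using Suc.prems by (subst (1 2) nn_integral_hc_kids) (auto simp: sum_distrib_left simp del: Mx.simps intro!: sum_mono)
qed simp

text \<open>The estimate on a kid comes at the raised level \<open>t * l\<close> and has to be
  brought back to \<open>l\<close>. The excess \<open>t powr \<epsilon> - 1\<close> is at most
  \<epsilon> * ln t * 2^(n * \<epsilon>), from 1 - 1 / y <= ln y, while \<open>ln t * m\<close> is
  exactly the additional logarithmic energy of the jump. The inequality for \<open>b\<close> says
  that the coefficient \<open>b * \<epsilon>\<close> of this energy absorbs the excess.\<close>

lemma power_step:
  fixes \<epsilon> :: real
  assumes t: "1 \<le> t" "t \<le> 2 ^ CARD('n)" and \<epsilon>: "0 < \<epsilon>" and L: "L \<le> K * m" and m: "0 \<le> m"
    and b: "2 powr (CARD('n) * \<epsilon>) * (1 + b * \<epsilon> * K) \<le> b" and b0: "0 \<le> b" and K: "0 \<le> K"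
  shows "t powr \<epsilon> * (m + b * \<epsilon> * L) \<le> m + b * \<epsilon> * (ln t * m + L)"
proof -
  define D where "D = 2 powr (CARD('n) * \<epsilon>)"
  have u: "1 \<le> t powr \<epsilon>" "t powr \<epsilon> \<le> D"
  proof -
    show "1 \<le> t powr \<epsilon>"
      using t \<epsilon> by (simp add: ge_one_powr_ge_zero)
    have "t powr \<epsilon> \<le> (2 ^ CARD('n)) powr \<epsilon>"
      using t \<epsilon> by (intro powr_mono2) auto
    then show "t powr \<epsilon> \<le> D"
      by (simp add: D_def powr_realpow[symmetric] powr_powr)
  qed
  have "0 < t powr \<epsilon>"
    using u(1) by linarith
  then have "ln (1 / (t powr \<epsilon>)) \<le> 1 / (t powr \<epsilon>) - 1"
    by (intro ln_le_minus_one divide_pos_pos) auto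
  moreover have "ln (1 / (t powr \<epsilon>)) = - ln (t powr \<epsilon>)"
    using u(1) t by (subst ln_div) auto
  ultimately have "1 - 1 / (t powr \<epsilon>) \<le> ln (t powr \<epsilon>)"
    by linarith
  then have "t powr \<epsilon> - 1 \<le> \<epsilon> * ln t * t powr \<epsilon>"
    using u(1) t by (simp add: ln_powr field_simps)
  also have "\<dots> \<le> \<epsilon> * ln t * D"
    using u \<epsilon> t by (intro mult_left_mono) auto
  finally have 1: "t powr \<epsilon> - 1 \<le> \<epsilon> * ln t * D" .
  have "(t powr \<epsilon> - 1) * (m + b * \<epsilon> * L) \<le> (t powr \<epsilon> - 1) * (m + b * \<epsilon> * (K * m))"
    using u b0 \<epsilon> L by (intro mult_left_mono add_left_mono) auto
  also have "\<dots> \<le> (\<epsilon> * ln t * D) * (m + b * \<epsilon> * (K * m))"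
    using 1 b0 \<epsilon> K m by (intro mult_right_mono) auto
  also have "\<dots> = (\<epsilon> * ln t * m) * (D * (1 + b * \<epsilon> * K))"
    by (simp add: algebra_simps)
  also have "\<dots> \<le> (\<epsilon> * ln t * m) * b"
    using b t \<epsilon> m by (intro mult_left_mono) (auto simp: D_def)
  finally show ?thesis
    by (simp add: algebra_simps)
qed

text \<open>Ranges over all subcubes, so it is inherited by kids without reference to a dyadic tree,
  and it is uniform in the number \<open>N\<close> of generations. The starting level is always the
  average of the subcube itself.\<close>

definition log_energy_bound :: "real \<Rightarrow> real ^ 'n \<Rightarrow> real \<Rightarrow> bool" where
  "log_energy_bound K c s \<longleftrightarrow> (\<forall>c' s' N. 0 < s' \<longrightarrow> hc c' s' \<subseteq> hc c s \<longrightarrow> 0 < av w c' s' \<longrightarrow>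
    (wint (hc c' s') (\<lambda>x. ln (Mx w N c' s' (av w c' s') x / av w c' s'))) \<le> ennreal (K * mass c' s'))"

text \<open>The logarithmic integral stays on the right, instead of \<open>K\<close> times the mass,
  because like the mass it adds up over the kids. It is compared with \<open>K\<close> only on kids
  where a jump occurs.\<close>

lemma power_energy:
  fixes \<epsilon> :: real
  assumes \<epsilon>: "0 < \<epsilon>" and K: "0 \<le> K" and b0: "0 \<le> b"
    and b: "2 powr (CARD('n) * \<epsilon>) * (1 + b * \<epsilon> * K) \<le> b"
    and "log_energy_bound K c s" "0 < s" "0 < l" "av w c s \<le> l"
  shows "(wint (hc c s) (\<lambda>x. Mx w N c s l x powr \<epsilon>)) \<le>
    ennreal (l powr \<epsilon>) * (ennreal (mass c s) +
      ennreal (b * \<epsilon>) * (wint (hc c s) (\<lambda>x. ln (Mx w N c s l x / l))))"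
  using assms(5-)
proof (induction N arbitrary: c s l)
  case 0
  have "(wint (hc c s) (\<lambda>x. Mx w 0 c s l x powr \<epsilon>)) =
      (\<integral>\<^sup>+x. ennreal (l powr \<epsilon>) * (ennreal (w x) * indicator (hc c s) x) \<partial>lborel)"
    using w_nonneg by (intro nn_integral_cong) (auto simp: ennreal_mult indicator_def mult.commute)
  also have "\<dots> = ennreal (l powr \<epsilon>) * ennreal (mass c s)"
    by (simp add: nn_integral_cmult nn_integral_w_hc)
  finally show ?case
    using \<open>0 < l\<close> by simp
next
  case (Suc N)
  have step: "(wint (hc c' (s / 2)) (\<lambda>x. Mx w (Suc N) c s l x powr \<epsilon>)) \<le>
    ennreal (l powr \<epsilon>) * (ennreal (mass c' (s / 2)) +
      ennreal (b * \<epsilon>) * (wint (hc c' (s / 2)) (\<lambda>x. ln (Mx w (Suc N) c s l x / l))))"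
    if c': "c' \<in> kids c s" for c'
  proof -
    define a where "a = av w c' (s / 2)"
    define l' where "l' = max l a"
    define L where "L = (wint (hc c' (s / 2)) (\<lambda>x. ln (Mx w N c' (s / 2) l' x / l')))"
    define m where "m = mass c' (s / 2)"
    have s2: "0 < s / 2"
      using Suc.prems by simp
    have sub: "hc c' (s / 2) \<subseteq> hc c s"
      by (rule hc_kid_subset[OF c' Suc.prems(2)])
    then have leb: "log_energy_bound K c' (s / 2)"
      using Suc.prems(1) unfolding log_energy_bound_def by (meson order_trans)
    have l': "0 < l'" "l \<le> l'" "a \<le> l'"
      using Suc.prems by (auto simp: l'_def)
    have eq: "Mx w (Suc N) c s l x = Mx w N c' (s / 2) l' x" if "x \<in> hc c' (s / 2)" for x
      using child_eq[OF c' that] by (simp add: l'_def a_def)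
    have "(wint (hc c' (s / 2)) (\<lambda>x. Mx w (Suc N) c s l x powr \<epsilon>)) =
        (wint (hc c' (s / 2)) (\<lambda>x. Mx w N c' (s / 2) l' x powr \<epsilon>))"
      using eq by (intro nn_integral_cong) (auto simp: indicator_def)
    also have "\<dots> \<le> ennreal (l' powr \<epsilon>) * (ennreal m + ennreal (b * \<epsilon>) * L)"
      unfolding L_def m_def by (rule Suc.IH[OF leb s2 l'(1) l'(3)[unfolded a_def]])
    also have "\<dots> \<le> ennreal (l powr \<epsilon>) * (ennreal m + ennreal (b * \<epsilon>) * (ennreal (ln (l' / l) * m) + L))"
    proof (cases "a \<le> l")
      case True
      then have "l' = l"
        by (simp add: l'_def)
      then show ?thesis
        using Suc.prems by simp
    next
      case False
      then have l'a: "l' = a"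
        by (simp add: l'_def)
      have "0 < av w c' (s / 2)"
        using False Suc.prems by (simp add: a_def)
      \<comment> \<open>At a jump the new level is the average of the kid, which is the starting
        level that \<open>log_energy_bound\<close> speaks about.\<close>
      then have LK: "L \<le> ennreal (K * m)"
        using leb s2 unfolding log_energy_bound_def L_def l'a unfolding a_def m_def by blast
      have m0: "0 \<le> m"
        by (simp add: m_def mass_nonneg)
      obtain R where R: "L = ennreal R" "0 \<le> R" "R \<le> K * m"
        using LK K m0 by (cases L) (auto simp: top_unique)
      define t where "t = l' / l"
      have "a \<le> 2 ^ CARD('n) * l"
        using av_kid_le[OF c' Suc.prems(2)] Suc.prems(4)
        by (smt (verit) a_def mult_left_mono zero_le_power)
      then have t: "1 \<le> t" "t \<le> 2 ^ CARD('n)"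
        using False Suc.prems by (auto simp: t_def l'a field_simps)
      have "t powr \<epsilon> * (m + b * \<epsilon> * R) \<le> m + b * \<epsilon> * (ln t * m + R)"
        by (rule power_step[OF t \<epsilon> R(3) m0 b b0 K])
      then have "l powr \<epsilon> * (t powr \<epsilon> * (m + b * \<epsilon> * R)) \<le> l powr \<epsilon> * (m + b * \<epsilon> * (ln t * m + R))"
        by (intro mult_left_mono) auto
      moreover have "l' powr \<epsilon> = l powr \<epsilon> * t powr \<epsilon>"
        using Suc.prems l' by (simp add: t_def powr_mult[symmetric])
      ultimately have "l' powr \<epsilon> * (m + b * \<epsilon> * R) \<le> l powr \<epsilon> * (m + b * \<epsilon> * (ln t * m + R))"
        by (simp add: mult.assoc)
      then have "ennreal (l' powr \<epsilon> * (m + b * \<epsilon> * R)) \<le> ennreal (l powr \<epsilon> * (m + b * \<epsilon> * (ln t * m + R)))"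
        by (rule ennreal_leI)
      then show ?thesis
        using m0 R \<epsilon> b0 t unfolding R(1) t_def[symmetric] by (simp add: ennreal_mult ennreal_plus)
    qed
    also have "ennreal (ln (l' / l) * m) + L =
        (wint (hc c' (s / 2)) (\<lambda>x. ln (Mx w N c' (s / 2) l' x / l)))"
      unfolding L_def m_def using Suc.prems l'
      by (subst nn_integral_ln_shift[where l' = l']) (auto intro: Mx_ge)
    also have "\<dots> = (wint (hc c' (s / 2)) (\<lambda>x. ln (Mx w (Suc N) c s l x / l)))"
      using eq by (intro nn_integral_cong) (auto simp: indicator_def)
    finally show ?thesis
      by (simp add: m_def)
  qed
  have "ennreal (mass c s) = (\<Sum>c'\<in>kids c s. ennreal (mass c' (s / 2)))"
    using Suc.prems by (simp add: nn_integral_w_hc[symmetric] nn_integral_hc_kids)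
  then show ?case
    using Suc.prems step
    by (subst (1 2) nn_integral_hc_kids)
      (auto simp: sum_distrib_left sum.distrib[symmetric] simp del: Mx.simps intro!: sum_mono)
qed

end

section \<open>Dyadic differentiation: almost everywhere, w is at most the supremum of its running
  maxima\<close>

primrec kc :: "nat \<Rightarrow> real ^ 'n \<Rightarrow> real \<Rightarrow> real ^ 'n \<Rightarrow> real ^ 'n" where
  "kc 0 c s x = c"
| "kc (Suc k) c s x = kc k (child c s x) (s / 2) x"

lemma mem_hc_kc: "x \<in> hc c s \<Longrightarrow> x \<in> hc (kc k c s x) (s / 2 ^ k)"
proof (induction k arbitrary: c s)
  case (Suc k)
  then show ?case
    using Suc.IH[OF mem_hc_child[OF Suc.prems]] by simp
qed simp

lemma measurable_kc_subset [measurable]: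
  "Measurable.pred borel (\<lambda>x. hc (kc k c s x) (s / 2 ^ k) \<subseteq> U)"
proof (induction k arbitrary: c s)
  case (Suc k)
  have "Measurable.pred borel (\<lambda>x. (\<lambda>c' x. hc (kc k c' (s / 2) x) (s / 2 / 2 ^ k) \<subseteq> U) (child c s x) x)"
    by (rule measurable_compose_countable'[OF Suc measurable_child countable_finite[OF finite_kids]])
  then show ?case
    by simp
qed simp

lemma eventually_hc_kc_subset:
  fixes x :: "real ^ 'n"
  assumes "open U" "x \<in> U" "x \<in> hc c s"
  shows "eventually (\<lambda>k. hc (kc k c s x) (s / 2 ^ k) \<subseteq> U) sequentially"
proof -
  obtain e where e: "0 < e" "ball x e \<subseteq> U"
    using assms by (meson open_contains_ball)
  have "(\<lambda>k. (real CARD('n) * s) * (1 / 2) ^ k) \<longlonglongrightarrow> (real CARD('n) * s) * 0"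
    by (intro tendsto_intros LIMSEQ_realpow_zero) auto
  then have "eventually (\<lambda>k. (real CARD('n) * s) * (1 / 2) ^ k < e) sequentially"
    using e(1) by (intro order_tendstoD(2)[of _ "real CARD('n) * s * 0"]) auto
  then show ?thesis
  proof (rule eventually_mono)
    fix k assume k: "(real CARD('n) * s) * (1 / 2) ^ k < e"
    show "hc (kc k c s x) (s / 2 ^ k) \<subseteq> U"
    proof
      fix y assume y: "y \<in> hc (kc k c s x) (s / 2 ^ k)"
      have "\<bar>(y - x) $ i\<bar> \<le> s / 2 ^ k" for i
        using y[unfolded hc_def, simplified, rule_format, of i]
          mem_hc_kc[OF assms(3), of k, unfolded hc_def, simplified, rule_format, of i] by auto
      then have "norm (y - x) \<le> (\<Sum>i\<in>(UNIV :: 'n set). s / 2 ^ k)"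
        by (intro order_trans[OF norm_le_l1_cart] sum_mono)
      also have "\<dots> < e"
        using k by (simp add: power_one_over)
      finally have "y \<in> ball x e"
        by (simp add: dist_norm norm_minus_commute)
      then show "y \<in> U"
        using e by auto
    qed
  qed
qed

context weight_density begin

definition exceed :: "real \<Rightarrow> real ^ 'n \<Rightarrow> real \<Rightarrow> real \<Rightarrow> (real ^ 'n) set" where
  "exceed u c s l = {x. u < w x \<and> (\<forall>N. Mx w N c s l x \<le> u)}"

lemma exceed_borel [measurable]: "exceed u c s l \<in> sets borel"
  unfolding exceed_def by measurable

abbreviation exceed_in :: "nat \<Rightarrow> (real ^ 'n) set \<Rightarrow> real \<Rightarrow> real ^ 'n \<Rightarrow> real \<Rightarrow> real \<Rightarrow> (real ^ 'n) set" where
  "exceed_in k U u c s l \<equiv> {x \<in> exceed u c s l. hc (kc k c s x) (s / 2 ^ k) \<subseteq> U}"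

lemma exceed_kid:
  assumes "c' \<in> kids c s" "x \<in> hc c' (s / 2)" "x \<in> exceed u c s l"
  shows "x \<in> exceed u c' (s / 2) (max l (av w c' (s / 2)))"
proof -
  have "Mx w N c' (s / 2) (max l (av w c' (s / 2))) x = Mx w (Suc N) c s l x" for N
    using child_eq[OF assms(1,2)] by simp
  then show ?thesis
    using assms(3) unfolding exceed_def by (simp only: mem_Collect_eq) blast
qed

lemma emeasure_Int_eq_nn_integral:
  assumes [measurable]: "S \<in> sets borel" "U \<in> sets borel"
  shows "vol (S \<inter> U) = (\<integral>\<^sup>+x\<in>S. indicator U x \<partial>lborel)"
proof -
  have "(\<integral>\<^sup>+x\<in>S. indicator U x \<partial>lborel) = (\<integral>\<^sup>+x. indicator (S \<inter> U) x \<partial>lborel)"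
    by (intro nn_integral_cong) (auto simp: indicator_def)
  then show ?thesis
    by simp
qed

text \<open>A set covered by dyadic cubes that lie in \<open>U\<close> and have average at most
  \<open>u\<close> carries mass at most \<open>u * vol U\<close>. The index \<open>k\<close> fixes
  the generation of the cubes, and the induction descends to it.\<close>

lemma exceed_open_bound:
  assumes [measurable]: "U \<in> sets borel" and u: "0 \<le> u" and "0 < s" "av w c s \<le> l"
  shows "(\<integral>\<^sup>+x\<in>hc c s. ennreal (w x) * indicator (exceed_in k U u c s l) x \<partial>lborel)
    \<le> ennreal u * vol (hc c s \<inter> U)"
  using assms(3,4)
proof (induction k arbitrary: c s l)
  case 0
  show ?case
  \<comment> \<open>At generation 0 the running maximum is \<open>l\<close> itself, which dominates
    the average of the cube: a single exceptional point gives average at most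
    \<open>u\<close>.\<close>
  proof (cases "hc c s \<subseteq> U \<and> (\<exists>x. x \<in> exceed u c s l)")
    case True
    then obtain x where "x \<in> exceed u c s l"
      by blast
    then have "Mx w 0 c s l x \<le> u"
      unfolding exceed_def by blast
    then have "av w c s \<le> u"
      using 0 by simp
    have "(\<integral>\<^sup>+x\<in>hc c s. ennreal (w x) * indicator (exceed_in 0 U u c s l) x \<partial>lborel)
        \<le> (wvol (hc c s))"
      by (intro nn_integral_mono) (auto simp: indicator_def)
    also have "\<dots> = ennreal (av w c s * s ^ CARD('n))"
      using 0 by (simp add: nn_integral_w_hc mass_av)
    also have "\<dots> \<le> ennreal (u * s ^ CARD('n))"
      using \<open>av w c s \<le> u\<close> 0 by (intro ennreal_leI mult_right_mono) auto
    also have "\<dots> = ennreal u * vol (hc c s \<inter> U)"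
      using True 0 u by (simp add: Int_absorb2 emeasure_hc ennreal_mult)
    finally show ?thesis .
  next
    case False
    then have "(\<integral>\<^sup>+x\<in>hc c s. ennreal (w x) * indicator (exceed_in 0 U u c s l) x \<partial>lborel) = (\<integral>\<^sup>+x. 0 \<partial>(lborel :: (real ^ 'n) measure))"
      by (intro nn_integral_cong) (auto simp: indicator_def)
    then show ?thesis
      by simp
  qed
next
  case (Suc k)
  have "(\<integral>\<^sup>+x\<in>hc c' (s / 2). ennreal (w x) * indicator (exceed_in (Suc k) U u c s l) x \<partial>lborel)
      \<le> ennreal u * (\<integral>\<^sup>+x\<in>hc c' (s / 2). indicator U x \<partial>lborel)" if c': "c' \<in> kids c s" for c'
  proof -
    define l' where "l' = max l (av w c' (s / 2))"
    have "(\<integral>\<^sup>+x\<in>hc c' (s / 2). ennreal (w x) * indicator (exceed_in (Suc k) U u c s l) x \<partial>lborel)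
      \<le> (\<integral>\<^sup>+x\<in>hc c' (s / 2). ennreal (w x) * indicator (exceed_in k U u c' (s / 2) l') x \<partial>lborel)"
    proof (rule nn_integral_mono)
      fix x
      show "ennreal (w x) * indicator (exceed_in (Suc k) U u c s l) x * indicator (hc c' (s / 2)) x
        \<le> ennreal (w x) * indicator (exceed_in k U u c' (s / 2) l') x * indicator (hc c' (s / 2)) x"
      proof (cases "x \<in> hc c' (s / 2)")
        case True
        have "child c s x = c'"
          by (rule child_eq[OF c' True])
        then show ?thesis
          using True exceed_kid[OF c' True] by (auto simp: indicator_def l'_def)
      qed auto
    qed
    also have "\<dots> \<le> ennreal u * vol (hc c' (s / 2) \<inter> U)"
      using Suc.prems by (intro Suc.IH) (auto simp: l'_def)
    also have "vol (hc c' (s / 2) \<inter> U) = (\<integral>\<^sup>+x\<in>hc c' (s / 2). indicator U x \<partial>lborel)"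
      by (intro emeasure_Int_eq_nn_integral) auto
    finally show ?thesis .
  qed
  note step = this
  have "(\<integral>\<^sup>+x\<in>hc c s. ennreal (w x) * indicator (exceed_in (Suc k) U u c s l) x \<partial>lborel)
      = (\<Sum>c'\<in>kids c s. \<integral>\<^sup>+x\<in>hc c' (s / 2). ennreal (w x) * indicator (exceed_in (Suc k) U u c s l) x \<partial>lborel)"
    by (rule nn_integral_hc_kids[OF _ Suc.prems(1)]) measurable
  also have "\<dots> \<le> (\<Sum>c'\<in>kids c s. ennreal u * (\<integral>\<^sup>+x\<in>hc c' (s / 2). indicator U x \<partial>lborel))"
    by (intro sum_mono step)
  also have "\<dots> = ennreal u * (\<integral>\<^sup>+x\<in>hc c s. indicator U x \<partial>lborel)"
    using Suc.prems by (simp add: nn_integral_hc_kids sum_distrib_left)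
  also have "(\<integral>\<^sup>+x\<in>hc c s. indicator U x \<partial>lborel) = vol (hc c s \<inter> U)"
    by (intro emeasure_Int_eq_nn_integral[symmetric]) auto
  finally show ?case .
qed

text \<open>Small dyadic cubes around each point fit into any open superset, so by Fatou's lemma the
  mass of the exceptional set is at most \<open>u\<close> times the volume of that superset. Outer
  regularity shrinks the superset to the set itself, on which \<open>w\<close> is larger than
  \<open>u\<close>.\<close>

lemma exceed_null:
  assumes s: "0 < s" and u: "0 \<le> u"
  shows "vol (hc c s \<inter> exceed u c s (av w c s)) = 0"
proof -
  define T where "T = hc c s \<inter> exceed u c s (av w c s)"
  have [measurable]: "T \<in> sets borel"
    by (simp add: T_def)
  have fin: "vol T < \<infinity>"
    using emeasure_mono[of T "hc c s" lborel] s by (simp add: T_def emeasure_hc order_le_less_trans)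
  have le: "wvol T \<le> ennreal u * vol U"
    if U: "open U" "T \<subseteq> U" for U
  proof -
    have Ub[measurable]: "U \<in> sets borel"
      using U by auto
    define F where "F k x = ennreal (w x) * indicator (exceed_in k U u c s (av w c s)) x * indicator (hc c s) x" for k x
    have "ennreal (w x) * indicator T x \<le> liminf (\<lambda>k. F k x)" for x
    proof (cases "x \<in> T")
      case True
      then have "eventually (\<lambda>k. hc (kc k c s x) (s / 2 ^ k) \<subseteq> U) sequentially"
        using U by (intro eventually_hc_kc_subset) (auto simp: T_def)
      then have "eventually (\<lambda>k. ennreal (w x) * indicator T x \<le> F k x) sequentially"
        by (rule eventually_mono) (use True in \<open>auto simp: F_def T_def\<close>)
      then show ?thesis
        by (rule Liminf_bounded)
    qed auto
    then have "wvol T \<le> (\<integral>\<^sup>+x. liminf (\<lambda>k. F k x) \<partial>lborel)"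
      by (intro nn_integral_mono)
    also have "\<dots> \<le> liminf (\<lambda>k. \<integral>\<^sup>+x. F k x \<partial>lborel)"
      unfolding F_def by (intro nn_integral_liminf) measurable
    also have "\<dots> \<le> liminf (\<lambda>k :: nat. ennreal u * vol U)"
    proof (intro Liminf_mono always_eventually allI)
      fix k
      have "(\<integral>\<^sup>+x. F k x \<partial>lborel) \<le> ennreal u * vol (hc c s \<inter> U)"
        unfolding F_def by (rule exceed_open_bound[OF Ub u s order_refl])
      also have "\<dots> \<le> ennreal u * vol U"
        by (intro mult_left_mono emeasure_mono) auto
      finally show "(\<integral>\<^sup>+x. F k x \<partial>lborel) \<le> ennreal u * vol U" .
    qed
    finally show ?thesis
      by (simp add: Liminf_const)
  qed
  have le': "wvol T \<le> ennreal u * vol T"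
  proof (rule ennreal_le_epsilon)
    fix e :: real assume "0 < e"
    define \<eta> where "\<eta> = e / (u + 1)"
    have \<eta>: "0 < \<eta>" "u * \<eta> \<le> e"
      using \<open>0 < e\<close> u by (auto simp: \<eta>_def field_simps)
    obtain U where U: "open U" "T \<subseteq> U" "vol (U - T) < ennreal \<eta>"
      using outer_regular_lborel[of T \<eta>] \<eta> by auto
    have [measurable]: "U \<in> sets borel"
      using U by auto
    have "vol U = vol T + vol (U - T)"
      using U by (subst plus_emeasure) (auto simp: Un_absorb1)
    then have "ennreal u * vol U \<le> ennreal u * vol T + ennreal u * ennreal \<eta>"
      using U(3) by (simp add: distrib_left[symmetric] mult_left_mono add_left_mono less_imp_le)
    also have "\<dots> \<le> ennreal u * vol T + ennreal e"
      using \<eta> u by (simp add: ennreal_mult'[symmetric] add_left_mono ennreal_leI)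
    finally show "wvol T \<le> ennreal u * vol T + ennreal e"
      using le[OF U(1,2)] by (rule order_trans[rotated])
  qed
  have "wvol T = (\<integral>\<^sup>+x. ennreal u * indicator T x + ennreal (w x - u) * indicator T x \<partial>lborel)"
    using u by (intro nn_integral_cong)
      (auto simp: indicator_def T_def exceed_def ennreal_plus[symmetric] simp del: ennreal_plus)
  also have "\<dots> = ennreal u * vol T + (\<integral>\<^sup>+x\<in>T. ennreal (w x - u) \<partial>lborel)"
    by (simp add: nn_integral_add nn_integral_cmult_indicator)
  finally have "ennreal u * vol T + (\<integral>\<^sup>+x\<in>T. ennreal (w x - u) \<partial>lborel) \<le> ennreal u * vol T + 0"
    using le' by simp
  then have "(\<integral>\<^sup>+x\<in>T. ennreal (w x - u) \<partial>lborel) = 0"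
    using fin by (subst (asm) ennreal_add_left_cancel_le) (auto simp: ennreal_mult_eq_top_iff)
  then have "AE x in lborel. ennreal (w x - u) * indicator T x = 0"
    by (subst (asm) nn_integral_0_iff_AE) auto
  then have "AE x in lborel. x \<notin> T"
    by (rule AE_mp) (auto intro!: AE_I2 simp: T_def exceed_def indicator_def split: if_splits)
  then show ?thesis
    by (subst (asm) AE_iff_measurable[OF _ refl]) (auto simp: T_def Int_def)
qed

text \<open>Rational levels suffice, which leaves countably many null sets. Phrasing it through
  \<open>u < w x\<close> avoids a supremum of reals that could be unbounded.\<close>

lemma AE_le_Mx:
  assumes s: "0 < s"
  shows "AE x in lborel. x \<in> hc c s \<longrightarrow> (\<forall>u<w x. 0 \<le> u \<longrightarrow> (\<exists>N. u < Mx w N c s (av w c s) x))"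
proof -
  have "AE x in lborel. x \<notin> hc c s \<inter> exceed (real_of_rat u) c s (av w c s)" if "0 \<le> u" for u
    using exceed_null[OF s, of "real_of_rat u" c] that
    by (intro AE_not_in) (auto simp: null_sets_def)
  then have "AE x in lborel. \<forall>u. 0 \<le> u \<longrightarrow> x \<notin> hc c s \<inter> exceed (real_of_rat u) c s (av w c s)"
    unfolding AE_all_countable by (auto intro: AE_I2)
  then show ?thesis
  proof (rule AE_mp, intro AE_I2 impI allI)
    fix x u
    assume *: "\<forall>u. 0 \<le> u \<longrightarrow> x \<notin> hc c s \<inter> exceed (real_of_rat u) c s (av w c s)"
      and x: "x \<in> hc c s" and u: "u < w x" "0 \<le> u"
    obtain v where v: "u < real_of_rat v" "real_of_rat v < w x"
      using of_rat_dense[OF u(1)] by blast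
    then have "0 \<le> v"
      using u(2) by (metis less_le_trans less_imp_le of_rat_less_0_iff not_less)
    then have "x \<notin> exceed (real_of_rat v) c s (av w c s)"
      using * x by blast
    then obtain N where "\<not> Mx w N c s (av w c s) x \<le> real_of_rat v"
      using v unfolding exceed_def by blast
    then show "\<exists>N. u < Mx w N c s (av w c s) x"
      using v by (intro exI[of _ N]) linarith
  qed
qed

text \<open>With D = 2^(n * \<epsilon>), convexity of exp gives D * (1 - n * \<epsilon> * ln 2) <=
  1. The hypothesis bounds 2 * \<epsilon> * K by that same bracket, so D * \<epsilon> * K <= 1 / 2.
  This one half becomes the constant 2 of the conclusion.\<close>

theorem reverse_Hoelder_of_log_energy:
  assumes leb: "log_energy_bound K c s" and s: "0 < s" and pos: "0 < av w c s"
    and K: "0 \<le> K" and \<epsilon>: "0 < \<epsilon>" and K\<epsilon>: "2 * K + CARD('n) * ln 2 \<le> 1 / \<epsilon>"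
  shows "(\<integral>\<^sup>+x\<in>hc c s. ennreal (w x powr (1 + \<epsilon>)) \<partial>lborel) \<le> ennreal (2 * av w c s powr \<epsilon> * mass c s)"
proof -
  define D where "D = 2 powr (CARD('n) * \<epsilon>)"
  \<comment> \<open>The solution of \<open>D * (1 + b * \<epsilon> * K) = b\<close>, that is,
    equality in the condition of \<open>power_energy\<close>.\<close>
  define b where "b = D / (1 - D * \<epsilon> * K)"
  define a where "a = av w c s"
  have D: "0 < D" "D * (1 - CARD('n) * \<epsilon> * ln 2) \<le> 1"
  proof -
    have "D = exp (CARD('n) * \<epsilon> * ln 2)"
      by (simp add: D_def powr_def)
    moreover have "1 - CARD('n) * \<epsilon> * ln 2 \<le> exp (- (CARD('n) * \<epsilon> * ln 2))"
      using exp_ge_add_one_self[of "- (CARD('n) * \<epsilon> * ln 2)"] by simp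
    ultimately show "0 < D" "D * (1 - CARD('n) * \<epsilon> * ln 2) \<le> 1"
      by (auto simp: exp_minus field_simps)
  qed
  have "(2 * K + CARD('n) * ln 2) * \<epsilon> \<le> 1"
    using K\<epsilon> \<epsilon> by (simp add: field_simps)
  then have "2 * \<epsilon> * K \<le> 1 - CARD('n) * \<epsilon> * ln 2"
    by (simp add: algebra_simps)
  then have "D * (2 * \<epsilon> * K) \<le> D * (1 - CARD('n) * \<epsilon> * ln 2)"
    using D(1) by (intro mult_left_mono) auto
  then have half: "D * \<epsilon> * K \<le> 1 / 2"
    using D(2) by (simp add: algebra_simps)
  have b0: "0 \<le> b"
    using half D by (simp add: b_def)
  have beq: "D * (1 + b * \<epsilon> * K) = b"
  proof -
    have "b * (1 - D * \<epsilon> * K) = D"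
      using half by (simp add: b_def)
    then show ?thesis
      by (simp add: algebra_simps)
  qed
  \<comment> \<open>The final factor is \<open>1 + b * \<epsilon> * K\<close>, which equals b / D;
    so \<open>b \<le> 2 * D\<close> is what is wanted.\<close>
  have "b * (1 / 2) \<le> b * (1 - D * \<epsilon> * K)"
    using half b0 by (intro mult_left_mono) auto
  also have "\<dots> = D"
    using half by (simp add: b_def)
  finally have "b \<le> 2 * D"
    by simp
  then have "D * (1 + b * \<epsilon> * K) \<le> D * 2"
    using beq by simp
  then have bK: "1 + b * \<epsilon> * K \<le> 2"
    using D by simp
  have bound: "(wint (hc c s) (\<lambda>x. Mx w N c s a x powr \<epsilon>)) \<le> ennreal (2 * a powr \<epsilon> * mass c s)" for N
  proof -
    have "(wint (hc c s) (\<lambda>x. Mx w N c s a x powr \<epsilon>)) \<le>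
      ennreal (a powr \<epsilon>) * (ennreal (mass c s) +
        ennreal (b * \<epsilon>) * (wint (hc c s) (\<lambda>x. ln (Mx w N c s a x / a))))"
      using beq pos unfolding a_def by (intro power_energy[OF \<epsilon> K b0 _ leb s]) (auto simp: D_def)
    also have "\<dots> \<le> ennreal (a powr \<epsilon>) * (ennreal (mass c s) + ennreal (b * \<epsilon>) * ennreal (K * mass c s))"
      using leb s pos unfolding log_energy_bound_def a_def
      by (intro mult_left_mono add_left_mono) auto
    also have "\<dots> = ennreal (a powr \<epsilon> * (mass c s + b * \<epsilon> * (K * mass c s)))"
      using b0 \<epsilon> K mass_nonneg by (simp add: ennreal_mult[symmetric] ennreal_plus[symmetric] del: ennreal_plus)
    also have "a powr \<epsilon> * (mass c s + b * \<epsilon> * (K * mass c s)) = (a powr \<epsilon> * mass c s) * (1 + b * \<epsilon> * K)"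
      by (simp add: algebra_simps)
    also have "ennreal \<dots> \<le> ennreal ((a powr \<epsilon> * mass c s) * 2)"
      using bK mass_nonneg by (intro ennreal_leI mult_left_mono) auto
    finally show ?thesis
      by (simp add: mult_ac)
  qed
  have "(\<integral>\<^sup>+x\<in>hc c s. ennreal (w x powr (1 + \<epsilon>)) \<partial>lborel)
      \<le> (\<integral>\<^sup>+x. (SUP N. ennreal (w x * Mx w N c s a x powr \<epsilon>) * indicator (hc c s) x) \<partial>lborel)"
  proof (rule nn_integral_mono_AE, rule AE_mp[OF AE_le_Mx[OF s, of c]], intro AE_I2 impI)
    fix x
    assume *: "x \<in> hc c s \<longrightarrow> (\<forall>u<w x. 0 \<le> u \<longrightarrow> (\<exists>N. u < Mx w N c s (av w c s) x))"
    show "ennreal (w x powr (1 + \<epsilon>)) * indicator (hc c s) x \<le> (SUP N. ennreal (w x * Mx w N c s a x powr \<epsilon>) * indicator (hc c s) x)"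
    proof (cases "x \<in> hc c s \<and> 0 < w x")
      case True
      have le: "ennreal (w x * u powr \<epsilon>) \<le> (SUP N. ennreal (w x * Mx w N c s a x powr \<epsilon>) * indicator (hc c s) x)"
        if u: "0 \<le> u" "u < w x" for u
      proof -
        obtain N where "u < Mx w N c s a x"
          using * True u unfolding a_def by blast
        then have "ennreal (w x * u powr \<epsilon>) \<le> ennreal (w x * Mx w N c s a x powr \<epsilon>) * indicator (hc c s) x"
          using True u \<epsilon> by (auto intro!: ennreal_leI powr_mono2)
        also have "\<dots> \<le> (SUP N. ennreal (w x * Mx w N c s a x powr \<epsilon>) * indicator (hc c s) x)"
          by (rule SUP_upper) simp
        finally show ?thesis .
      qed
      \<comment> \<open>The maxima are only known to pass levels strictly below \<open>w x\<close>,
        so \<open>w x\<close> is approached from below; the sequence starts at level 0, which is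
        allowed.\<close>
      have lim: "(\<lambda>k. ennreal (w x * (w x - w x / real (Suc k)) powr \<epsilon>)) \<longlonglongrightarrow> ennreal (w x * w x powr \<epsilon>)"
      proof (intro tendsto_ennrealI tendsto_mult tendsto_const)
        have "(\<lambda>k. w x - w x * (1 / real (Suc k))) \<longlonglongrightarrow> w x - w x * 0"
          by (intro tendsto_intros LIMSEQ_Suc lim_1_over_n)
        then have "(\<lambda>k. w x - w x / real (Suc k)) \<longlonglongrightarrow> w x"
          by simp
        then show "(\<lambda>k. (w x - w x / real (Suc k)) powr \<epsilon>) \<longlonglongrightarrow> w x powr \<epsilon>"
          using True by (intro tendsto_powr tendsto_const) auto
      qed
      have "ennreal (w x * w x powr \<epsilon>) \<le> (SUP N. ennreal (w x * Mx w N c s a x powr \<epsilon>) * indicator (hc c s) x)"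
      proof (rule LIMSEQ_le_const2[OF lim], intro exI[of _ 0] allI impI le)
        fix k :: nat
        show "0 \<le> w x - w x / real (Suc k)" "w x - w x / real (Suc k) < w x"
          using True by (auto simp: field_simps)
      qed
      moreover have "w x powr (1 + \<epsilon>) = w x * w x powr \<epsilon>"
        using True by (simp add: powr_add)
      ultimately show ?thesis
        using True by simp
    qed (use w_nonneg[of x] in \<open>auto simp: indicator_def not_less\<close>)
  qed
  also have "\<dots> = (SUP N. \<integral>\<^sup>+x\<in>hc c s. ennreal (w x * Mx w N c s a x powr \<epsilon>) \<partial>lborel)"
  proof (rule nn_integral_monotone_convergence_SUP)
    show "incseq (\<lambda>N x. ennreal (w x * Mx w N c s a x powr \<epsilon>) * indicator (hc c s) x)"
    proof (intro monoI le_funI mult_right_mono ennreal_leI mult_left_mono powr_mono2 Mx_mono)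
      show "0 \<le> Mx w N c s a x" for N x
        using Mx_ge[of a w N c s x] pos by (simp add: a_def)
    qed (use \<epsilon> w_nonneg in auto)
  qed measurable
  also have "\<dots> \<le> ennreal (2 * a powr \<epsilon> * mass c s)"
    by (intro SUP_least bound)
  finally show ?thesis
    by (simp add: a_def)
qed

end

section \<open>Balls whose radius is a Lipschitz function of the center\<close>

lemma nn_integral_scaleR:
  fixes f :: "'a :: euclidean_space \<Rightarrow> ennreal"
  assumes [measurable]: "f \<in> borel_measurable borel" and t: "0 < t"
  shows "(\<integral>\<^sup>+x. f x \<partial>lborel) = ennreal (t ^ DIM('a)) * (\<integral>\<^sup>+x. f (t *\<^sub>R x) \<partial>lborel)"
proof -
  have "(\<integral>\<^sup>+x. f x \<partial>lborel) = (\<integral>\<^sup>+x. f x \<partial>density (distr lborel borel (\<lambda>x. 0 + t *\<^sub>R x)) (\<lambda>_. ennreal (\<bar>t\<bar> ^ DIM('a))))"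
    using t by (subst lborel_affine[of t 0]) auto
  also have "\<dots> = ennreal (t ^ DIM('a)) * (\<integral>\<^sup>+x. f (t *\<^sub>R x) \<partial>lborel)"
    using t by (simp add: nn_integral_density nn_integral_distr nn_integral_cmult)
  finally show ?thesis .
qed

text \<open>The points with \<open>norm x < g x\<close> are the centers whose balls of radius
  \<open>g x\<close> cover the origin. The aim is that, each ball being weighted by the inverse
  power of its radius, the origin is covered with weight at least \<open>V / 2\<close>.\<close>

locale lipschitz_radius =
  fixes g :: "'a :: euclidean_space \<Rightarrow> real" and B V :: real
  assumes V: "V = unit_ball_vol (real DIM('a))"
    and lip: "\<bar>g x - g y\<bar> \<le> norm (x - y)"
    and g_nonneg: "0 \<le> g x" and g_le: "g x \<le> B" and g0: "0 < g 0"
begin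

lemma V_nonneg [simp]: "0 \<le> V"
  by (simp add: V)

text \<open>The quotient of \<open>norm x\<close> by \<open>g x\<close> may grow faster than
  linearly along a ray, since \<open>g\<close> can decrease. But \<open>norm x + g x\<close> never
  decreases along a ray, so dilation by \<open>t\<close> multiplies this quotient at most by
  \<open>t\<close>. The factor 2 normalizes \<open>level 1\<close> to the condition
  \<open>norm x < g x\<close>.\<close>

definition q :: "'a \<Rightarrow> real" where "q x = 2 * norm x / (norm x + g x)"

definition level :: "real \<Rightarrow> 'a set" where "level c = {x. q x < c}"

definition \<mu> :: "'a set \<Rightarrow> ennreal" where
  "\<mu> S = (\<integral>\<^sup>+x\<in>S. ennreal (1 / norm x ^ DIM('a)) \<partial>lborel)"

lemma denom_ge: "g 0 \<le> norm x + g x"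
  using lip[of x 0] by simp

lemma denom_pos: "0 < norm x + g x"
  using denom_ge[of x] g0 by linarith

lemma continuous_g: "continuous_on S g"
proof (rule continuous_onI)
  fix x and e :: real assume "0 < e"
  then show "\<exists>d>0. \<forall>x'\<in>S. dist x' x < d \<longrightarrow> dist (g x') (g x) \<le> e"
    by (intro exI[of _ e]) (auto simp: dist_norm intro: order_trans[OF lip] less_imp_le)
qed

lemma g_borel [measurable]: "g \<in> borel_measurable borel"
  by (rule borel_measurable_continuous_onI[OF continuous_g])

lemma q_borel [measurable]: "q \<in> borel_measurable borel"
  unfolding q_def by measurable

lemma level_borel [measurable]: "level c \<in> sets borel"
  unfolding level_def by measurable

lemma q_scale_le:
  assumes "1 \<le> t"
  shows "q (t *\<^sub>R x) \<le> t * q x"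
proof -
  have "norm (t *\<^sub>R x - x) = (t - 1) * norm x"
  proof -
    have "t *\<^sub>R x - x = (t - 1) *\<^sub>R x"
      by (simp add: algebra_simps)
    then show ?thesis
      using assms by simp
  qed
  then have "norm x + g x \<le> norm (t *\<^sub>R x) + g (t *\<^sub>R x)"
    using lip[of "t *\<^sub>R x" x] assms by (simp add: algebra_simps abs_le_iff)
  then have "2 * norm (t *\<^sub>R x) / (norm (t *\<^sub>R x) + g (t *\<^sub>R x)) \<le> 2 * norm (t *\<^sub>R x) / (norm x + g x)"
    by (intro divide_left_mono mult_pos_pos denom_pos) auto
  also have "\<dots> = t * (2 * norm x / (norm x + g x))"
    using assms by simp
  finally show ?thesis
    by (simp add: q_def)
qed

lemma level_mono: "c \<le> c' \<Longrightarrow> level c \<subseteq> level c'"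
  by (auto simp: level_def)

lemma level_le_1: "level 1 = {x. norm x < g x}"
  using denom_pos by (auto simp: level_def q_def divide_less_eq)

lemma level_bounded: "c \<le> 1 \<Longrightarrow> level c \<subseteq> ball 0 B"
proof
  fix x assume "c \<le> 1" "x \<in> level c"
  then have "norm x < g x"
    using level_mono[of c 1] unfolding level_le_1 by auto
  then show "x \<in> ball 0 B"
    using g_le[of x] by simp
qed

lemma ball_subset_level:
  assumes "0 < c"
  shows "ball 0 (c * g 0 / 2) \<subseteq> level c"
proof
  fix x :: 'a assume "x \<in> ball 0 (c * g 0 / 2)"
  then have "2 * norm x < c * g 0"
    by simp
  also have "\<dots> \<le> c * (norm x + g x)"
    using denom_ge assms by (intro mult_left_mono) auto
  finally show "x \<in> level c"
    using denom_pos[of x] by (simp add: level_def q_def divide_less_eq mult.commute)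
qed

lemma \<mu>_scale:
  assumes [measurable]: "S \<in> sets borel" and t: "0 < t"
  shows "\<mu> {x. (1 / t) *\<^sub>R x \<in> S} = \<mu> S"
proof -
  have [measurable]: "{x. (1 / t) *\<^sub>R x \<in> S} \<in> sets borel"
    using measurable_sets[of "\<lambda>x. (1 / t) *\<^sub>R x" borel borel S] by (simp add: vimage_def)
  have "\<mu> {x. (1 / t) *\<^sub>R x \<in> S} = ennreal (t ^ DIM('a)) *
      (\<integral>\<^sup>+x. ennreal (1 / norm (t *\<^sub>R x) ^ DIM('a)) * indicator {x. (1 / t) *\<^sub>R x \<in> S} (t *\<^sub>R x) \<partial>lborel)"
    unfolding \<mu>_def by (rule nn_integral_scaleR[OF _ t]) measurable
  also have "\<dots> = (\<integral>\<^sup>+x. ennreal (t ^ DIM('a)) * (ennreal (1 / norm (t *\<^sub>R x) ^ DIM('a)) * indicator {x. (1 / t) *\<^sub>R x \<in> S} (t *\<^sub>R x)) \<partial>lborel)"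
    by (rule nn_integral_cmult[symmetric]) measurable
  also have "\<dots> = \<mu> S"
    unfolding \<mu>_def using t
    by (intro nn_integral_cong)
      (auto simp: indicator_def ennreal_mult[symmetric] power_mult_distrib)
  finally show ?thesis .
qed

lemma \<mu>_union:
  assumes [measurable]: "S \<in> sets borel" "T \<in> sets borel" and "S \<inter> T = {}"
  shows "\<mu> (S \<union> T) = \<mu> S + \<mu> T"
proof -
  have "\<mu> (S \<union> T) = (\<integral>\<^sup>+x. ennreal (1 / norm x ^ DIM('a)) * indicator S x + ennreal (1 / norm x ^ DIM('a)) * indicator T x \<partial>lborel)"
    unfolding \<mu>_def using assms(3) by (intro nn_integral_cong) (auto simp: indicator_def)
  then show ?thesis
    unfolding \<mu>_def by (simp add: nn_integral_add)
qed

lemma \<mu>_mono: "S \<subseteq> T \<Longrightarrow> \<mu> S \<le> \<mu> T"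
  unfolding \<mu>_def by (intro nn_integral_mono) (auto simp: indicator_def)

lemma emeasure_ball_V: "0 \<le> r \<Longrightarrow> vol (ball (c :: 'a) r) = ennreal (V * r ^ DIM('a))"
  by (simp add: emeasure_ball V)

lemma \<mu>_ball_shell:
  assumes "0 < \<delta>" "1 < t"
  shows "ennreal (V * (1 - (1 / t) ^ DIM('a))) \<le> \<mu> (ball 0 \<delta> - ball 0 (\<delta> / t))"
proof -
  have sub: "ball 0 (\<delta> / t) \<subseteq> ball (0 :: 'a) \<delta>"
    using assms by (intro subset_ball) (simp add: field_simps)
  have "ennreal (V * (1 - (1 / t) ^ DIM('a))) = ennreal (1 / \<delta> ^ DIM('a)) * ennreal (V * \<delta> ^ DIM('a) - V * (\<delta> / t) ^ DIM('a))"
  proof -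
    have "V * (1 - (1 / t) ^ DIM('a)) = 1 / \<delta> ^ DIM('a) * (V * \<delta> ^ DIM('a) - V * (\<delta> / t) ^ DIM('a))"
      using assms by (simp add: field_simps)
    then show ?thesis
      using assms by (simp add: ennreal_mult'[symmetric])
  qed
  also have "\<dots> = ennreal (1 / \<delta> ^ DIM('a)) * vol (ball 0 \<delta> - ball (0 :: 'a) (\<delta> / t))"
    using assms sub by (subst emeasure_Diff) (auto simp: emeasure_ball_V ennreal_minus)
  also have "\<dots> = (\<integral>\<^sup>+x\<in>ball 0 \<delta> - ball (0 :: 'a) (\<delta> / t). ennreal (1 / \<delta> ^ DIM('a)) \<partial>lborel)"
    by (simp add: nn_integral_cmult_indicator)
  also have "\<dots> \<le> \<mu> (ball 0 \<delta> - ball 0 (\<delta> / t))"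
    unfolding \<mu>_def
  proof (intro nn_integral_mono)
    fix x :: 'a
    show "ennreal (1 / \<delta> ^ DIM('a)) * indicator (ball 0 \<delta> - ball 0 (\<delta> / t)) x
        \<le> ennreal (1 / norm x ^ DIM('a)) * indicator (ball 0 \<delta> - ball 0 (\<delta> / t)) x"
    proof (cases "x \<in> ball 0 \<delta> - ball 0 (\<delta> / t)")
      case True
      then have "0 < norm x" "norm x \<le> \<delta>"
        using assms by (auto intro: less_le_trans[OF divide_pos_pos])
      then have "1 / \<delta> ^ DIM('a) \<le> 1 / norm x ^ DIM('a)"
        using assms by (intro divide_left_mono power_mono mult_pos_pos zero_less_power) auto
      then show ?thesis
        using True by (auto intro!: ennreal_leI)
    qed auto
  qed
  finally show ?thesis .
qed

text \<open>The measure \<open>\<mu>\<close> is invariant under dilations, and the dilation of \<open>level c\<close> by \<open>t\<close> is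
  contained in \<open>level (t * c)\<close>.\<close>

lemma \<mu>_level_shell:
  assumes c: "0 < c" "t * c \<le> 1" and t: "1 < t"
  shows "ennreal (V * (1 - (1 / t) ^ DIM('a))) \<le> \<mu> (level (t * c) - level c)"
proof -
  \<comment> \<open>\<open>\<mu>\<close> has infinite mass at the origin. A small ball is taken out
    of \<open>level c\<close>, and its dilate out of the dilated set, so that only finite quantities
    are cancelled.\<close>
  define \<delta> where "\<delta> = c * g 0 / 2"
  have \<delta>: "0 < \<delta>"
    using c g0 by (simp add: \<delta>_def)
  have c1: "c \<le> 1"
    using c t by (smt (verit) mult_le_cancel_right1)
  define T where "T = {x. (1 / t) *\<^sub>R x \<in> level c}"
  have [measurable]: "T \<in> sets borel"
    using measurable_sets[of "\<lambda>x. (1 / t) *\<^sub>R x" borel borel "level c"] by (simp add: vimage_def T_def)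
  have sub: "ball 0 \<delta> \<subseteq> level c"
    unfolding \<delta>_def by (rule ball_subset_level[OF c(1)])
  have Tsub: "T \<subseteq> level (t * c)"
  proof
    fix x assume "x \<in> T"
    then have "q ((1 / t) *\<^sub>R x) < c"
      by (simp add: T_def level_def)
    then have "t * q ((1 / t) *\<^sub>R x) < t * c"
      using t by (intro mult_strict_left_mono) auto
    then show "x \<in> level (t * c)"
    proof -
      have "q x \<le> t * q ((1 / t) *\<^sub>R x)"
        using q_scale_le[of t "(1 / t) *\<^sub>R x"] t by simp
      with \<open>t * q ((1 / t) *\<^sub>R x) < t * c\<close> show ?thesis
        unfolding level_def mem_Collect_eq by linarith
    qed
  qed
  have fin: "\<mu> (level c - ball 0 \<delta>) < \<infinity>"
  proof -
    have "\<mu> (level c - ball 0 \<delta>) \<le> (\<integral>\<^sup>+x. ennreal (1 / \<delta> ^ DIM('a)) * indicator (ball (0 :: 'a) B) x \<partial>lborel)"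
      unfolding \<mu>_def using \<delta> level_bounded[OF c1]
      by (intro nn_integral_mono)
        (auto simp: indicator_def intro!: ennreal_leI divide_left_mono power_mono mult_pos_pos zero_less_power)
    also have "\<dots> = ennreal (1 / \<delta> ^ DIM('a)) * vol (ball (0 :: 'a) B)"
      by (simp add: nn_integral_cmult_indicator)
    also have "\<dots> < \<infinity>"
      using emeasure_lborel_ball_finite[of "0 :: 'a" B] by (simp add: ennreal_mult_less_top)
    finally show ?thesis .
  qed
  have "\<mu> (level c - ball 0 \<delta>) + \<mu> (ball 0 \<delta> - ball 0 (\<delta> / t)) = \<mu> (level c - ball 0 (\<delta> / t))"
  proof -
    have "ball (0 :: 'a) (\<delta> / t) \<subseteq> ball 0 \<delta>"
      using t \<delta> by (intro subset_ball) (simp add: field_simps)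
    then have "level c - ball 0 (\<delta> / t) = (level c - ball 0 \<delta>) \<union> (ball 0 \<delta> - ball 0 (\<delta> / t))"
      using sub by auto
    moreover have "\<mu> ((level c - ball 0 \<delta>) \<union> (ball 0 \<delta> - ball 0 (\<delta> / t))) =
        \<mu> (level c - ball 0 \<delta>) + \<mu> (ball 0 \<delta> - ball 0 (\<delta> / t))"
      by (intro \<mu>_union) auto
    ultimately show ?thesis
      by simp
  qed
  also have "\<dots> = \<mu> (T - ball 0 \<delta>)"
  proof -
    have "{x. (1 / t) *\<^sub>R x \<in> level c - ball 0 (\<delta> / t)} = T - ball 0 \<delta>"
      using t by (auto simp: T_def divide_less_cancel)
    then show ?thesis
      using \<mu>_scale[of "level c - ball 0 (\<delta> / t)" t] t by simp
  qed
  also have "\<dots> \<le> \<mu> ((level c - ball 0 \<delta>) \<union> (level (t * c) - level c))"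
    using Tsub by (intro \<mu>_mono) auto
  also have "\<dots> = \<mu> (level c - ball 0 \<delta>) + \<mu> (level (t * c) - level c)"
    by (intro \<mu>_union) auto
  finally have "\<mu> (ball 0 \<delta> - ball 0 (\<delta> / t)) \<le> \<mu> (level (t * c) - level c)"
    using fin by (auto simp: ennreal_add_left_cancel_le)
  with \<mu>_ball_shell[OF \<delta> t] show ?thesis
    by (rule order_trans)
qed

text \<open>By the inequality of arithmetic and geometric means, the square of \<open>q x\<close> is
  at most \<open>norm x / g x\<close>. This is the origin of the exponent
  \<open>2 * DIM('a)\<close>.\<close>

lemma inverse_radius_ge:
  assumes "x \<in> level 1" "0 < c" "c \<le> q x"
  shows "c ^ (2 * DIM('a)) * (1 / norm x ^ DIM('a)) \<le> 1 / g x ^ DIM('a)"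
proof -
  have x0: "0 < norm x"
    using assms by (auto simp: q_def)
  have gx: "norm x < g x"
    using assms(1) by (simp add: level_le_1)
  have "4 * (norm x * g x) \<le> (norm x + g x)\<^sup>2"
    using sum_squares_ge_zero[of "norm x - g x" 0] by (simp add: power2_eq_square algebra_simps)
  then have "4 * (norm x * g x) * (norm x / g x) \<le> (norm x + g x)\<^sup>2 * (norm x / g x)"
    using x0 less_trans[OF x0 gx] by (intro mult_right_mono divide_nonneg_pos) auto
  then have "(q x)\<^sup>2 \<le> norm x / g x"
    using x0 gx by (simp add: q_def power_divide power_mult_distrib divide_le_eq power2_eq_square mult.commute)
  moreover have "c\<^sup>2 \<le> (q x)\<^sup>2"
    using assms by (intro power_mono) auto
  ultimately have "(c\<^sup>2) ^ DIM('a) \<le> (norm x / g x) ^ DIM('a)"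
    by (intro power_mono) auto
  then show ?thesis
    using x0 less_trans[OF x0 gx] by (simp add: power_mult[symmetric] power_divide field_simps)
qed

lemma inverse_radius_partial_sum:
  assumes t: "1 < t"
  shows "ennreal (\<Sum>k<N. V * (1 - (1 / t) ^ DIM('a)) * ((1 / t) ^ Suc k) ^ (2 * DIM('a)))
    \<le> (\<integral>\<^sup>+x\<in>level 1 - level ((1 / t) ^ N). ennreal (1 / g x ^ DIM('a)) \<partial>lborel)"
proof (induction N)
  case (Suc N)
  define c where "c = (1 / t) ^ Suc N"
  have c: "0 < c" "t * c = (1 / t) ^ N" "c \<le> t * c" "t * c \<le> 1"
    using t by (auto simp: c_def power_le_one field_simps)
  have v: "0 \<le> V * (1 - (1 / t) ^ DIM('a))"
    using t by (intro mult_nonneg_nonneg) (auto simp: power_le_one)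
  have "ennreal (V * (1 - (1 / t) ^ DIM('a)) * c ^ (2 * DIM('a))) \<le> ennreal (c ^ (2 * DIM('a))) * \<mu> (level (t * c) - level c)"
    using \<mu>_level_shell[OF c(1) c(4) t] c v
    by (subst mult.commute, subst ennreal_mult) (auto intro!: mult_left_mono)
  also have "\<dots> = (\<integral>\<^sup>+x. ennreal (c ^ (2 * DIM('a))) * (ennreal (1 / norm x ^ DIM('a)) * indicator (level (t * c) - level c) x) \<partial>lborel)"
    unfolding \<mu>_def by (rule nn_integral_cmult[symmetric]) measurable
  also have "\<dots> \<le> (\<integral>\<^sup>+x\<in>level (t * c) - level c. ennreal (1 / g x ^ DIM('a)) \<partial>lborel)"
  proof (rule nn_integral_mono)
    fix x
    show "ennreal (c ^ (2 * DIM('a))) * (ennreal (1 / norm x ^ DIM('a)) * indicator (level (t * c) - level c) x)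
        \<le> ennreal (1 / g x ^ DIM('a)) * indicator (level (t * c) - level c) x"
    proof (cases "x \<in> level (t * c) - level c")
      case True
      then have "c ^ (2 * DIM('a)) * (1 / norm x ^ DIM('a)) \<le> 1 / g x ^ DIM('a)"
        using level_mono[OF c(4)] c by (intro inverse_radius_ge) (auto simp: level_def)
      then show ?thesis
        using True c by (simp add: ennreal_mult[symmetric] ennreal_leI)
    qed auto
  qed
  finally have 1: "ennreal (V * (1 - (1 / t) ^ DIM('a)) * c ^ (2 * DIM('a))) \<le>
      (\<integral>\<^sup>+x\<in>level (t * c) - level c. ennreal (1 / g x ^ DIM('a)) \<partial>lborel)" .
  have "ennreal (\<Sum>k<Suc N. V * (1 - (1 / t) ^ DIM('a)) * ((1 / t) ^ Suc k) ^ (2 * DIM('a))) =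
      ennreal (\<Sum>k<N. V * (1 - (1 / t) ^ DIM('a)) * ((1 / t) ^ Suc k) ^ (2 * DIM('a))) +
      ennreal (V * (1 - (1 / t) ^ DIM('a)) * c ^ (2 * DIM('a)))"
    using v t by (subst ennreal_plus[symmetric]) (auto simp: c_def intro!: sum_nonneg mult_nonneg_nonneg)
  also have "\<dots> \<le> (\<integral>\<^sup>+x\<in>level 1 - level (t * c). ennreal (1 / g x ^ DIM('a)) \<partial>lborel) +
      (\<integral>\<^sup>+x\<in>level (t * c) - level c. ennreal (1 / g x ^ DIM('a)) \<partial>lborel)"
    using Suc 1 by (intro add_mono) (simp_all only: c(2))
  also have "\<dots> = (\<integral>\<^sup>+x. ennreal (1 / g x ^ DIM('a)) * indicator (level 1 - level (t * c)) x +
      ennreal (1 / g x ^ DIM('a)) * indicator (level (t * c) - level c) x \<partial>lborel)"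
    by (rule nn_integral_add[symmetric]) measurable
  also have "\<dots> = (\<integral>\<^sup>+x\<in>level 1 - level c. ennreal (1 / g x ^ DIM('a)) \<partial>lborel)"
    using level_mono[OF c(3)] level_mono[OF c(4)]
    by (intro nn_integral_cong) (auto simp: indicator_def)
  finally show ?case
    by (simp only: c_def)
qed simp

text \<open>The shells of ratio \<open>t\<close> form a Riemann sum for the integral of n * V * c^(2
  * n - 1) over c from 0 to 1, which is V / 2. With v = t^(-n) the geometric series adds up to V *
  v^2 / (1 + v), and v tends to 1.\<close>

lemma inverse_radius_integral_0:
  "ennreal (V / 2) \<le> (\<integral>\<^sup>+x\<in>{x. norm x < g x}. ennreal (1 / g x ^ DIM('a)) \<partial>lborel)"
proof -
  define J where "J = (\<integral>\<^sup>+x\<in>{x. norm x < g x}. ennreal (1 / g x ^ DIM('a)) \<partial>lborel)"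
  have V0: "0 \<le> V"
    by simp
  have J: "ennreal (V * v\<^sup>2 * (1 - (v\<^sup>2) ^ N) / (1 + v)) \<le> J" if v: "0 < v" "v < 1" for v :: real and N
  proof -
    define t where "t = (1 / v) powr (1 / real DIM('a))"
    have t: "1 < t"
      using v powr_less_mono2[of "1 / real DIM('a)" 1 "1 / v"] by (simp add: t_def)
    have tv: "(1 / t) ^ DIM('a) = v"
      using v t by (simp add: t_def power_divide powr_realpow[symmetric] powr_powr)
    have tv': "((1 / t) ^ Suc k) ^ (2 * DIM('a)) = v\<^sup>2 * (v\<^sup>2) ^ k" for k
    proof -
      have "((1 / t) ^ Suc k) ^ (2 * DIM('a)) = ((1 / t) ^ DIM('a)) ^ (2 * Suc k)"
        by (simp only: power_mult[symmetric] mult_ac)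
      also have "\<dots> = v\<^sup>2 * (v\<^sup>2) ^ k"
        unfolding tv by (simp add: power_mult[symmetric] power_add[symmetric])
      finally show ?thesis .
    qed
    have "(v\<^sup>2) < 1"
      using v by (simp add: power_less_one_iff abs_square_less_1)
    have "(\<Sum>k<N. V * (1 - (1 / t) ^ DIM('a)) * ((1 / t) ^ Suc k) ^ (2 * DIM('a))) =
        V * (1 - v) * v\<^sup>2 * (\<Sum>k<N. (v\<^sup>2) ^ k)"
      unfolding tv tv' by (simp add: sum_distrib_left mult.assoc)
    also have "(\<Sum>k<N. (v\<^sup>2) ^ k) = (1 - (v\<^sup>2) ^ N) / (1 - v\<^sup>2)"
      using \<open>v\<^sup>2 < 1\<close> by (subst sum_gp_strict) auto
    also have "V * (1 - v) * v\<^sup>2 * ((1 - (v\<^sup>2) ^ N) / (1 - v\<^sup>2)) = V * v\<^sup>2 * (1 - (v\<^sup>2) ^ N) / (1 + v)"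
    proof -
      have "1 - v\<^sup>2 = (1 - v) * (1 + v)"
        by (simp add: power2_eq_square algebra_simps)
      then show ?thesis
        using v by simp
    qed
    finally have "ennreal (V * v\<^sup>2 * (1 - (v\<^sup>2) ^ N) / (1 + v)) \<le>
        (\<integral>\<^sup>+x\<in>level 1 - level ((1 / t) ^ N). ennreal (1 / g x ^ DIM('a)) \<partial>lborel)"
      using inverse_radius_partial_sum[OF t, of N] by simp
    also have "\<dots> \<le> J"
      unfolding J_def by (intro nn_integral_mono) (auto simp: indicator_def level_le_1)
    finally show ?thesis .
  qed
  show ?thesis
  proof (cases J)
    case (real j)
    have 1: "V * v\<^sup>2 / (1 + v) \<le> j" if v: "0 < v" "v < 1" for v
    proof (rule LIMSEQ_le_const2)
      have "(\<lambda>N. V * v\<^sup>2 * (1 - (v\<^sup>2) ^ N) / (1 + v)) \<longlonglongrightarrow> V * v\<^sup>2 * (1 - 0) / (1 + v)"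
        using v by (intro tendsto_intros LIMSEQ_realpow_zero) (auto simp: abs_square_less_1)
      then show "(\<lambda>N. V * v\<^sup>2 * (1 - (v\<^sup>2) ^ N) / (1 + v)) \<longlonglongrightarrow> V * v\<^sup>2 / (1 + v)"
        by simp
      show "\<exists>N0. \<forall>N\<ge>N0. V * v\<^sup>2 * (1 - (v\<^sup>2) ^ N) / (1 + v) \<le> j"
        using J[OF v] real by (auto simp: ennreal_le_iff)
    qed
    have "V * 1\<^sup>2 / (1 + 1) \<le> j"
    proof (rule LIMSEQ_le_const2)
      have "(\<lambda>k. 1 - 1 / real (Suc (Suc k))) \<longlonglongrightarrow> 1 - 0"
        by (intro tendsto_intros LIMSEQ_Suc lim_1_over_n)
      then have "(\<lambda>k. 1 - 1 / real (Suc (Suc k))) \<longlonglongrightarrow> 1"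
        by simp
      then show "(\<lambda>k. V * (1 - 1 / real (Suc (Suc k)))\<^sup>2 / (1 + (1 - 1 / real (Suc (Suc k))))) \<longlonglongrightarrow> V * 1\<^sup>2 / (1 + 1)"
        by (intro tendsto_intros) auto
      show "\<exists>N0. \<forall>k\<ge>N0. V * (1 - 1 / real (Suc (Suc k)))\<^sup>2 / (1 + (1 - 1 / real (Suc (Suc k)))) \<le> j"
        by (intro exI[of _ 0] allI impI 1) (auto simp: field_simps)
    qed
    then show ?thesis
      using real by (simp add: J_def[symmetric] ennreal_leI)
  qed (simp add: J_def[symmetric])
qed

end

lemma inverse_radius_integral:
  fixes g :: "'a :: euclidean_space \<Rightarrow> real"
  assumes lip: "\<And>x y. \<bar>g x - g y\<bar> \<le> norm (x - y)"
    and nonneg: "\<And>x. 0 \<le> g x" and le: "\<And>x. g x \<le> B" and pos: "0 < g y"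
  shows "ennreal (unit_ball_vol (real DIM('a)) / 2) \<le>
    (\<integral>\<^sup>+x\<in>{x. dist x y < g x}. ennreal (1 / g x ^ DIM('a)) \<partial>lborel)"
proof -
  interpret lipschitz_radius "\<lambda>x. g (y + x)" B "unit_ball_vol (real DIM('a))"
    using assms lip[of "y + _" "y + _"] by unfold_locales auto
  have g: "continuous_on UNIV g"
  proof (rule continuous_onI)
    fix x and e :: real assume "0 < e"
    then show "\<exists>d>0. \<forall>x'\<in>UNIV. dist x' x < d \<longrightarrow> dist (g x') (g x) \<le> e"
      by (intro exI[of _ e]) (auto simp: dist_norm intro: order_trans[OF assms(1)] less_imp_le)
  qed
  have [measurable]: "g \<in> borel_measurable borel"
    by (rule borel_measurable_continuous_onI[OF g])
  have "(\<integral>\<^sup>+x\<in>{x. dist x y < g x}. ennreal (1 / g x ^ DIM('a)) \<partial>lborel) =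
      (\<integral>\<^sup>+x\<in>{x. dist x y < g x}. ennreal (1 / g x ^ DIM('a)) \<partial>distr lborel borel ((+) y))"
    by (simp add: lborel_distr_plus)
  also have "\<dots> = (\<integral>\<^sup>+x\<in>{x. norm x < g (y + x)}. ennreal (1 / g (y + x) ^ DIM('a)) \<partial>lborel)"
    by (subst nn_integral_distr) (auto simp: dist_norm indicator_def intro!: nn_integral_cong)
  finally show ?thesis
    using inverse_radius_integral_0 by simp
qed

section \<open>A reverse weak type inequality in a cube\<close>

text \<open>A point at distance d outside a face goes to distance 2 * d inside it, whereas
  reflection goes to distance d. The two images differ by d, which is at most the distance in this
  coordinate from the point to any point of the cube; so they are never farther apart than a ball
  reaching the cube allows.\<close>

definition unfold_coord :: "real \<Rightarrow> real \<Rightarrow> real \<Rightarrow> real" where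
  "unfold_coord a l t = (if t < a then 3 * a - 2 * t else if t < a + l then t else 3 * (a + l) - 2 * t)"

text \<open>The coordinates are switched on one at a time, so that the measure estimate is an
  induction over \<open>J\<close>.\<close>

definition unfold_on :: "'n set \<Rightarrow> real ^ 'n \<Rightarrow> real \<Rightarrow> real ^ 'n \<Rightarrow> real ^ 'n" where
  "unfold_on J a l z = (\<chi> i. if i \<in> J then unfold_coord (a $ i) l (z $ i) else z $ i)"

definition near :: "'n set \<Rightarrow> real ^ 'n \<Rightarrow> real \<Rightarrow> (real ^ 'n) set" where
  "near J a l = {z. \<forall>i\<in>J. a $ i - l / 4 < z $ i \<and> z $ i < a $ i + 5 * l / 4}"

lemma borel_measurable_nth [measurable]: "(\<lambda>x :: real ^ 'n. x $ i) \<in> borel_measurable borel"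
  by (intro borel_measurable_continuous_onI continuous_on_component continuous_on_id)

lemma borel_measurable_vec_lambda [measurable (raw)]:
  fixes f :: "'n :: finite \<Rightarrow> 'a \<Rightarrow> 'b :: euclidean_space"
  assumes "\<And>i. f i \<in> borel_measurable N"
  shows "(\<lambda>x. \<chi> i. f i x) \<in> borel_measurable N"
proof (subst borel_measurable_euclidean_space, intro ballI)
  fix b :: "'b ^ 'n" assume "b \<in> Basis"
  then obtain i u where b: "b = axis i u"
    by (auto simp: Basis_vec_def)
  show "(\<lambda>x. (\<chi> i. f i x) \<bullet> b) \<in> borel_measurable N"
    using assms[of i] by (simp add: b inner_axis)
qed

lemma measurable_unfold_on [measurable]: "unfold_on J a l \<in> borel_measurable borel"
proof -
  have "(\<lambda>z :: real ^ 'a. if i \<in> J then unfold_coord (a $ i) l (z $ i) else z $ i) \<in> borel_measurable borel" for i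
    unfolding unfold_coord_def by (cases "i \<in> J") measurable
  then show ?thesis
    unfolding unfold_on_def[abs_def] by (rule borel_measurable_vec_lambda)
qed

lemma near_borel [measurable]: "near J a l \<in> sets borel"
proof -
  have "near J a l = (\<Inter>i. {z. i \<in> J \<longrightarrow> a $ i - l / 4 < z $ i \<and> z $ i < a $ i + 5 * l / 4})"
    by (auto simp: near_def)
  also have "\<dots> \<in> sets borel"
    by (intro sets.countable_INT') auto
  finally show ?thesis .
qed

lemma emeasure_reflect_stretch_coord:
  fixes Y :: "(real ^ 'n) set"
  assumes [measurable]: "Y \<in> sets borel"
  shows "vol Y = 2 * vol {z. (\<chi> i. if i = j then 3 * b - 2 * z $ i else z $ i) \<in> Y}"
proof -
  define c :: "real ^ 'n \<Rightarrow> real" where "c e = (if e = axis j 1 then - 2 else 1)" for e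
  define S :: "real ^ 'n \<Rightarrow> real ^ 'n" where
    "S x = (3 * b) *\<^sub>R axis j 1 + (\<Sum>e\<in>Basis. (c e * (x \<bullet> e)) *\<^sub>R e)" for x
  have S: "S z = (\<chi> i. if i = j then 3 * b - 2 * z $ i else z $ i)" for z
  proof (rule euclidean_eqI)
    fix e :: "real ^ 'n" assume "e \<in> Basis"
    then obtain i where e: "e = axis i 1"
      by (auto simp: Basis_vec_def)
    have "S z \<bullet> e = (3 * b) * (axis j 1 \<bullet> e) + c e * (z \<bullet> e)"
      using \<open>e \<in> Basis\<close> by (simp add: S_def inner_add_left)
    then show "S z \<bullet> e = (\<chi> i. if i = j then 3 * b - 2 * z $ i else z $ i) \<bullet> e"
      by (simp add: e c_def inner_axis axis_eq_axis) (simp add: axis_def)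
  qed
  have [measurable]: "S \<in> borel_measurable borel"
    unfolding S_def by measurable
  have "(\<Prod>e\<in>(Basis :: (real ^ 'n) set). \<bar>c e\<bar>) = (\<Prod>e\<in>(Basis :: (real ^ 'n) set). if e = axis j 1 then 2 else 1)"
    by (intro prod.cong) (auto simp: c_def)
  also have "\<dots> = 2"
    by (simp add: axis_in_Basis_iff)
  finally have p: "(\<Prod>e\<in>(Basis :: (real ^ 'n) set). \<bar>c e\<bar>) = 2" .
  have "lborel = density (distr lborel borel S) (\<lambda>_. ennreal (\<Prod>e\<in>(Basis :: (real ^ 'n) set). \<bar>c e\<bar>))"
    unfolding S_def by (rule lborel_affine_euclidean) (auto simp: c_def)
  then have "vol Y = emeasure (density (distr lborel borel S) (\<lambda>_. 2)) Y"
    unfolding p by simp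
  also have "\<dots> = 2 * vol {z. S z \<in> Y}"
    by (simp add: emeasure_density nn_integral_cmult_indicator emeasure_distr vimage_def)
  finally show ?thesis
    by (simp add: S)
qed

text \<open>Every point of the interval has at most one preimage outside of it in \<open>near\<close>, and there the
  map stretches lengths by the factor 2: this gives \<open>1 + 1 / 2\<close>.\<close>

lemma emeasure_unfold_coord_le:
  fixes Y :: "(real ^ 'n) set"
  assumes Y [measurable]: "Y \<in> sets borel" and l: "0 < l"
  shows "vol {z. unfold_on {j} a l z \<in> Y \<and> z \<in> near {j} a l} \<le> ennreal (3 / 2) * vol Y"
proof -
  \<comment> \<open>The two outer strips are mapped into different halves of the edge, so their
    preimages together have half the measure of \<open>Y\<close>, not all of it.\<close>
  define Y1 where "Y1 = Y \<inter> {x. x $ j < a $ j + l / 2}"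
  define Y2 where "Y2 = Y \<inter> {x. \<not> x $ j < a $ j + l / 2}"
  have [measurable]: "Y1 \<in> sets borel" "Y2 \<in> sets borel"
    by (simp_all add: Y1_def Y2_def)
  define S where "S b z = (\<chi> i. if i = j then 3 * b - 2 * z $ i else z $ i)" for b and z :: "real ^ 'n"
  have [measurable]: "S b \<in> borel_measurable borel" for b
    unfolding S_def[abs_def]
  proof (rule borel_measurable_vec_lambda)
    show "(\<lambda>z :: real ^ 'n. if i = j then 3 * b - 2 * z $ i else z $ i) \<in> borel_measurable borel" for i
      by (cases "i = j") measurable
  qed
  have half: "vol {z. S b z \<in> X} = ennreal (1 / 2) * vol X" if [measurable]: "X \<in> sets borel" for b X
  proof -
    have "ennreal (1 / 2) * vol X = (ennreal (1 / 2) * ennreal 2) * vol {z. S b z \<in> X}"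
      unfolding S_def emeasure_reflect_stretch_coord[OF that, of j b] by (simp add: mult.assoc)
    also have "ennreal (1 / 2) * ennreal 2 = 1"
      by (subst ennreal_mult[symmetric]) auto
    finally show ?thesis
      by simp
  qed
  have "{z. unfold_on {j} a l z \<in> Y \<and> z \<in> near {j} a l} \<subseteq> Y \<union> {z. S (a $ j) z \<in> Y1} \<union> {z. S (a $ j + l) z \<in> Y2}"
  proof
    fix z assume "z \<in> {z. unfold_on {j} a l z \<in> Y \<and> z \<in> near {j} a l}"
    then have z: "unfold_on {j} a l z \<in> Y" "a $ j - l / 4 < z $ j" "z $ j < a $ j + 5 * l / 4"
      by (auto simp: near_def)
    consider "z $ j < a $ j" | "a $ j \<le> z $ j" "z $ j < a $ j + l" | "a $ j + l \<le> z $ j"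
      by linarith
    then show "z \<in> Y \<union> {z. S (a $ j) z \<in> Y1} \<union> {z. S (a $ j + l) z \<in> Y2}"
    proof cases
      case 1
      then have "unfold_on {j} a l z = S (a $ j) z"
        by (simp add: unfold_on_def S_def unfold_coord_def vec_eq_iff)
      then show ?thesis
        using z by (simp add: Y1_def S_def)
    next
      case 2
      then have "unfold_on {j} a l z = z"
        by (simp add: unfold_on_def unfold_coord_def vec_eq_iff)
      then show ?thesis
        using z by simp
    next
      case 3
      then have "unfold_on {j} a l z = S (a $ j + l) z"
        using l by (simp add: unfold_on_def S_def unfold_coord_def vec_eq_iff)
      then show ?thesis
        using z by (simp add: Y2_def S_def algebra_simps)
    qed
  qed
  then have "vol {z. unfold_on {j} a l z \<in> Y \<and> z \<in> near {j} a l}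
      \<le> vol (Y \<union> {z. S (a $ j) z \<in> Y1} \<union> {z. S (a $ j + l) z \<in> Y2})"
    by (intro emeasure_mono) auto
  also have "\<dots> \<le> vol Y + vol {z. S (a $ j) z \<in> Y1} + vol {z. S (a $ j + l) z \<in> Y2}"
    by (intro order_trans[OF emeasure_subadditive] add_right_mono emeasure_subadditive) auto
  also have "\<dots> = vol Y + ennreal (1 / 2) * (vol Y1 + vol Y2)"
    by (simp add: half distrib_left add.assoc)
  also have "vol Y1 + vol Y2 = vol Y"
    by (subst plus_emeasure) (auto simp: Y1_def Y2_def intro!: arg_cong[of _ _ "vol"])
  also have "vol Y + ennreal (1 / 2) * vol Y = (ennreal 1 + ennreal (1 / 2)) * vol Y"
    by (simp add: distrib_right)
  also have "ennreal 1 + ennreal (1 / 2) = ennreal (3 / 2)"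
    by (subst ennreal_plus[symmetric]) auto
  finally show ?thesis .
qed

lemma emeasure_unfold_le:
  fixes Y :: "(real ^ 'n) set"
  assumes "finite J" and l: "0 < l" and "Y \<in> sets borel"
  shows "vol {z. unfold_on J a l z \<in> Y \<and> z \<in> near J a l} \<le> ennreal ((3 / 2) ^ card J) * vol Y"
  using assms(1,3)
proof (induction J arbitrary: Y rule: finite_induct)
  case empty
  then show ?case
    by (simp add: unfold_on_def near_def)
next
  case (insert j J)
  note [measurable] = insert.prems
  define Y' where "Y' = {z. unfold_on {j} a l z \<in> Y \<and> z \<in> near {j} a l}"
  have Y': "Y' \<in> sets borel"
    unfolding Y'_def by measurable
  have "unfold_on (insert j J) a l z = unfold_on {j} a l (unfold_on J a l z)" for z
    using insert.hyps by (auto simp: unfold_on_def vec_eq_iff)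
  moreover have "z \<in> near (insert j J) a l \<longleftrightarrow> z \<in> near J a l \<and> unfold_on J a l z \<in> near {j} a l" for z
    using insert.hyps by (auto simp: unfold_on_def near_def)
  ultimately have "{z. unfold_on (insert j J) a l z \<in> Y \<and> z \<in> near (insert j J) a l} =
      {z. unfold_on J a l z \<in> Y' \<and> z \<in> near J a l}"
    by (auto simp: Y'_def)
  also have "vol \<dots> \<le> ennreal ((3 / 2) ^ card J) * vol Y'"
    by (rule insert.IH[OF Y'])
  also have "\<dots> \<le> ennreal ((3 / 2) ^ card J) * (ennreal (3 / 2) * vol Y)"
    unfolding Y'_def by (intro mult_left_mono emeasure_unfold_coord_le insert.prems l) auto
  also have "\<dots> = (ennreal ((3 / 2) ^ card J) * ennreal (3 / 2)) * vol Y"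
    by (rule mult.assoc[symmetric])
  also have "ennreal ((3 / 2) ^ card J) * ennreal (3 / 2) = ennreal ((3 / 2) ^ card J * (3 / 2))"
    by (rule ennreal_mult[symmetric]) auto
  also have "(3 / 2) ^ card J * (3 / 2) = (3 / 2 :: real) ^ card (insert j J)"
    using insert.hyps by (simp add: mult.commute)
  finally show ?case .
qed

text \<open>The inner absolute value reflects at the lower face, the outer one at the upper face,
  and the maximum stops the map beyond distance 2 * l. The result is a 1-Lipschitz retraction of the
  whole space onto the closed cube.\<close>

definition fold_cube :: "real ^ 'n \<Rightarrow> real \<Rightarrow> real ^ 'n \<Rightarrow> real ^ 'n" where
  "fold_cube a l z = (\<chi> i. a $ i + max 0 (l - \<bar>l - \<bar>z $ i - a $ i\<bar>\<bar>))"

lemma fold_cube_lipschitz: "norm (fold_cube a l z - fold_cube a l z') \<le> norm (z - z')"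
  by (rule norm_le_componentwise_cart) (auto simp: fold_cube_def abs_if max_def)

lemma fold_cube_id:
  assumes "y \<in> hc a l"
  shows "fold_cube a l y = y"
proof -
  have "fold_cube a l y $ i = y $ i" for i
    using assms[unfolded hc_def, simplified, rule_format, of i]
    by (simp add: fold_cube_def abs_if max_def)
  then show ?thesis
    by (simp add: vec_eq_iff)
qed

lemma fold_cube_mem: "0 < l \<Longrightarrow> fold_cube a l z \<in> cbox a (a + vec l)"
  by (auto simp: fold_cube_def mem_box_cart)

lemma infdist_lipschitz: "\<bar>infdist x A - infdist y A\<bar> \<le> dist x y"
  using infdist_triangle[of x A y] infdist_triangle[of y A x] by (simp add: dist_commute abs_le_iff)

text \<open>A cube of edge l / (4 * sqrt n) has diameter l / 4; placed with a vertex at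
  \<open>z\<close>, it cannot reach the complement of \<open>E\<close>.\<close>

lemma large_depth_large_measure:
  fixes a :: "real ^ 'n"
  assumes l: "0 < l" and z: "z \<in> cbox a (a + vec l)" and far: "\<And>q. q \<in> hc a l - E \<Longrightarrow> l / 4 < dist z q"
    and [measurable]: "E \<in> sets borel"
  shows "ennreal ((l / (4 * sqrt CARD('n))) ^ CARD('n)) \<le> vol E"
proof -
  define r where "r = l / (4 * sqrt CARD('n))"
  have n1: "1 \<le> sqrt (real CARD('n))"
    using zero_less_card_finite[where 'a='n] by simp
  have r: "0 < r" "r \<le> l / 4" "sqrt CARD('n) * r = l / 4"
    using l n1 by (auto simp: r_def field_simps)
  \<comment> \<open>In each coordinate the small cube extends from \<open>z\<close> towards the
    farther face, hence stays inside.\<close>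
  define c where "c = (\<chi> i. if z $ i \<le> a $ i + l / 2 then z $ i else z $ i - r)"
  have "box c (c + vec r) \<subseteq> E"
  proof
    fix x assume x: "x \<in> box c (c + vec r)"
    have xi: "c $ i < x $ i" "x $ i < c $ i + r" for i
      using x by (auto simp: mem_box_cart)
    have zi: "a $ i \<le> z $ i" "z $ i \<le> a $ i + l" for i
      using z by (auto simp: mem_box_cart)
    have xH: "x \<in> hc a l"
      unfolding hc_def mem_Collect_eq
    proof
      fix i show "a $ i \<le> x $ i \<and> x $ i < a $ i + l"
        using xi[of i] zi[of i] r l by (auto simp: c_def split: if_splits)
    qed
    have "norm (z - x) \<le> norm (vec r :: real ^ 'n)"
    proof (rule norm_le_componentwise_cart)
      fix i show "norm ((z - x) $ i) \<le> norm ((vec r :: real ^ 'n) $ i)"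
        using xi[of i] r by (auto simp: c_def split: if_splits)
    qed
    also have "\<dots> = l / 4"
      using r by (simp add: norm_vec_def L2_set_def real_sqrt_mult)
    finally show "x \<in> E"
      using far[of x] xH by (force simp: dist_norm)
  qed
  then have "vol (box c (c + vec r)) \<le> vol E"
    by (intro emeasure_mono) auto
  then show ?thesis
    using r by (simp add: emeasure_cube_cart r_def)
qed

text \<open>The smallness of \<open>E\<close> keeps the centers within \<open>l / 4\<close> of the cube, where the map
  \<open>unfold_on\<close> covers each half of an edge from one side only.\<close>

theorem reverse_weak_type:
  fixes f :: "real ^ 'n \<Rightarrow> ennreal" and a :: "real ^ 'n"
  assumes f [measurable]: "f \<in> borel_measurable borel" and l: "0 < l" and u: "0 \<le> u"
    and E [measurable]: "E \<in> sets borel" and EH: "E \<subseteq> hc a l"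
    and touch: "\<And>z \<rho> q. 0 < \<rho> \<Longrightarrow> q \<in> ball z \<rho> \<Longrightarrow> q \<in> hc a l - E \<Longrightarrow>
      (\<integral>\<^sup>+x\<in>ball z \<rho> \<inter> hc a l. f x \<partial>lborel) \<le> ennreal u * vol (ball z \<rho>)"
    and openE: "\<And>y. y \<in> E \<Longrightarrow> \<exists>e>0. ball y e \<inter> hc a l \<subseteq> E"
    and small: "vol E < ennreal ((l / (4 * sqrt CARD('n))) ^ CARD('n))"
  shows "(\<integral>\<^sup>+x\<in>E. f x \<partial>lborel) \<le> ennreal (2 * (3 / 2) ^ CARD('n) * u) * vol E"
proof -
  define F where "F = hc a l - E"
  define \<omega> where "\<omega> = unit_ball_vol (real CARD('n))"
  have \<omega>: "0 < \<omega>"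
    by (simp add: \<omega>_def)
  have [measurable]: "F \<in> sets borel"
    by (simp add: F_def)
  \<comment> \<open>Reflection keeps the depth 1-Lipschitz and bounded on the whole space;
    \<open>inverse_radius_integral\<close> counts centers on both sides of the faces, so points of
    \<open>E\<close> near a face lose no weight.\<close>
  define g where "g z = infdist (fold_cube a l z) F" for z
  have Fne: "F \<noteq> {}"
  proof
    assume "F = {}"
    then have "ennreal ((l / (4 * sqrt CARD('n))) ^ CARD('n)) \<le> vol E"
      using l by (intro large_depth_large_measure[of l a a E]) (auto simp: F_def mem_box_cart)
    then show False
      using small by simp
  qed
  have depth: "infdist z F \<le> l / 4" if "z \<in> cbox a (a + vec l)" for z
  proof (rule ccontr)
    assume "\<not> infdist z F \<le> l / 4"
    then have "ennreal ((l / (4 * sqrt CARD('n))) ^ CARD('n)) \<le> vol E"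
      using l that infdist_le[of _ F z] by (intro large_depth_large_measure[of l z a E]) (force simp: F_def)+
    then show False
      using small by simp
  qed
  have g_lip: "\<bar>g x - g y\<bar> \<le> norm (x - y)" for x y
    unfolding g_def using infdist_lipschitz[of "fold_cube a l x" F "fold_cube a l y"] fold_cube_lipschitz[of a l x y]
    by (simp add: dist_norm)
  have g0: "0 \<le> g x" for x
    by (simp add: g_def infdist_nonneg)
  have gl: "g x \<le> l / 4" for x
    unfolding g_def by (intro depth fold_cube_mem l)
  have [measurable]: "g \<in> borel_measurable borel"
  proof (rule borel_measurable_continuous_onI, rule continuous_onI)
    fix x and e :: real assume "0 < e"
    then show "\<exists>d>0. \<forall>x'\<in>UNIV. dist x' x < d \<longrightarrow> dist (g x') (g x) \<le> e"
      by (intro exI[of _ e]) (auto simp: dist_norm intro: order_trans[OF g_lip] less_imp_le)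
  qed
  have gE: "0 < g y" if yE: "y \<in> E" for y
  proof -
    obtain e where e: "0 < e" "ball y e \<inter> hc a l \<subseteq> E"
      using openE[OF yE] by blast
    have "e \<le> infdist y F"
      unfolding infdist_notempty[OF Fne] using e Fne
      by (intro cINF_greatest) (force simp: F_def)+
    then show ?thesis
      using e EH yE by (simp add: g_def fold_cube_id subset_iff)
  qed
  have ball_le: "(\<integral>\<^sup>+x\<in>ball z (g z) \<inter> hc a l. f x \<partial>lborel) \<le> ennreal (u * (\<omega> * g z ^ CARD('n)))" for z
  proof -
    \<comment> \<open>A ball whose radius is exactly the distance to \<open>F\<close> need not meet
      \<open>F\<close>. The radius is enlarged by \<eta>, and \<eta> tends to 0 at the end.\<close>
    define \<rho> where "\<rho> \<eta> = g z + \<eta>" for \<eta> :: real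
    have *: "(\<integral>\<^sup>+x\<in>ball z (g z) \<inter> hc a l. f x \<partial>lborel) \<le> ennreal (u * (\<omega> * \<rho> \<eta> ^ CARD('n)))" if "0 < \<eta>" for \<eta>
    proof -
      have \<rho>: "0 < \<rho> \<eta>" "g z < \<rho> \<eta>"
        using that g0[of z] by (auto simp: \<rho>_def)
      obtain q where q: "q \<in> F" "dist (fold_cube a l z) q < \<rho> \<eta>"
      proof -
        have "(INF q\<in>F. dist (fold_cube a l z) q) < \<rho> \<eta>"
          using \<rho> by (simp add: g_def infdist_notempty[OF Fne])
        then show ?thesis
          using that Fne by (subst (asm) cINF_less_iff) auto
      qed
      \<comment> \<open>Points of the cube are fixed by the fold, which does not increase distances:
        moving the center into the cube loses no point of the cube.\<close>
      have "ball z (g z) \<inter> hc a l \<subseteq> ball (fold_cube a l z) (\<rho> \<eta>) \<inter> hc a l"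
      proof
        fix y assume y: "y \<in> ball z (g z) \<inter> hc a l"
        then have "norm (fold_cube a l z - y) \<le> norm (z - y)"
          using fold_cube_lipschitz[of a l z y] by (simp add: fold_cube_id)
        then show "y \<in> ball (fold_cube a l z) (\<rho> \<eta>) \<inter> hc a l"
          using y \<rho> by (auto simp: dist_norm)
      qed
      then have "(\<integral>\<^sup>+x\<in>ball z (g z) \<inter> hc a l. f x \<partial>lborel) \<le> (\<integral>\<^sup>+x\<in>ball (fold_cube a l z) (\<rho> \<eta>) \<inter> hc a l. f x \<partial>lborel)"
        by (intro nn_integral_mono) (auto simp: indicator_def)
      also have "\<dots> \<le> ennreal u * vol (ball (fold_cube a l z) (\<rho> \<eta>))"
        using q \<rho> by (intro touch) (auto simp: F_def)
      also have "\<dots> = ennreal (u * (\<omega> * \<rho> \<eta> ^ CARD('n)))"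
        using u \<rho> \<omega> by (simp add: emeasure_ball \<omega>_def ennreal_mult)
      finally show ?thesis .
    qed
    have lim: "(\<lambda>k. ennreal (u * (\<omega> * \<rho> (1 / real (Suc k)) ^ CARD('n)))) \<longlonglongrightarrow> ennreal (u * (\<omega> * (g z + 0) ^ CARD('n)))"
      unfolding \<rho>_def by (intro tendsto_intros LIMSEQ_Suc lim_1_over_n)
    show ?thesis
      using LIMSEQ_le_const[OF lim] * by auto
  qed
  \<comment> \<open>The unfolded center may land on a face that the half-open cube omits; so
    \<open>cbox\<close> minus \<open>F\<close> appears, which is \<open>E\<close> up to a null
    set.\<close>
  define Z where "Z = {z. unfold_on UNIV a l z \<in> cbox a (a + vec l) - F \<and> z \<in> near UNIV a l}"
  have [measurable]: "Z \<in> sets borel"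
    unfolding Z_def by measurable
  have ZI: "z \<in> Z" if y: "y \<in> hc a l" and zy: "dist z y < g z" for z y
  proof -
    have comp: "\<bar>z $ i - y $ i\<bar> < l / 4" for i
      using component_le_norm_cart[of "z - y" i] zy gl[of z] by (simp add: dist_norm)
    have yi: "a $ i \<le> y $ i" "y $ i < a $ i + l" for i
      using y by (auto simp: hc_def)
    have nearz: "z \<in> near UNIV a l"
      unfolding near_def
    proof (intro CollectI ballI)
      fix i show "a $ i - l / 4 < z $ i \<and> z $ i < a $ i + 5 * l / 4"
        using comp[of i] yi[of i] by (auto simp: abs_if split: if_splits)
    qed
    define x where "x = unfold_on UNIV a l z"
    \<comment> \<open>The unfolded center is no farther from the folded center than \<open>z\<close>
      is from \<open>y\<close>. Since that distance is below the depth of the folded center, the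
      unfolded center avoids \<open>F\<close>.\<close>
    have xi: "a $ i \<le> x $ i \<and> x $ i \<le> a $ i + l \<and> \<bar>x $ i - fold_cube a l z $ i\<bar> \<le> \<bar>z $ i - y $ i\<bar>" for i
      using comp[of i] yi[of i] l
      by (auto simp: x_def unfold_on_def unfold_coord_def fold_cube_def abs_if max_def split: if_splits)
    have "norm (x - fold_cube a l z) \<le> norm (z - y)"
      by (rule norm_le_componentwise_cart) (use xi in auto)
    then have "dist (fold_cube a l z) x < infdist (fold_cube a l z) F"
      using zy by (simp add: g_def dist_norm norm_minus_commute)
    then have "x \<notin> F"
      using infdist_le[of x F "fold_cube a l z"] by auto
    moreover have "x \<in> cbox a (a + vec l)"
      using xi by (auto simp: mem_box_cart)
    ultimately show ?thesis
      using nearz by (simp add: Z_def x_def)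
  qed
  have "vol Z \<le> ennreal ((3 / 2) ^ CARD('n)) * vol (cbox a (a + vec l) - F)"
    unfolding Z_def by (rule emeasure_unfold_le[OF finite l]) measurable
  also have "vol (cbox a (a + vec l) - F) \<le> vol E"
  proof -
    have "vol (cbox a (a + vec l) - hc a l) = 0"
      using l emeasure_hc[of l a] by (subst emeasure_Diff) (auto simp: hc_subset_cbox emeasure_cube_cart)
    moreover have "vol (cbox a (a + vec l) - F) \<le> vol E + vol (cbox a (a + vec l) - hc a l)"
      using EH by (intro order_trans[OF emeasure_mono emeasure_subadditive]) (auto simp: F_def)
    ultimately show ?thesis
      by simp
  qed
  finally have Zle: "vol Z \<le> ennreal ((3 / 2) ^ CARD('n)) * vol E"
    by (simp add: mult_left_mono)
  \<comment> \<open>Double counting: integrated over the centers first, every point of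
    \<open>E\<close> receives at least \<omega> / 2; integrated over the points first, every center
    in \<open>Z\<close> contributes at most \<open>u * \<omega>\<close>, because the weight cancels
    the volume of its ball.\<close>
  define \<phi> where "\<phi> z y = (f y * indicator E y) * (ennreal (1 / g z ^ CARD('n)) * (if dist z y < g z then 1 else 0))" for z y
  have \<phi>_borel [measurable]: "(\<lambda>(z, y). \<phi> z y) \<in> borel_measurable (lborel \<Otimes>\<^sub>M lborel)"
    unfolding \<phi>_def by measurable
  have "ennreal (\<omega> / 2) * (\<integral>\<^sup>+y\<in>E. f y \<partial>lborel) = (\<integral>\<^sup>+y. (f y * indicator E y) * ennreal (\<omega> / 2) \<partial>lborel)"
    by (subst nn_integral_multc) (measurable, simp add: mult.commute)
  also have "\<dots> \<le> (\<integral>\<^sup>+y. (\<integral>\<^sup>+z. \<phi> z y \<partial>lborel) \<partial>lborel)"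
  proof (rule nn_integral_mono)
    fix y
    show "(f y * indicator E y) * ennreal (\<omega> / 2) \<le> (\<integral>\<^sup>+z. \<phi> z y \<partial>lborel)"
    proof (cases "y \<in> E")
      case True
      have "ennreal (\<omega> / 2) \<le> (\<integral>\<^sup>+z\<in>{z. dist z y < g z}. ennreal (1 / g z ^ CARD('n)) \<partial>lborel)"
        using inverse_radius_integral[OF g_lip g0 gl gE[OF True]] by (simp add: \<omega>_def)
      also have "\<dots> = (\<integral>\<^sup>+z. ennreal (1 / g z ^ CARD('n)) * (if dist z y < g z then 1 else 0) \<partial>lborel)"
        by (intro nn_integral_cong) (auto simp: indicator_def)
      finally show ?thesis
        unfolding \<phi>_def by (subst nn_integral_cmult) (auto intro!: mult_left_mono)
    qed auto
  qed
  also have "\<dots> = (\<integral>\<^sup>+z. (\<integral>\<^sup>+y. \<phi> z y \<partial>lborel) \<partial>lborel)"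
    using lborel_pair.Fubini'[OF \<phi>_borel] by simp
  also have "\<dots> \<le> (\<integral>\<^sup>+z. ennreal (u * \<omega>) * indicator Z z \<partial>lborel)"
  proof (rule nn_integral_mono)
    fix z
    show "(\<integral>\<^sup>+y. \<phi> z y \<partial>lborel) \<le> ennreal (u * \<omega>) * indicator Z z"
    proof (cases "\<exists>y\<in>E. dist z y < g z")
      case True
      then obtain y where y: "y \<in> E" "dist z y < g z"
        by blast
      have gz: "0 < g z"
        using y(2) by (meson le_less_trans zero_le_dist)
      have [measurable]: "ball z (g z) \<inter> hc a l \<in> sets borel"
        by simp
      have "(\<integral>\<^sup>+y. \<phi> z y \<partial>lborel) \<le> (\<integral>\<^sup>+y. ennreal (1 / g z ^ CARD('n)) * (f y * indicator (ball z (g z) \<inter> hc a l) y) \<partial>lborel)"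
        using EH by (intro nn_integral_mono) (auto simp: \<phi>_def indicator_def mult.commute)
      also have "\<dots> = ennreal (1 / g z ^ CARD('n)) * (\<integral>\<^sup>+y\<in>ball z (g z) \<inter> hc a l. f y \<partial>lborel)"
        by (rule nn_integral_cmult) measurable
      also have "\<dots> \<le> ennreal (1 / g z ^ CARD('n)) * ennreal (u * (\<omega> * g z ^ CARD('n)))"
        by (intro mult_left_mono ball_le) auto
      also have "\<dots> = ennreal (u * \<omega>)"
        using gz u \<omega> by (simp add: ennreal_mult'[symmetric])
      finally show ?thesis
        using ZI[OF _ y(2)] y(1) EH by auto
    next
      case False
      then have "(\<integral>\<^sup>+y. \<phi> z y \<partial>lborel) = (\<integral>\<^sup>+y. 0 \<partial>(lborel :: (real ^ 'n) measure))"
        by (intro nn_integral_cong) (auto simp: \<phi>_def indicator_def)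
      then show ?thesis
        by simp
    qed
  qed
  also have "\<dots> = ennreal (u * \<omega>) * vol Z"
    by (simp add: nn_integral_cmult_indicator)
  also have "\<dots> \<le> ennreal (u * \<omega>) * (ennreal ((3 / 2) ^ CARD('n)) * vol E)"
    by (intro mult_left_mono Zle) auto
  finally have "ennreal (\<omega> / 2) * (\<integral>\<^sup>+y\<in>E. f y \<partial>lborel) \<le> ennreal (u * \<omega>) * (ennreal ((3 / 2) ^ CARD('n)) * vol E)" .
  then have "ennreal (2 / \<omega>) * (ennreal (\<omega> / 2) * (\<integral>\<^sup>+y\<in>E. f y \<partial>lborel)) \<le>
      ennreal (2 / \<omega>) * (ennreal (u * \<omega>) * (ennreal ((3 / 2) ^ CARD('n)) * vol E))"
    by (rule mult_left_mono) simp
  moreover have "ennreal (2 / \<omega>) * (ennreal (\<omega> / 2) * X) = X" for X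
  proof -
    have "ennreal (2 / \<omega>) * ennreal (\<omega> / 2) = 1"
      using \<omega> by (subst ennreal_mult[symmetric]) auto
    then show ?thesis
      by (simp only: mult.assoc[symmetric] mult_1_left)
  qed
  moreover have "ennreal (2 / \<omega>) * (ennreal (u * \<omega>) * (ennreal ((3 / 2) ^ CARD('n)) * X)) = ennreal (2 * (3 / 2) ^ CARD('n) * u) * X" for X
  proof -
    have "ennreal (2 / \<omega>) * ennreal (u * \<omega>) * ennreal ((3 / 2) ^ CARD('n)) = ennreal (2 / \<omega> * (u * \<omega>) * (3 / 2) ^ CARD('n))"
      using \<omega> u by (subst ennreal_mult[symmetric], simp, simp)+ simp
    also have "2 / \<omega> * (u * \<omega>) * (3 / 2) ^ CARD('n) = 2 * (3 / 2) ^ CARD('n) * u"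
      using \<omega> by simp
    finally show ?thesis
      by (simp only: mult.assoc[symmetric])
  qed
  ultimately show ?thesis
    by simp
qed

definition circum_ratio :: "nat \<Rightarrow> real" where
  "circum_ratio n = unit_ball_vol (real n) * (sqrt (real n) / 2) ^ n"

lemma circum_ratio_pos: "0 < n \<Longrightarrow> 0 < circum_ratio n"
  by (simp add: circum_ratio_def)

section \<open>Numerical estimates\<close>

text \<open>The largest ratio of \<open>ln t\<close> and \<open>1 - 1 / t\<close> for \<open>1 < t \<le> 2 ^ n\<close>.\<close>

definition jump_ratio :: "nat \<Rightarrow> real" where
  "jump_ratio n = n * ln 2 / (1 - (1 / 2) ^ n)"

lemma jump_ratio_ge: "0 < n \<Longrightarrow> n * ln 2 \<le> jump_ratio n"
  by (simp add: jump_ratio_def field_simps power_one_over)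

text \<open>As a function of 1 / t, minus the logarithm is convex and lies below its chord between
  2^(-n) and 1; \<open>jump_ratio n\<close> is the steepness of that chord.\<close>

lemma ln_le_jump_ratio:
  assumes n: "0 < n" and t: "1 \<le> t" "t \<le> 2 ^ n"
  shows "t * ln t \<le> jump_ratio n * (t - 1)"
proof -
  define v where "v = (1 / 2 :: real) ^ n"
  have v: "0 < v" "v < 1"
    using n by (auto simp: v_def power_less_one_iff)
  have "convex_on {0<..} (\<lambda>x. - log (exp 1) x)"
    by (rule minus_log_convex) simp
  then have conv: "convex_on {0<..} (\<lambda>x :: real. - ln x)"
    by (simp add: log_def)
  define \<theta> where "\<theta> = (1 - 1 / t) / (1 - v)"
  have tv: "v \<le> 1 / t"
    using t by (simp add: v_def power_one_over field_simps)
  have \<theta>: "0 \<le> \<theta>" "\<theta> \<le> 1"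
    using t tv v by (auto simp: \<theta>_def divide_le_eq)
  have "(1 - \<theta>) * 1 + \<theta> * v = 1 - \<theta> * (1 - v)"
    by (simp add: algebra_simps)
  also have "\<dots> = 1 / t"
    using v by (simp add: \<theta>_def)
  finally have eq: "(1 - \<theta>) * 1 + \<theta> * v = 1 / t" .
  have "- ln ((1 - \<theta>) *\<^sub>R 1 + \<theta> *\<^sub>R v) \<le> (1 - \<theta>) * (- ln 1) + \<theta> * (- ln v)"
    using \<theta> v by (intro convex_onD[OF conv]) auto
  then have "- ln (1 / t) \<le> \<theta> * (- ln v)"
    using eq by simp
  moreover have "- ln (1 / t) = ln t"
    using t by (simp add: ln_div)
  moreover have "- ln v = n * ln 2"
    by (simp add: v_def ln_realpow ln_div)
  ultimately have "ln t \<le> \<theta> * (n * ln 2)"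
    by (simp only:)
  also have "\<dots> = jump_ratio n * (1 - 1 / t)"
    by (simp add: \<theta>_def jump_ratio_def v_def)
  finally have "ln t \<le> jump_ratio n * (1 - 1 / t)" .
  then have "t * ln t \<le> t * (jump_ratio n * (1 - 1 / t))"
    using t by (intro mult_left_mono) auto
  also have "t * (jump_ratio n * (1 - 1 / t)) = jump_ratio n * (t - 1)"
    using t by (simp add: field_simps)
  finally show ?thesis .
qed

text \<open>The restriction on \<open>n\<close> is sharp: at n = 5 the left side is about 65.8 and
  the right side 64.\<close>

lemma jump_circum_le:
  assumes n: "0 < n" "n \<le> 4"
  shows "2 * jump_ratio n * circum_ratio n \<le> 2 ^ (n + 1)"
proof -
  have l: "ln 2 \<le> (25 / 36 :: real)"
    by (rule ln2_le_25_over_36)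
  have pi: "pi \<le> 3.2"
    using pi_less_4 pi_approx by simp
  consider "n = 1" | "n = 2" | "n = 3" | "n = 4"
    using n by linarith
  then show ?thesis
  proof cases
    case 1
    then show ?thesis
      using l by (simp add: jump_ratio_def circum_ratio_def)
  next
    case 2
    have "ln 2 * pi \<le> 25 / 36 * 3.2"
      using l pi by (intro mult_mono) auto
    then show ?thesis
      using 2 by (simp add: jump_ratio_def circum_ratio_def eval_unit_ball_vol power_divide field_simps)
  next
    case 3
    have s: "sqrt 3 \<le> 1.75"
      by (rule real_le_lsqrt) (auto simp: power2_eq_square)
    have "ln 2 * pi * sqrt 3 \<le> 25 / 36 * 3.2 * 1.75"
      using l pi s by (intro mult_mono) auto
    moreover have "(sqrt 3) ^ 3 = 3 * sqrt 3"
      by (simp add: power3_eq_cube)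
    ultimately show ?thesis
      using 3 by (simp add: jump_ratio_def circum_ratio_def eval_unit_ball_vol power_divide field_simps)
  next
    case 4
    have "ln 2 * pi ^ 2 \<le> 25 / 36 * 3.2 ^ 2"
      using l pi by (intro mult_mono power_mono) auto
    moreover have "sqrt 4 = (2 :: real)"
      by simp
    ultimately show ?thesis
      using 4 by (simp add: jump_ratio_def circum_ratio_def eval_unit_ball_vol power_divide field_simps)
  qed
qed

text \<open>The leading terms are compared by \<open>jump_circum_le\<close>. Subtracting the average
  inside the energy yields -2 * \<open>jump_ratio n\<close>, which pays for \<open>n * ln 2\<close>
  and for the -1 on the right.\<close>

lemma dyadic_constant:
  assumes n: "0 < n" "n \<le> 4" and A: "1 \<le> A"
  shows "2 * (jump_ratio n * (circum_ratio n * A - 1)) + n * ln 2 \<le> 2 ^ (n + 1) * A - 1"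
proof -
  have l: "2 / 3 \<le> ln (2 :: real)"
    by (rule ln2_ge_two_thirds)
  have "1 \<le> 2 * jump_ratio n - n * ln 2"
  proof (cases "n = 1")
    case True
    then show ?thesis
      using l by (simp add: jump_ratio_def)
  next
    case False
    have "real n * ln 2 \<ge> 2 * (2 / 3)"
      using n False l by (intro mult_mono) auto
    then show ?thesis
      using jump_ratio_ge[OF n(1)] by linarith
  qed
  moreover have "2 * jump_ratio n * circum_ratio n * A \<le> 2 ^ (n + 1) * A"
    using jump_circum_le[OF n] A by (intro mult_right_mono) auto
  ultimately show ?thesis
    by (simp add: algebra_simps)
qed

section \<open>The constants in dimension at least 5\<close>

lemma unit_ball_vol_Suc_Suc: "unit_ball_vol (real (n + 2)) = unit_ball_vol (real n) * (2 * pi / (n + 2))"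
proof -
  have "Gamma (real n / 2 + 1 + 1) = (real n / 2 + 1) * Gamma (real n / 2 + 1)"
    by (rule Gamma_plus1) (auto simp: nonpos_Ints_def)
  moreover have "real (n + 2) / 2 + 1 = real n / 2 + 1 + 1"
    by simp
  ultimately have G: "Gamma (real (n + 2) / 2 + 1) = (real n / 2 + 1) * Gamma (real n / 2 + 1)"
    by (simp only:)
  have P: "pi powr (real (n + 2) / 2) = pi powr (real n / 2) * pi"
    by (simp add: add_divide_distrib powr_add)
  have "unit_ball_vol (real (n + 2)) = unit_ball_vol (real n) * (pi / (real n / 2 + 1))"
    unfolding unit_ball_vol_def P G by (simp only: times_divide_times_eq mult.commute)
  also have "pi / (real n / 2 + 1) = 2 * pi / (n + 2)"
    by (simp add: field_simps)
  finally show ?thesis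
    by simp
qed

text \<open>From n = 5 on, the two-step recursion multiplies by 2 * pi / (n + 2) < 1. The bound is
  chosen as a power of 2, since only its logarithm is used.\<close>

lemma unit_ball_vol_le_8: "5 \<le> n \<Longrightarrow> unit_ball_vol (real n) \<le> 8"
proof (induction n rule: less_induct)
  case (less n)
  have pi: "pi \<le> 3.2"
    using pi_less_4 pi_approx by simp
  consider "n = 5" | "n = 6" | "7 \<le> n"
    using less.prems by linarith
  then show ?case
  proof cases
    case 1
    have "pi ^ 2 \<le> 3.2 ^ 2"
      using pi by (intro power_mono) auto
    then show ?thesis
      using 1 by (simp add: eval_unit_ball_vol field_simps)
  next
    case 2
    have "pi ^ 3 \<le> 3.2 ^ 3"
      using pi by (intro power_mono) auto
    then show ?thesis
      using 2 by (simp add: eval_unit_ball_vol field_simps)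
  next
    case 3
    define m where "m = n - 2"
    have m: "n = m + 2" "5 \<le> m" "m < n"
      using 3 by (auto simp: m_def)
    have "unit_ball_vol (real m) * (2 * pi / (m + 2)) \<le> 8 * 1"
      using less.IH[OF m(3,2)] m(2) pi by (intro mult_mono) (auto simp: divide_le_eq)
    then show ?thesis
      unfolding m(1) unit_ball_vol_Suc_Suc by simp
  qed
qed

text \<open>The quadratic polynomial dominates 2 * ln \<omega> + 2 * n * ln (2 * n) + n * ln 2 + 1,
  as these terms are estimated in \<open>weak_type_constant\<close>, with \<omega> the volume of the
  unit ball. Every part at most doubles from n to n + 1. The start is narrow: 62.425 against
  64.\<close>

lemma weak_type_growth:
  "5 \<le> n \<Longrightarrow> 4 * (3 / 2) ^ n + (2 / 5 * real n ^ 2 + 337 / 100 * n + 26 / 5) \<le> (2 :: real) ^ (n + 1)"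
proof (induction n rule: nat_induct_at_least)
  case base
  show ?case
    by (simp add: power_divide)
next
  case (Suc n)
  have double_add: "a + c \<le> 2 * (b + d)" if "a \<le> 2 * b" "c \<le> 2 * d" for a b c d :: real
    using that by simp
  have "4 * (3 / 2) ^ Suc n \<le> 2 * (4 * (3 / 2 :: real) ^ n)"
    by simp
  moreover have "2 / 5 * real (Suc n) ^ 2 + 337 / 100 * Suc n + 26 / 5 \<le> 2 * (2 / 5 * real n ^ 2 + 337 / 100 * n + 26 / 5)"
  proof -
    define N where "N = real n"
    have N: "5 \<le> N" "real (Suc n) = N + 1"
      using Suc.hyps by (auto simp: N_def)
    have "(N + 1) ^ 2 \<le> 2 * N ^ 2"
    proof -
      have "5 * N \<le> N * N"
        using N(1) by (intro mult_right_mono) auto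
      moreover have "(N + 1) ^ 2 = N * N + 2 * N + 1"
        by (simp add: power2_eq_square algebra_simps)
      ultimately show ?thesis
        using N(1) unfolding power2_eq_square[of N] by linarith
    qed
    then show ?thesis
    proof -
      have "2 / 5 * X + 337 / 100 * (N + 1) + 26 / 5 \<le> 2 * (2 / 5 * Y + 337 / 100 * N + 26 / 5)"
        if "X \<le> 2 * Y" for X Y :: real
        using that N(1) by (simp add: field_simps)
      from this[OF \<open>(N + 1) ^ 2 \<le> 2 * N ^ 2\<close>] show ?thesis
        by (simp only: N(2) N_def[symmetric])
    qed
  qed
  ultimately have "4 * (3 / 2) ^ Suc n + (2 / 5 * real (Suc n) ^ 2 + 337 / 100 * Suc n + 26 / 5) \<le>
      2 * (4 * (3 / 2) ^ n + (2 / 5 * real n ^ 2 + 337 / 100 * n + 26 / 5))"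
    by (rule double_add)
  also have "\<dots> \<le> 2 * 2 ^ (n + 1)"
    using Suc.IH by (rule mult_left_mono) simp
  finally show ?case
    by simp
qed

lemma weak_type_constant:
  assumes n: "5 \<le> n" and A: "1 \<le> A"
  shows "2 * (2 * (3 / 2) ^ n * A + ln (circum_ratio n * (4 * sqrt n) ^ n * A)) + n * ln 2 \<le> 2 ^ (n + 1) * A - 1"
proof -
  have l: "ln 2 \<le> (25 / 36 :: real)"
    by (rule ln2_le_25_over_36)
  have \<omega>: "0 < unit_ball_vol (real n)" "unit_ball_vol (real n) \<le> 8"
    using unit_ball_vol_le_8[OF n] by auto
  have "circum_ratio n * (4 * sqrt n) ^ n = unit_ball_vol (real n) * (sqrt n / 2 * (4 * sqrt n)) ^ n"
    unfolding circum_ratio_def by (simp only: power_mult_distrib[symmetric] mult.assoc)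
  also have "sqrt n / 2 * (4 * sqrt n) = 2 * real n"
    by simp
  finally have "ln (circum_ratio n * (4 * sqrt n) ^ n * A) = ln (unit_ball_vol (real n)) + n * ln (2 * real n) + ln A"
    using \<omega> n A by (simp add: ln_mult_pos ln_realpow distrib_left)
  moreover have "ln (unit_ball_vol (real n)) \<le> 25 / 12"
  proof -
    have "ln (unit_ball_vol (real n)) \<le> ln (2 ^ 3)"
      using \<omega> by simp
    also have "\<dots> = 3 * ln 2"
      by (subst ln_realpow) auto
    finally show ?thesis
      using l by simp
  qed
  moreover have "ln (2 * real n) \<le> 6667 / 5000 + n / 5"
  proof -
    \<comment> \<open>Factored around n = 5, where there is least room:
      \<open>ln y \<le> y - 1\<close> is nearly exact for the factors 5 / 4 and n / 5.\<close>
    have "ln (2 * real n) = ln (2 ^ 3 * ((5 / 4) * (n / 5)))"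
      by simp
    also have "\<dots> = 3 * ln 2 + ln (5 / 4) + ln (n / 5)"
      using n by (subst ln_mult_pos, simp, simp, subst ln_mult_pos, simp, simp, subst ln_realpow) auto
    also have "\<dots> \<le> 3 * (25 / 36) + (5 / 4 - 1) + (n / 5 - 1)"
      using n l by (intro add_mono ln_le_minus_one mult_left_mono) auto
    finally show ?thesis
      by simp
  qed
  then have "real n * ln (2 * real n) \<le> real n * (6667 / 5000 + n / 5)"
    by (rule mult_left_mono) simp
  moreover have "ln A \<le> A - 1"
    using A by (intro ln_le_minus_one) simp
  moreover have "real n * ln 2 \<le> real n * (25 / 36)"
    using l by (intro mult_left_mono) auto
  \<comment> \<open>Reduction to A = 1: since \<open>ln A \<le> A - 1\<close>, the left side of the
    claim grows in \<open>A\<close> with slope at most 4 * (3 / 2)^n + 2.\<close>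
  moreover have "(4 * (3 / 2) ^ n + 2) * (A - 1) \<le> 2 ^ (n + 1) * (A - 1)"
  proof (rule mult_right_mono)
    show "4 * (3 / 2) ^ n + 2 \<le> (2 :: real) ^ (n + 1)"
      using weak_type_growth[OF n] zero_le_power2[of "real n"] n by linarith
  qed (use A in simp)
  moreover note weak_type_growth[OF n]
  ultimately show ?thesis
    by (simp add: algebra_simps power2_eq_square)
qed

section \<open>Logarithmic energy and the maximal function\<close>

text \<open>The corner \<open>c\<close> lies on the circumscribed sphere, so an open ball needs a
  strictly larger radius; the excess tends to 0 wherever the exact volume ratio matters.\<close>

lemma hc_subset_ball:
  fixes c :: "real ^ 'n"
  assumes "sqrt CARD('n) * s / 2 < \<rho>"
  shows "hc c s \<subseteq> ball (c + vec (s / 2)) \<rho>"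
proof
  fix x assume x: "x \<in> hc c s"
  have "norm (c + vec (s / 2) - x) \<le> norm (vec (s / 2) :: real ^ 'n)"
  proof (rule norm_le_componentwise_cart)
    fix i show "norm ((c + vec (s / 2) - x) $ i) \<le> norm ((vec (s / 2) :: real ^ 'n) $ i)"
    proof -
      have "c $ i \<le> x $ i" "x $ i < c $ i + s"
        using x by (auto simp: hc_def)
      then have "\<bar>c $ i + s / 2 - x $ i\<bar> \<le> \<bar>s / 2\<bar>"
        using abs_ge_self[of "s / 2"] by (intro abs_leI) linarith+
      then show ?thesis
        by simp
    qed
  qed
  moreover have "0 \<le> s"
    using x[unfolded hc_def, simplified, rule_format, of undefined] by linarith
  ultimately show "x \<in> ball (c + vec (s / 2)) \<rho>"
    using assms by (simp add: dist_norm norm_vec_def L2_set_def real_sqrt_mult)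
qed

lemma circum_ratio_ge_1: "1 \<le> circum_ratio CARD('n :: finite)"
proof -
  define \<omega> where "\<omega> = unit_ball_vol (real CARD('n))"
  define R where "R = sqrt (real CARD('n)) / 2"
  have *: "1 \<le> \<omega> * (R + \<eta>) ^ CARD('n)" if "0 < \<eta>" for \<eta>
  proof -
    have R: "0 \<le> R + \<eta>"
      using that by (simp add: R_def)
    have "hc (0 :: real ^ 'n) 1 \<subseteq> ball (0 + vec (1 / 2)) (R + \<eta>)"
      using that by (intro hc_subset_ball) (simp add: R_def)
    then have "vol (hc (0 :: real ^ 'n) 1) \<le> vol (ball (0 + vec (1 / 2) :: real ^ 'n) (R + \<eta>))"
      by (intro emeasure_mono) auto
    then have "ennreal 1 \<le> ennreal (\<omega> * (R + \<eta>) ^ CARD('n))"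
      using R by (simp add: emeasure_hc emeasure_ball \<omega>_def)
    then show ?thesis
      using R by (subst (asm) ennreal_le_iff) (auto simp: \<omega>_def)
  qed
  have lim: "(\<lambda>k. \<omega> * (R + 1 / real (Suc k)) ^ CARD('n)) \<longlonglongrightarrow> \<omega> * (R + 0) ^ CARD('n)"
    by (intro tendsto_intros LIMSEQ_Suc lim_1_over_n)
  have "1 \<le> \<omega> * (R + 0) ^ CARD('n)"
    by (rule LIMSEQ_le_const[OF lim]) (intro exI[of _ 0] allI impI *, simp)
  then show ?thesis
    by (simp add: circum_ratio_def \<omega>_def R_def)
qed

section \<open>The maximal function of a weight restricted to a cube\<close>

context weight_density begin

definition HL :: "real ^ 'n \<Rightarrow> real \<Rightarrow> real ^ 'n \<Rightarrow> ennreal" where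
  "HL c s = HL_maximal (\<lambda>y. w y * indicator (hc c s) y)"

abbreviation ball_mass :: "real ^ 'n \<Rightarrow> real \<Rightarrow> real ^ 'n \<Rightarrow> real \<Rightarrow> ennreal" where
  "ball_mass c s z \<rho> \<equiv> (wvol (ball z \<rho> \<inter> hc c s))"

lemma emeasure_ball_pos: "0 < \<rho> \<Longrightarrow> 0 < vol (ball (z :: real ^ 'n) \<rho>)"
  by (simp add: emeasure_ball)

lemma nnavg_ball:
  "nnavg (ball z \<rho>) (\<lambda>y. ennreal \<bar>w y * indicator (hc c s) y\<bar>) = ball_mass c s z \<rho> / vol (ball z \<rho>)"
proof -
  have "(\<integral>\<^sup>+x\<in>ball z \<rho>. ennreal \<bar>w x * indicator (hc c s) x\<bar> \<partial>lborel) = ball_mass c s z \<rho>"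
    using w_nonneg by (intro nn_integral_cong) (auto simp: indicator_def)
  then show ?thesis
    by (simp add: nnavg_def nn_integral_completion)
qed

lemma ball_mass_le_HL:
  assumes "0 < \<rho>" "x \<in> ball z \<rho>"
  shows "ball_mass c s z \<rho> \<le> HL c s x * vol (ball z \<rho>)"
proof -
  have "nnavg (ball z \<rho>) (\<lambda>y. ennreal \<bar>w y * indicator (hc c s) y\<bar>) \<le> HL c s x"
    unfolding HL_def HL_maximal_def using assms by (intro SUP_upper) auto
  then have "ball_mass c s z \<rho> / vol (ball z \<rho>) * vol (ball z \<rho>) \<le> HL c s x * vol (ball z \<rho>)"
    unfolding nnavg_ball by (rule mult_right_mono) simp
  moreover have "ball_mass c s z \<rho> / vol (ball z \<rho>) * vol (ball z \<rho>) = ball_mass c s z \<rho>"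
    using emeasure_ball_pos[OF assms(1), of z] emeasure_lborel_ball_finite[of z \<rho>]
    by (simp add: ennreal_divide_times ennreal_times_divide mult_divide_eq_ennreal)
  ultimately show ?thesis
    by simp
qed

text \<open>The maximal function is uncentered, so its superlevel sets are unions of balls. This
  gives measurability, and relative openness of the sets in the weak type inequality.\<close>

lemma open_HL_greater: "open {x. u < HL c s x}"
proof -
  have "{x. u < HL c s x} = \<Union>{B. (\<exists>z \<rho>. 0 < \<rho> \<and> B = ball z \<rho>) \<and> u < nnavg B (\<lambda>y. ennreal \<bar>w y * indicator (hc c s) y\<bar>)}"
    unfolding HL_def HL_maximal_def less_SUP_iff by blast
  also have "open \<dots>"
    by (intro open_Union) auto
  finally show ?thesis .
qed

lemma HL_borel [measurable]: "HL c s \<in> borel_measurable borel"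
  by (rule borel_measurableI_greater) (use open_HL_greater in auto)

text \<open>This forces the Fujii-Wilson constant to be at least 1. The maximal function dominates
  the averages over balls of a fixed small radius; by Fubini their integral over the cube retains
  all mass away from the faces, and the radius tends to 0.\<close>

lemma mass_le_integral_HL:
  assumes s: "0 < s"
  shows "ennreal (mass c s) \<le> (\<integral>\<^sup>+x\<in>hc c s. HL c s x \<partial>lborel)"
proof -
  define \<rho> where "\<rho> k = 1 / real (Suc k)" for k
  have \<rho>: "0 < \<rho> k" for k
    by (simp add: \<rho>_def)
  define v where "v k = vol (ball (0 :: real ^ 'n) (\<rho> k))" for k
  have v: "vol (ball z (\<rho> k)) = v k" for k and z :: "real ^ 'n"
    using \<rho>[of k] by (simp add: v_def emeasure_ball)
  have v0: "v k \<noteq> 0" "v k \<noteq> \<infinity>" for k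
    using emeasure_ball_pos[OF \<rho>, of "0 :: real ^ 'n" k] emeasure_lborel_ball_finite[of "0 :: real ^ 'n" "\<rho> k"]
    by (auto simp: v_def)
  \<comment> \<open>Points whose ball of radius \<open>\<rho> k\<close> stays in the cube, so that
    none of their mass is lost in the averaging.\<close>
  define B where "B k = {y. \<forall>i. \<rho> k < min (y $ i - c $ i) (c $ i + s - y $ i)}" for k
  have [measurable]: "B k \<in> sets borel" for k
  proof -
    have "B k = (\<Inter>i. {y. \<rho> k < min (y $ i - c $ i) (c $ i + s - y $ i)})"
      by (auto simp: B_def)
    also have "\<dots> \<in> sets borel"
      by (intro sets.countable_INT') auto
    finally show ?thesis .
  qed
  have v1: "1 / v k * v k = 1" for k
    using v0[of k] by (simp add: ennreal_divide_times ennreal_divide_self less_top[symmetric])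
  have le: "wvol (B k) \<le> (\<integral>\<^sup>+x\<in>hc c s. HL c s x \<partial>lborel)" for k
  proof -
    define \<phi> where "\<phi> x y = indicator (hc c s) x * (ennreal (w y) * indicator (hc c s) y * (if dist x y < \<rho> k then 1 / v k else 0))" for x y
    have \<phi>_borel: "(\<lambda>(x, y). \<phi> x y) \<in> borel_measurable (lborel \<Otimes>\<^sub>M lborel)"
      unfolding \<phi>_def by measurable
    have "wvol (B k)
        \<le> (\<integral>\<^sup>+y. (\<integral>\<^sup>+x. \<phi> x y \<partial>lborel) \<partial>lborel)"
    proof (rule nn_integral_mono)
      fix y
      show "ennreal (w y) * indicator (B k) y \<le> (\<integral>\<^sup>+x. \<phi> x y \<partial>lborel)"
      proof (cases "y \<in> B k")
        case True
        have sub: "x \<in> hc c s" if "dist x y < \<rho> k" for x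
          unfolding hc_def mem_Collect_eq
        proof
          fix i
          have "\<bar>(x - y) $ i\<bar> < \<rho> k"
            using that component_le_norm_cart[of "x - y" i] by (simp add: dist_norm)
          then show "c $ i \<le> x $ i \<and> x $ i < c $ i + s"
            using True by (simp add: B_def abs_less_iff) (smt (verit))
        qed
        then have "y \<in> hc c s"
          using \<rho>[of k] by simp
        then have "(\<integral>\<^sup>+x. \<phi> x y \<partial>lborel) = (\<integral>\<^sup>+x. (ennreal (w y) * (1 / v k)) * indicator (ball y (\<rho> k)) x \<partial>lborel)"
          using sub by (intro nn_integral_cong) (auto simp: \<phi>_def indicator_def dist_commute)
        also have "\<dots> = ennreal (w y) * (1 / v k * v k)"
          by (subst nn_integral_cmult_indicator) (simp_all add: v mult.assoc)
        also have "1 / v k * v k = 1"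
          by (rule v1)
        finally show ?thesis
          using True by simp
      qed auto
    qed
    also have "\<dots> = (\<integral>\<^sup>+x. (\<integral>\<^sup>+y. \<phi> x y \<partial>lborel) \<partial>lborel)"
      using lborel_pair.Fubini'[OF \<phi>_borel] by simp
    also have "\<dots> \<le> (\<integral>\<^sup>+x\<in>hc c s. HL c s x \<partial>lborel)"
    proof (rule nn_integral_mono)
      fix x
      have [measurable]: "ball x (\<rho> k) \<inter> hc c s \<in> sets borel"
        by simp
      have "(\<integral>\<^sup>+y. \<phi> x y \<partial>lborel) = (\<integral>\<^sup>+y. (indicator (hc c s) x * (1 / v k)) * (ennreal (w y) * indicator (ball x (\<rho> k) \<inter> hc c s) y) \<partial>lborel)"
        by (intro nn_integral_cong) (auto simp: \<phi>_def indicator_def mult.commute)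
      also have "\<dots> = (indicator (hc c s) x * (1 / v k)) * ball_mass c s x (\<rho> k)"
        by (rule nn_integral_cmult) measurable
      also have "\<dots> \<le> (indicator (hc c s) x * (1 / v k)) * (HL c s x * v k)"
        using ball_mass_le_HL[OF \<rho>[of k], of x x c s] \<rho>[of k] by (intro mult_left_mono) (auto simp: v)
      also have "\<dots> = (HL c s x * indicator (hc c s) x) * (1 / v k * v k)"
        by (simp only: mult_ac)
      also have "1 / v k * v k = 1"
        by (rule v1)
      finally show "(\<integral>\<^sup>+y. \<phi> x y \<partial>lborel) \<le> HL c s x * indicator (hc c s) x"
        by simp
    qed
    finally show ?thesis .
  qed
  have "ennreal (mass c s) = (\<integral>\<^sup>+y. ennreal (w y) * indicator (box c (c + vec s)) y \<partial>lborel)"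
  proof -
    have "vol (hc c s - box c (c + vec s)) = 0"
      using s box_subset_hc[of c s] by (subst emeasure_Diff) (auto simp: emeasure_hc emeasure_cube_cart)
    then have "AE y in lborel. y \<notin> hc c s - box c (c + vec s)"
      by (intro AE_not_in) (auto simp: null_sets_def)
    then have "wvol (hc c s) = (\<integral>\<^sup>+y. ennreal (w y) * indicator (box c (c + vec s)) y \<partial>lborel)"
      using box_subset_hc[of c s] by (intro nn_integral_cong_AE) (auto simp: indicator_def)
    then show ?thesis
      by (simp add: nn_integral_w_hc)
  qed
  also have "\<dots> \<le> (\<integral>\<^sup>+y. liminf (\<lambda>k. ennreal (w y) * indicator (B k) y) \<partial>lborel)"
  proof (rule nn_integral_mono)
    fix y
    show "ennreal (w y) * indicator (box c (c + vec s)) y \<le> liminf (\<lambda>k. ennreal (w y) * indicator (B k) y)"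
    proof (cases "y \<in> box c (c + vec s)")
      case True
      have "\<rho> \<longlonglongrightarrow> 0"
        unfolding \<rho>_def by (intro LIMSEQ_Suc lim_1_over_n)
      then have "eventually (\<lambda>k. \<rho> k < min (y $ i - c $ i) (c $ i + s - y $ i)) sequentially" for i
        using True by (intro order_tendstoD(2)) (auto simp: mem_box_cart)
      then have "eventually (\<lambda>k. \<forall>i. \<rho> k < min (y $ i - c $ i) (c $ i + s - y $ i)) sequentially"
        by (rule eventually_all_finite)
      then have "eventually (\<lambda>k. ennreal (w y) * indicator (box c (c + vec s)) y \<le> ennreal (w y) * indicator (B k) y) sequentially"
        by (rule eventually_mono) (auto simp: B_def indicator_def)
      then show ?thesis
        by (rule Liminf_bounded)
    qed auto
  qed
  also have "\<dots> \<le> liminf (\<lambda>k. \<integral>\<^sup>+y\<in>B k. ennreal (w y) \<partial>lborel)"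
    by (rule nn_integral_liminf) measurable
  also have "\<dots> \<le> liminf (\<lambda>k :: nat. \<integral>\<^sup>+x\<in>hc c s. HL c s x \<partial>lborel)"
    by (intro Liminf_mono always_eventually allI le)
  finally show ?thesis
    by (simp add: Liminf_const)
qed

lemma av_le_HL:
  assumes s: "0 < s'" and sub: "hc c' s' \<subseteq> hc c s" and x: "x \<in> hc c' s'" and h: "HL c s x = ennreal h" "0 \<le> h"
  shows "av w c' s' \<le> circum_ratio CARD('n) * h"
proof -
  define \<omega> where "\<omega> = unit_ball_vol (real CARD('n))"
  define R where "R = sqrt CARD('n) * s' / 2"
  have \<omega>: "0 < \<omega>"
    by (simp add: \<omega>_def)
  have R: "0 \<le> R"
    using s by (simp add: R_def)
  have *: "mass c' s' \<le> h * (\<omega> * (R + \<eta>) ^ CARD('n))" if "0 < \<eta>" for \<eta>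
  proof -
    define z where "z = c' + vec (s' / 2)"
    have sb: "hc c' s' \<subseteq> ball z (R + \<eta>)"
      unfolding z_def using that by (intro hc_subset_ball) (simp add: R_def)
    have "ennreal (mass c' s') \<le> ball_mass c s z (R + \<eta>)"
      unfolding nn_integral_w_hc[symmetric] using sb sub
      by (intro nn_integral_mono) (auto simp: indicator_def)
    also have "\<dots> \<le> HL c s x * vol (ball z (R + \<eta>))"
      using that R sb x by (intro ball_mass_le_HL) auto
    also have "\<dots> = ennreal (h * (\<omega> * (R + \<eta>) ^ CARD('n)))"
      using h R that \<omega> by (simp add: emeasure_ball \<omega>_def ennreal_mult)
    finally show ?thesis
      using h R that \<omega> by (simp add: mass_nonneg)
  qed
  have lim: "(\<lambda>k. h * (\<omega> * (R + 1 / real (Suc k)) ^ CARD('n))) \<longlonglongrightarrow> h * (\<omega> * (R + 0) ^ CARD('n))"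
    by (intro tendsto_intros LIMSEQ_Suc lim_1_over_n)
  have "mass c' s' \<le> h * (\<omega> * (R + 0) ^ CARD('n))"
    by (rule LIMSEQ_le_const[OF lim]) (intro exI[of _ 0] allI impI *, simp)
  also have "\<dots> = (circum_ratio CARD('n) * h) * s' ^ CARD('n)"
    by (simp add: circum_ratio_def \<omega>_def R_def power_mult_distrib power_divide)
  finally show ?thesis
    using s by (simp add: av_mass divide_le_eq)
qed

lemma Mx_le_HL:
  assumes s: "0 < s" and x: "x \<in> hc c s"
  shows "ennreal (Mx w N c s (av w c s) x) \<le> ennreal (circum_ratio CARD('n)) * HL c s x"
proof (cases "HL c s x")
  case (real h)
  have "Mx w N c s (av w c s) x \<le> circum_ratio CARD('n) * h"
    using s x real by (intro Mx_le av_le_HL) auto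
  then show ?thesis
    using real circum_ratio_pos[of "CARD('n)"]
    by (simp add: ennreal_mult[symmetric] ennreal_leI less_imp_le)
next
  case top
  have "0 < circum_ratio CARD('n)"
    by (simp add: circum_ratio_pos)
  then show ?thesis
    by (simp add: top ennreal_mult_top)
qed

text \<open>The Fujii-Wilson quotient cleared of its denominator, so that cubes without mass need no
  exception.\<close>

definition HL_bound :: "real \<Rightarrow> real ^ 'n \<Rightarrow> real \<Rightarrow> bool" where
  "HL_bound A c s \<longleftrightarrow> (\<forall>c' s'. 0 < s' \<longrightarrow> hc c' s' \<subseteq> hc c s \<longrightarrow>
    (\<integral>\<^sup>+x\<in>hc c' s'. HL c' s' x \<partial>lborel) \<le> ennreal (A * mass c' s'))"

lemma HL_bound_ge_1:
  assumes "HL_bound A c s" "0 < s" "0 < mass c s"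
  shows "1 \<le> A"
proof -
  have "ennreal (mass c s) \<le> ennreal (A * mass c s)"
    using mass_le_integral_HL[OF assms(2), of c] assms(1,2) unfolding HL_bound_def by (meson order_refl order_trans)
  then have "mass c s \<le> A * mass c s"
    using assms(3) by (cases "0 \<le> A * mass c s") (auto simp: ennreal_neg)
  then show ?thesis
    using assms(3) by simp
qed

text \<open>The running maximum starts at the average, whose integral over the cube is the mass;
  removing it from the bound C * A for the whole maximum leaves C * A - 1.\<close>

lemma log_energy_bound_dyadic:
  assumes HLb: "HL_bound A c s" and "0 \<le> g"
    and g: "\<And>t. 1 \<le> t \<Longrightarrow> t \<le> 2 ^ CARD('n) \<Longrightarrow> t * ln t \<le> g * (t - 1)"
  shows "log_energy_bound (g * (circum_ratio CARD('n) * A - 1)) c s"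
  unfolding log_energy_bound_def
proof (intro allI impI)
  fix c' s' N
  assume s': "0 < s'" and sub: "hc c' s' \<subseteq> hc c s" and pos: "0 < av w c' s'"
  define C where "C = circum_ratio CARD('n)"
  have C: "0 < C"
    by (simp add: C_def circum_ratio_pos)
  define a where "a = av w c' s'"
  define m where "m = mass c' s'"
  have m: "m = a * s' ^ CARD('n)"
    using s' by (simp add: m_def a_def mass_av)
  have m0: "0 \<le> m"
    by (simp add: m_def mass_nonneg)
  define J where "J = (\<integral>\<^sup>+x\<in>hc c' s'. ennreal (Mx w N c' s' a x - a) \<partial>lborel)"
  have "J + ennreal m = (\<integral>\<^sup>+x. ennreal (Mx w N c' s' a x - a) * indicator (hc c' s') x + ennreal a * indicator (hc c' s') x \<partial>lborel)"
    using s' pos by (simp add: J_def nn_integral_add nn_integral_cmult_indicator emeasure_hc m ennreal_mult a_def)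
  also have "\<dots> = (\<integral>\<^sup>+x\<in>hc c' s'. ennreal (Mx w N c' s' a x) \<partial>lborel)"
    using pos Mx_ge[of a w N c' s'] by (intro nn_integral_cong)
      (auto simp: indicator_def a_def ennreal_plus[symmetric] simp del: ennreal_plus)
  also have "\<dots> \<le> (\<integral>\<^sup>+x. ennreal C * (HL c' s' x * indicator (hc c' s') x) \<partial>lborel)"
    using Mx_le_HL[OF s', of _ c' N] by (intro nn_integral_mono) (auto simp: indicator_def a_def C_def)
  also have "\<dots> = ennreal C * (\<integral>\<^sup>+x\<in>hc c' s'. HL c' s' x \<partial>lborel)"
    by (rule nn_integral_cmult) measurable
  also have "\<dots> \<le> ennreal C * ennreal (A * m)"
    using HLb s' sub unfolding HL_bound_def m_def by (intro mult_left_mono) auto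
  also have "\<dots> = ennreal (C * A * m)"
    using C by (simp add: ennreal_mult'[symmetric] mult.assoc)
  finally have J: "J + ennreal m \<le> ennreal (C * A * m)" .
  have "J \<le> ennreal ((C * A - 1) * m)"
  proof (cases J)
    case (real j)
    then have jm: "ennreal (j + m) \<le> ennreal (C * A * m)"
      using J m0 by simp
    have "0 < m"
      using pos s' by (simp add: m a_def)
    then have "j + m \<le> C * A * m"
      using jm real by (cases "0 \<le> C * A * m") (auto simp: ennreal_neg simp del: ennreal_plus)
    then show ?thesis
      using real by (auto intro!: ennreal_leI simp: algebra_simps)
  next
    case top
    then show ?thesis
      using J by (simp add: top_unique)
  qed
  then have "ennreal g * J \<le> ennreal g * ennreal ((C * A - 1) * m)"
    by (rule mult_left_mono) simp
  moreover have "(wint (hc c' s') (\<lambda>x. ln (Mx w N c' s' a x / a))) \<le> ennreal g * J"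
    unfolding J_def using pos by (intro log_maximum_le_maximum g \<open>0 \<le> g\<close> s') (auto simp: a_def)
  ultimately show "(wint (hc c' s') (\<lambda>x. ln (Mx w N c' s' (av w c' s') x / av w c' s')))
      \<le> ennreal (g * (circum_ratio CARD('n) * A - 1) * mass c' s')"
    using \<open>0 \<le> g\<close> unfolding a_def m_def C_def
    by (simp add: ennreal_mult'[symmetric] mult.assoc)
qed

text \<open>The threshold for \<open>u\<close> is Chebyshev's inequality: the superlevel set has
  volume at most \<open>A * mass c s / u\<close>, which then lies below the volume of a cube of edge
  s / (4 * sqrt n), as \<open>reverse_weak_type\<close> requires.\<close>

lemma mass_superlevel_le:
  assumes HLb: "HL_bound A c s" and s: "0 < s" and u: "A * av w c s * (4 * sqrt CARD('n)) ^ CARD('n) < u" "0 < u"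
  shows "(\<integral>\<^sup>+x\<in>hc c s \<inter> {x. ennreal u < HL c s x}. ennreal (w x) \<partial>lborel)
    \<le> ennreal (2 * (3 / 2) ^ CARD('n) * u) * vol (hc c s \<inter> {x. ennreal u < HL c s x})"
proof (rule reverse_weak_type[where a = c and l = s])
  define E where "E = hc c s \<inter> {x. ennreal u < HL c s x}"
  have op: "open {x. ennreal u < HL c s x}"
    by (rule open_HL_greater)
  then have [measurable]: "{x. ennreal u < HL c s x} \<in> sets borel"
    by simp
  show "(\<lambda>x. ennreal (w x)) \<in> borel_measurable borel"
    by measurable
  show "hc c s \<inter> {x. ennreal u < HL c s x} \<in> sets borel"
    by measurable
  show "0 < s" "0 \<le> u" "hc c s \<inter> {x. ennreal u < HL c s x} \<subseteq> hc c s"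
    using s u by auto
  show "ball_mass c s z \<rho> \<le> ennreal u * vol (ball z \<rho>)"
    if "0 < \<rho>" "q \<in> ball z \<rho>" "q \<in> hc c s - (hc c s \<inter> {x. ennreal u < HL c s x})" for z \<rho> q
  proof -
    have "HL c s q \<le> ennreal u"
      using that(3) by auto
    then show ?thesis
      using ball_mass_le_HL[OF that(1,2)] by (meson mult_right_mono order_trans zero_le)
  qed
  show "\<exists>e>0. ball y e \<inter> hc c s \<subseteq> hc c s \<inter> {x. ennreal u < HL c s x}"
    if "y \<in> hc c s \<inter> {x. ennreal u < HL c s x}" for y
    using op that by (metis (no_types, lifting) Int_commute Int_iff Int_mono open_contains_ball order_refl)
  have "ennreal u * vol E = (\<integral>\<^sup>+x. ennreal u * indicator E x \<partial>lborel)"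
    by (simp add: nn_integral_cmult_indicator E_def)
  also have "\<dots> \<le> (\<integral>\<^sup>+x\<in>hc c s. HL c s x \<partial>lborel)"
    by (intro nn_integral_mono) (auto simp: E_def indicator_def less_imp_le)
  also have "\<dots> \<le> ennreal (A * mass c s)"
    using HLb s unfolding HL_bound_def by blast
  finally have le: "ennreal u * vol E \<le> ennreal (A * mass c s)" .
  show "vol (hc c s \<inter> {x. ennreal u < HL c s x}) < ennreal ((s / (4 * sqrt CARD('n))) ^ CARD('n))"
  proof -
    define \<kappa> where "\<kappa> = (4 * sqrt (real CARD('n))) ^ CARD('n)"
    have \<kappa>: "0 < \<kappa>"
      by (simp add: \<kappa>_def)
    have fin: "vol E \<noteq> \<infinity>"
      using emeasure_mono[of E "hc c s" lborel] s by (auto simp: E_def emeasure_hc top_unique)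
    then obtain e where e: "vol E = ennreal e" "0 \<le> e"
      by (cases "vol E") auto
    have "u * e < u * (s ^ CARD('n) / \<kappa>)"
    proof (cases "e = 0")
      case True
      then show ?thesis
        using u(2) s \<kappa> by simp
    next
      case False
      have "u * e \<le> A * mass c s"
        using le e u False by (cases "0 \<le> A * mass c s") (auto simp: ennreal_mult[symmetric] ennreal_neg)
      also have "\<dots> = A * av w c s * s ^ CARD('n)"
        using s by (simp add: mass_av)
      also have "\<dots> < (u / \<kappa>) * s ^ CARD('n)"
        using u(1) \<kappa> s by (intro mult_strict_right_mono) (auto simp: \<kappa>_def less_divide_eq)
      finally show ?thesis
        by simp
    qed
    then have "e < s ^ CARD('n) / \<kappa>"
      using u(2) by (simp only: mult_less_cancel_left_pos)
    then show ?thesis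
      using e by (simp add: E_def[symmetric] ennreal_less_iff \<kappa>_def power_divide)
  qed
qed

end

section \<open>Logarithmic energy by integration over levels\<close>

context weight_density begin
lemma nn_integral_inverse_eq_ln:
  assumes "0 < a" "a \<le> b"
  shows "(\<integral>\<^sup>+u. (if a < u \<and> u < b then ennreal (1 / u) else 0) \<partial>lborel) = ennreal (ln (b / a))"
proof -
  have "(\<integral>\<^sup>+u. (if a < u \<and> u < b then ennreal (1 / u) else 0) \<partial>lborel) = (\<integral>\<^sup>+u. ennreal (1 / u) * indicator {a..b} u \<partial>lborel)"
  proof (rule nn_integral_cong_AE)
    have "AE u in lborel. u \<noteq> a" "AE u in lborel. u \<noteq> b"
      by (rule AE_lborel_singleton)+
    then show "AE u in lborel. (if a < u \<and> u < b then ennreal (1 / u) else 0) = ennreal (1 / u) * indicator {a..b} u"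
      by eventually_elim (auto simp: indicator_def)
  qed
  also have "\<dots> = ennreal (ln b - ln a)"
  proof (rule nn_integral_FTC_Icc)
    show "(ln has_real_derivative 1 / u) (at u)" if "u \<in> {a..b}" for u
      using that assms by (intro DERIV_ln_divide) simp
    show "0 \<le> 1 / u" if "u \<in> {a..b}" for u
      using that assms by simp
  qed (use assms in auto)
  finally show ?thesis
    using assms by (simp add: ln_div)
qed

text \<open>Above the level \<open>u0\<close> the logarithm is the integral of du / u. The reverse
  weak type inequality trades the mass of a superlevel set for u times its volume, the factor u
  cancels, and what remains is the integral of the maximal function. Up to \<open>u0\<close> the
  logarithm costs at most a constant per unit of mass.\<close>

lemma log_energy_bound_weak_type:
  assumes HLb: "HL_bound A c s" and A: "1 \<le> A"
    and big: "1 \<le> circum_ratio CARD('n) * (4 * sqrt CARD('n)) ^ CARD('n)"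
  shows "log_energy_bound (2 * (3 / 2) ^ CARD('n) * A + ln (circum_ratio CARD('n) * (4 * sqrt CARD('n)) ^ CARD('n) * A)) c s"
  unfolding log_energy_bound_def
proof (intro allI impI)
  fix c' s' N
  assume s': "0 < s'" and sub: "hc c' s' \<subseteq> hc c s" and pos: "0 < av w c' s'"
  define C where "C = circum_ratio CARD('n)"
  define \<kappa> where "\<kappa> = (4 * sqrt (real CARD('n))) ^ CARD('n)"
  define a where "a = av w c' s'"
  define m where "m = mass c' s'"
  define H where "H = hc c' s'"
  define u0 where "u0 = A * a * \<kappa>"
  define k where "k = 2 * (3 / 2 :: real) ^ CARD('n)"
  define \<Lambda> where "\<Lambda> = HL c' s'"
  have C: "0 < C"
    by (simp add: C_def circum_ratio_pos)
  have \<kappa>: "0 < \<kappa>"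
    by (simp add: \<kappa>_def)
  have u0: "0 < u0"
    using A pos \<kappa> by (simp add: u0_def a_def)
  have k: "0 \<le> k"
    by (simp add: k_def)
  have m: "0 \<le> m"
    by (simp add: m_def mass_nonneg)
  have [measurable]: "H \<in> sets borel" "\<Lambda> \<in> borel_measurable borel"
    by (simp_all add: H_def \<Lambda>_def)
  have HLb': "HL_bound A c' s'"
    using HLb sub unfolding HL_bound_def by (meson order_trans)
  \<comment> \<open>Dividing by the volume ratio puts the running maximum below the maximal function
    over balls; the division is repaid as the summand ln C.\<close>
  define f where "f x = Mx w N c' s' a x / C" for x
  have [measurable]: "f \<in> borel_measurable borel"
    unfolding f_def by measurable
  have f_le: "ennreal (f x) \<le> \<Lambda> x" if "x \<in> H" for x
  proof -
    have "ennreal (f x) = ennreal (1 / C) * ennreal (Mx w N c' s' a x)"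
      using C by (simp add: f_def ennreal_mult'[symmetric])
    also have "\<dots> \<le> ennreal (1 / C) * (ennreal C * \<Lambda> x)"
      using Mx_le_HL[OF s', of x c' N] that by (intro mult_left_mono) (auto simp: a_def C_def \<Lambda>_def H_def)
    also have "\<dots> = (ennreal (1 / C) * ennreal C) * \<Lambda> x"
      by (simp only: mult.assoc)
    also have "ennreal (1 / C) * ennreal C = 1"
      using C by (subst ennreal_mult[symmetric]) auto
    finally show ?thesis
      by simp
  qed
  define \<phi> where "\<phi> x u = (ennreal (w x) * indicator H x) * (if u0 < u \<and> u < f x then ennreal (1 / u) else 0)" for x u
  define \<psi> where "\<psi> x u = indicator H x * (if u0 < u \<and> ennreal u < \<Lambda> x then 1 else 0 :: ennreal)" for x u
  have \<phi>_borel: "(\<lambda>(x, u). \<phi> x u) \<in> borel_measurable (lborel \<Otimes>\<^sub>M lborel)"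
    unfolding \<phi>_def by measurable
  have \<psi>_borel: "(\<lambda>(x, u). \<psi> x u) \<in> borel_measurable (lborel \<Otimes>\<^sub>M lborel)"
    unfolding \<psi>_def by measurable
  have "(wint H (\<lambda>x. max 0 (ln (f x / u0)))) \<le> (\<integral>\<^sup>+x. (\<integral>\<^sup>+u. \<phi> x u \<partial>lborel) \<partial>lborel)"
  proof (rule nn_integral_mono)
    fix x
    show "ennreal (w x * max 0 (ln (f x / u0))) * indicator H x \<le> (\<integral>\<^sup>+u. \<phi> x u \<partial>lborel)"
    proof (cases "x \<in> H \<and> u0 \<le> f x")
      case True
      then have "0 \<le> ln (f x / u0)"
        using u0 by simp
      moreover have "(\<integral>\<^sup>+u. \<phi> x u \<partial>lborel) = ennreal (w x) * indicator H x * ennreal (ln (f x / u0))"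
        unfolding \<phi>_def using True u0 by (subst nn_integral_cmult) (auto simp: nn_integral_inverse_eq_ln)
      ultimately show ?thesis
        using True w_nonneg by (simp add: ennreal_mult max_absorb2)
    next
      case False
      have "max 0 (ln (f x / u0)) = 0" if "x \<in> H"
      proof -
        have "f x < u0"
          using False that by simp
        moreover have "0 < f x"
          using Mx_ge[of a w N c' s' x] pos C by (simp add: f_def a_def)
        ultimately show ?thesis
          using u0 by (simp add: ln_le_zero_iff)
      qed
      then show ?thesis
        by (cases "x \<in> H") auto
    qed
  qed
  also have "\<dots> = (\<integral>\<^sup>+u. (\<integral>\<^sup>+x. \<phi> x u \<partial>lborel) \<partial>lborel)"
    using lborel_pair.Fubini'[OF \<phi>_borel] by simp
  \<comment> \<open>For each level u the weight 1 / u meets the factor \<open>k * u\<close> from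
    \<open>mass_superlevel_le\<close>; the bound is uniform in u.\<close>
  also have "\<dots> \<le> (\<integral>\<^sup>+u. ennreal k * (\<integral>\<^sup>+x. \<psi> x u \<partial>lborel) \<partial>lborel)"
  proof (rule nn_integral_mono)
    fix u :: real
    show "(\<integral>\<^sup>+x. \<phi> x u \<partial>lborel) \<le> ennreal k * (\<integral>\<^sup>+x. \<psi> x u \<partial>lborel)"
    proof (cases "u0 < u")
      case True
      define E where "E = H \<inter> {x. ennreal u < \<Lambda> x}"
      have [measurable]: "E \<in> sets borel"
        unfolding E_def by measurable
      have u: "0 < u"
        using True u0 by linarith
      have "ennreal u < \<Lambda> x" if "x \<in> H" "u < f x" for x
        using f_le[OF that(1)] that(2) u by (meson ennreal_lessI le_less_trans less_le_trans less_trans)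
      then have "(\<integral>\<^sup>+x. \<phi> x u \<partial>lborel) \<le> (\<integral>\<^sup>+x. ennreal (1 / u) * (ennreal (w x) * indicator E x) \<partial>lborel)"
        by (intro nn_integral_mono) (auto simp: \<phi>_def indicator_def E_def mult.commute)
      also have "\<dots> = ennreal (1 / u) * (wvol E)"
        by (rule nn_integral_cmult) measurable
      also have "\<dots> \<le> ennreal (1 / u) * (ennreal (k * u) * vol E)"
        unfolding E_def H_def \<Lambda>_def k_def using True u
        by (intro mult_left_mono mass_superlevel_le[OF HLb' s']) (auto simp: u0_def a_def \<kappa>_def)
      also have "\<dots> = (ennreal (1 / u) * ennreal (k * u)) * vol E"
        by (simp only: mult.assoc)
      also have "ennreal (1 / u) * ennreal (k * u) = ennreal k"
        using u k by (subst ennreal_mult[symmetric]) auto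
      also have "vol E = (\<integral>\<^sup>+x. \<psi> x u \<partial>lborel)"
      proof -
        have "(\<integral>\<^sup>+x. \<psi> x u \<partial>lborel) = (\<integral>\<^sup>+x. indicator E x \<partial>lborel)"
          using True by (intro nn_integral_cong) (auto simp: \<psi>_def E_def indicator_def)
        then show ?thesis
          by simp
      qed
      finally show ?thesis .
    next
      case False
      then have "(\<integral>\<^sup>+x. \<phi> x u \<partial>lborel) = (\<integral>\<^sup>+x. 0 \<partial>(lborel :: (real ^ 'n) measure))"
        by (intro nn_integral_cong) (auto simp: \<phi>_def)
      then show ?thesis
        by simp
    qed
  qed
  also have "\<dots> = ennreal k * (\<integral>\<^sup>+u. (\<integral>\<^sup>+x. \<psi> x u \<partial>lborel) \<partial>lborel)"
    unfolding \<psi>_def by (rule nn_integral_cmult) measurable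
  also have "(\<integral>\<^sup>+u. (\<integral>\<^sup>+x. \<psi> x u \<partial>lborel) \<partial>lborel) = (\<integral>\<^sup>+x. (\<integral>\<^sup>+u. \<psi> x u \<partial>lborel) \<partial>lborel)"
    using lborel_pair.Fubini'[OF \<psi>_borel] by simp
  also have "\<dots> \<le> (\<integral>\<^sup>+x\<in>H. \<Lambda> x \<partial>lborel)"
  proof (rule nn_integral_mono)
    fix x
    show "(\<integral>\<^sup>+u. \<psi> x u \<partial>lborel) \<le> \<Lambda> x * indicator H x"
    proof (cases "x \<in> H")
      case True
      show ?thesis
      proof (cases "\<Lambda> x")
        case (real h)
        have "(\<integral>\<^sup>+u. \<psi> x u \<partial>lborel) \<le> (\<integral>\<^sup>+u. indicator {0..h} u \<partial>lborel)"
          using u0 real True by (intro nn_integral_mono) (auto simp: \<psi>_def indicator_def ennreal_less_iff)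
        also have "\<dots> = ennreal h"
          using real by simp
        finally show ?thesis
          using real True by simp
      qed (use True in simp)
    qed (simp add: \<psi>_def)
  qed
  also have "\<dots> \<le> ennreal (A * m)"
    using HLb' s' unfolding HL_bound_def m_def H_def \<Lambda>_def by blast
  finally have main: "(wint H (\<lambda>x. max 0 (ln (f x / u0)))) \<le> ennreal k * ennreal (A * m)"
    by (simp add: mult_left_mono)
  define L where "L = ln (C * \<kappa> * A)"
  have CA1: "1 \<le> C * \<kappa> * A"
    using mult_mono[OF big A] C \<kappa> by (simp add: C_def \<kappa>_def)
  then have L: "0 \<le> L"
    by (simp add: L_def)
  have "(wint H (\<lambda>x. ln (Mx w N c' s' a x / a)))
      \<le> (\<integral>\<^sup>+x. ennreal (w x * max 0 (ln (f x / u0))) * indicator H x + ennreal L * (ennreal (w x) * indicator H x) \<partial>lborel)"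
  proof (rule nn_integral_mono)
    fix x
    have Mp: "0 < Mx w N c' s' a x"
      using Mx_ge[of a w N c' s' x] pos by (simp add: a_def)
    \<comment> \<open>The logarithm splits into the part above \<open>u0\<close> and the constant
      \<open>L\<close>, in which the volume ratio and the smallness threshold are confined.\<close>
    have "Mx w N c' s' a x / a = (f x / u0) * (C * \<kappa> * A)"
      using C pos \<kappa> A by (simp add: f_def u0_def a_def)
    moreover have "0 < f x / u0"
      using Mp C u0 by (simp add: f_def)
    moreover have "0 < C * \<kappa> * A"
      using CA1 by linarith
    ultimately have "ln (Mx w N c' s' a x / a) = ln (f x / u0) + L"
      unfolding L_def by (simp only: ln_mult_pos)
    then have "w x * ln (Mx w N c' s' a x / a) \<le> w x * (max 0 (ln (f x / u0)) + L)"
      by (intro mult_left_mono w_nonneg) simp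
    also have "\<dots> = w x * max 0 (ln (f x / u0)) + L * w x"
      by (simp only: distrib_left mult.commute[of L])
    finally have "ennreal (w x * ln (Mx w N c' s' a x / a)) \<le> ennreal (w x * max 0 (ln (f x / u0)) + L * w x)"
      by (rule ennreal_leI)
    also have "\<dots> = ennreal (w x * max 0 (ln (f x / u0))) + ennreal L * ennreal (w x)"
    proof -
      have "ennreal L * ennreal (w x) = ennreal (L * w x)"
        by (rule ennreal_mult[symmetric]) (use L w_nonneg in auto)
      then show ?thesis
        using w_nonneg[of x] L by (subst ennreal_plus) auto
    qed
    finally show "ennreal (w x * ln (Mx w N c' s' a x / a)) * indicator H x \<le>
        ennreal (w x * max 0 (ln (f x / u0))) * indicator H x + ennreal L * (ennreal (w x) * indicator H x)"
      by (cases "x \<in> H") auto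
  qed
  also have "\<dots> = (wint H (\<lambda>x. max 0 (ln (f x / u0)))) + ennreal L * ennreal m"
    by (simp add: nn_integral_add nn_integral_cmult m_def H_def nn_integral_w_hc)
  also have "\<dots> \<le> ennreal k * ennreal (A * m) + ennreal L * ennreal m"
    by (intro add_right_mono main)
  also have "\<dots> = ennreal (k * (A * m)) + ennreal (L * m)"
    using k L A m by (subst (1 2) ennreal_mult) auto
  also have "\<dots> = ennreal (k * (A * m) + L * m)"
    using k L A m by (intro ennreal_plus[symmetric] mult_nonneg_nonneg) auto
  also have "k * (A * m) + L * m = (k * A + L) * m"
    by (simp only: distrib_right mult.assoc)
  finally show "(wint (hc c' s') (\<lambda>x. ln (Mx w N c' s' (av w c' s') x / av w c' s')))
      \<le> ennreal ((2 * (3 / 2) ^ CARD('n) * A + ln (circum_ratio CARD('n) * (4 * sqrt CARD('n)) ^ CARD('n) * A)) * mass c' s')"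
    unfolding H_def a_def L_def k_def m_def C_def \<kappa>_def .
qed

end

section \<open>The reverse Hoelder inequality\<close>

context weight_density begin

lemma HL_eq_0:
  assumes "mass c s = 0"
  shows "HL c s x = 0"
proof -
  have "ball_mass c s z \<rho> \<le> (\<integral>\<^sup>+x\<in>hc c s. ennreal (w x) \<partial>lborel)" for z \<rho>
    by (intro nn_integral_mono) (auto simp: indicator_def)
  then have "ball_mass c s z \<rho> = 0" for z \<rho>
    using assms by (simp add: nn_integral_w_hc)
  then have "nnavg B (\<lambda>y. ennreal \<bar>w y * indicator (hc c s) y\<bar>) = 0" if "\<exists>z \<rho>. 0 < \<rho> \<and> B = ball z \<rho>" for B
    using that nnavg_ball[of _ _ c s] by auto
  then show ?thesis
    unfolding HL_def HL_maximal_def by (intro antisym SUP_least) auto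
qed

text \<open>Either branch supplies an energy constant K with 2 * K + n * ln 2 at most
  \<open>2 ^ (n + 1) * A - 1\<close>, which is at most 1 / \<epsilon>. Positive mass yields
  \<open>1 \<le> A\<close>, on which the numerical estimates rely.\<close>

theorem reverse_Hoelder:
  assumes HLb: "HL_bound A c s" and s: "0 < s" and m: "0 < mass c s"
    and \<epsilon>: "0 < \<epsilon>" "\<epsilon> \<le> 1 / (2 ^ (CARD('n) + 1) * A - 1)"
  shows "(\<integral>\<^sup>+x\<in>hc c s. ennreal (w x powr (1 + \<epsilon>)) \<partial>lborel) \<le> ennreal (2 * av w c s powr \<epsilon> * mass c s)"
proof -
  define n where "n = CARD('n)"
  have n: "0 < n"
    by (simp add: n_def)
  have A: "1 \<le> A"
    by (rule HL_bound_ge_1[OF HLb s m])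
  have C1: "1 \<le> circum_ratio n"
    unfolding n_def by (rule circum_ratio_ge_1[where 'n='n])
  have "(2 :: real) ^ 1 \<le> 2 ^ (n + 1)"
    by (intro power_increasing) auto
  then have "2 * 1 \<le> 2 ^ (n + 1) * A"
    using A by (intro mult_mono) auto
  then have pos: "0 < 2 ^ (n + 1) * A - 1"
    by linarith
  have inv: "2 ^ (n + 1) * A - 1 \<le> 1 / \<epsilon>"
    using \<epsilon> pos unfolding n_def[symmetric] by (simp add: field_simps)
  have a: "0 < av w c s"
    using m s by (simp add: av_mass)
  show ?thesis
  proof (cases "n \<le> 4")
    case True
    have g0: "0 \<le> jump_ratio n"
      using jump_ratio_ge[OF n] by (meson ln_ge_zero mult_nonneg_nonneg of_nat_0_le_iff one_le_numeral order_trans)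
    have "log_energy_bound (jump_ratio n * (circum_ratio n * A - 1)) c s"
      unfolding n_def
      by (rule log_energy_bound_dyadic[OF HLb g0[unfolded n_def] ln_le_jump_ratio[OF n[unfolded n_def]]])
    moreover have "0 \<le> jump_ratio n * (circum_ratio n * A - 1)"
      using g0 mult_mono[OF C1 A] C1 by (intro mult_nonneg_nonneg) auto
    moreover have "2 * (jump_ratio n * (circum_ratio n * A - 1)) + n * ln 2 \<le> 1 / \<epsilon>"
      using dyadic_constant[OF n True A] inv by linarith
    ultimately show ?thesis
      unfolding n_def by (intro reverse_Hoelder_of_log_energy s a \<epsilon>(1))
  next
    case False
    then have n5: "5 \<le> n"
      by simp
    have "1 \<le> 4 * sqrt (real n)"
    proof -
      have "1 \<le> sqrt (real n)"
        using n by (intro real_sqrt_ge_one) simp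
      then show ?thesis
        by linarith
    qed
    then have "1 \<le> (4 * sqrt (real n)) ^ n"
      by (rule one_le_power)
    then have big: "1 \<le> circum_ratio n * (4 * sqrt n) ^ n"
      using mult_mono[OF C1, of 1 "(4 * sqrt (real n)) ^ n"] C1 by simp
    have "log_energy_bound (2 * (3 / 2) ^ n * A + ln (circum_ratio n * (4 * sqrt n) ^ n * A)) c s"
      unfolding n_def by (rule log_energy_bound_weak_type[OF HLb A big[unfolded n_def]])
    moreover have "0 \<le> 2 * (3 / 2) ^ n * A + ln (circum_ratio n * (4 * sqrt n) ^ n * A)"
      using A mult_mono[OF big A] big by (intro add_nonneg_nonneg ln_ge_zero) auto
    moreover have "2 * (2 * (3 / 2) ^ n * A + ln (circum_ratio n * (4 * sqrt n) ^ n * A)) + n * ln 2 \<le> 1 / \<epsilon>"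
      using weak_type_constant[OF n5 A] inv by linarith
    ultimately show ?thesis
      unfolding n_def by (intro reverse_Hoelder_of_log_energy s a \<epsilon>(1))
  qed
qed

end

section \<open>Matrix weights\<close>

text \<open>Measurability is implicit in integrability over compact sets: each entry is the limit of
  its restrictions to balls.\<close>

lemma matrix_weight_measurable:
  assumes "matrix_weight W"
  shows "W \<in> borel_measurable lebesgue"
proof -
  have entry: "(\<lambda>x. W x $ i $ j) \<in> borel_measurable lebesgue" for i j
  proof (rule borel_measurable_LIMSEQ_metric)
    fix k :: nat
    have "set_integrable lebesgue (cball 0 (real k)) (\<lambda>x. W x $ i $ j)"
      using assms by (simp add: matrix_weight_def)
    then show "(\<lambda>x. indicat_real (cball 0 (real k)) x *\<^sub>R W x $ i $ j) \<in> borel_measurable lebesgue"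
      unfolding set_integrable_def by (rule borel_measurable_integrable)
  next
    fix x
    have "eventually (\<lambda>k. indicat_real (cball 0 (real k)) x *\<^sub>R W x $ i $ j = W x $ i $ j) sequentially"
      unfolding eventually_sequentially
    proof (intro exI allI impI)
      fix k assume "nat \<lceil>norm x\<rceil> \<le> k"
      then have "norm x \<le> real k"
        by linarith
      then show "indicat_real (cball 0 (real k)) x *\<^sub>R W x $ i $ j = W x $ i $ j"
        by simp
    qed
    then show "(\<lambda>k. indicat_real (cball 0 (real k)) x *\<^sub>R W x $ i $ j) \<longlonglongrightarrow> W x $ i $ j"
      by (rule tendsto_eventually)
  qed
  have "(\<lambda>x. \<chi> i. \<chi> j. W x $ i $ j) \<in> borel_measurable lebesgue"
    by (intro borel_measurable_vec_lambda entry)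
  then show ?thesis
    by simp
qed

lemma opnorm_weight_measurable:
  assumes "matrix_weight W" "0 < p"
  shows "(\<lambda>x. opnorm (mat_powr (W x) (1 / p) ** M) powr p) \<in> borel_measurable lebesgue"
proof -
  have "(\<lambda>x. mat_powr (W x) (1 / p)) \<in> borel_measurable lebesgue"
    using assms by (intro borel_measurable_mat_powr matrix_weight_measurable) (auto simp: matrix_weight_def)
  moreover have "continuous_on UNIV (\<lambda>A. opnorm (A ** M))"
  proof (rule continuous_on_compose2[OF continuous_on_opnorm])
    show "continuous_on UNIV (\<lambda>A. A ** M)"
      unfolding matrix_matrix_mult_def
      by (intro continuous_on_vec_lambda continuous_on_sum continuous_on_mult continuous_on_component
          continuous_on_id continuous_on_const)
  qed auto
  ultimately have "(\<lambda>x. opnorm (mat_powr (W x) (1 / p) ** M)) \<in> borel_measurable lebesgue"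
    by (rule measurable_compose[OF _ borel_measurable_continuous_onI])
  then show ?thesis
    by measurable
qed

lemma opnorm_weight_integrable:
  fixes W :: "real ^ 'n \<Rightarrow> complex ^ 'm ^ 'm"
  assumes W: "matrix_weight W" and p: "0 < p" and K: "compact K"
  shows "set_integrable lebesgue K (\<lambda>x. opnorm (mat_powr (W x) (1 / p) ** M) powr p)"
proof -
  define k where "k = (real CARD('m) ^ 3 * entry_sum M) powr p"
  have int: "integrable lebesgue (\<lambda>x. \<Sum>i\<in>UNIV. k * Re (indicat_real K x *\<^sub>R W x $ i $ i))"
  proof (intro Bochner_Integration.integrable_sum integrable_mult_right integrable_Re)
    fix i
    show "integrable lebesgue (\<lambda>x. indicat_real K x *\<^sub>R W x $ i $ i)"
      using W K by (auto simp: matrix_weight_def set_integrable_def)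
  qed
  show ?thesis
    unfolding set_integrable_def
  proof (rule Bochner_Integration.integrable_bound[OF int])
    have [measurable]: "K \<in> sets lebesgue"
      using K by (simp add: borel_compact)
    show "(\<lambda>x. indicat_real K x *\<^sub>R opnorm (mat_powr (W x) (1 / p) ** M) powr p) \<in> borel_measurable lebesgue"
      by (intro borel_measurable_scaleR borel_measurable_indicator opnorm_weight_measurable W p) auto
    show "AE x in lebesgue. norm (indicat_real K x *\<^sub>R opnorm (mat_powr (W x) (1 / p) ** M) powr p)
        \<le> norm (\<Sum>i\<in>UNIV. k * Re (indicat_real K x *\<^sub>R W x $ i $ i))"
    proof (rule AE_I2)
      fix x
      have nd: "nonneg_definite (W x)"
        using W by (simp add: matrix_weight_def)
      have "opnorm (mat_powr (W x) (1 / p) ** M) powr p \<le> k * (\<Sum>i\<in>UNIV. Re (W x $ i $ i))"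
        unfolding k_def by (rule opnorm_mat_powr_bound(2)[OF nd p])
      then show "norm (indicat_real K x *\<^sub>R opnorm (mat_powr (W x) (1 / p) ** M) powr p)
        \<le> norm (\<Sum>i\<in>UNIV. k * Re (indicat_real K x *\<^sub>R W x $ i $ i))"
        by (cases "x \<in> K") (auto simp: sum_distrib_left intro: order_trans[OF _ abs_ge_self])
    qed
  qed
qed

section \<open>General cubes, the scalar weights of a matrix weight, and the conclusion\<close>

lemma cube_hc:
  fixes Q :: "(real ^ 'n) set"
  assumes "cube Q"
  obtains c s where "0 < s" "box c (c + vec s) \<subseteq> Q" "Q \<subseteq> cbox c (c + vec s)"
proof -
  obtain a s I where s: "0 < s" and I: "\<And>i. {a i<..<a i + s} \<subseteq> I i \<and> I i \<subseteq> {a i..a i + s}"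
    and Q: "Q = {x. \<forall>i. x $ i \<in> I i}"
    using assms unfolding cube_def by blast
  show ?thesis
  proof
    show "0 < s"
      by (rule s)
    show "box (\<chi> i. a i) ((\<chi> i. a i) + vec s) \<subseteq> Q"
    proof
      fix x :: "real ^ 'n" assume x: "x \<in> box (\<chi> i. a i) ((\<chi> i. a i) + vec s)"
      have "x $ i \<in> I i" for i
        by (rule subsetD[OF conjunct1[OF I]]) (use x in \<open>simp add: mem_box_cart\<close>)
      then show "x \<in> Q"
        by (simp add: Q)
    qed
    show "Q \<subseteq> cbox (\<chi> i. a i) ((\<chi> i. a i) + vec s)"
    proof
      fix x assume x: "x \<in> Q"
      have "x $ i \<in> {a i..a i + s}" for i
        by (rule subsetD[OF conjunct2[OF I]]) (use x in \<open>simp add: Q\<close>)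
      then show "x \<in> cbox (\<chi> i. a i) ((\<chi> i. a i) + vec s)"
        by (simp add: mem_box_cart)
    qed
  qed
qed

lemma cube_hc_mem: "0 < s \<Longrightarrow> cube (hc c s)"
  unfolding cube_def hc_def
  by (intro exI[of _ "\<lambda>i. c $ i"] exI[of _ s] exI[of _ "\<lambda>i. {c $ i..<c $ i + s}"]) auto

theorem proposition5p6:
  fixes p r :: real
    and W :: "real ^ 'n \<Rightarrow> complex ^ 'm ^ 'm"
    and M :: "complex ^ 'm ^ 'm"
    and Q :: "(real ^ 'n) set"
  assumes "0 < p"
    and "W \<in> Ap_infty p"
    and "1 \<le> r"
    and "ennreal r \<le> 1 + 1 / (2 ^ (CARD('n) + 1) * Ap_infty_sc p W - 1)"
    and "cube Q"
  shows "nnavg Q (\<lambda>x. ennreal (opnorm (mat_powr (W x) (1 / p) ** M) powr (p * r)))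
         \<le> ennreal (2 * avg Q (\<lambda>x. opnorm (mat_powr (W x) (1 / p) ** M) powr p) powr r)"
proof -
  define f where "f x = opnorm (mat_powr (W x) (1 / p) ** M) powr p" for x
  have W: "matrix_weight W"
    using assms(2) by (simp add: Ap_infty_def)
  obtain c s where s: "0 < s" and Q: "box c (c + vec s) \<subseteq> Q" "Q \<subseteq> cbox c (c + vec s)"
    using cube_hc[OF assms(5)] .
  define H where "H = hc c s"
  have [measurable]: "H \<in> sets borel" "H \<in> sets lebesgue"
    by (simp_all add: H_def)
  have f0: "0 \<le> f x" for x
    by (simp add: f_def)
  have f_meas: "f \<in> borel_measurable lebesgue"
    unfolding f_def using W assms(1) by (rule opnorm_weight_measurable)
  then obtain f' where f': "f' \<in> borel_measurable lborel" "AE x in lborel. f x = f' x"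
    using completion_ex_borel_measurable_real[of f lborel] by blast
  \<comment> \<open>\<open>f\<close> is only Lebesgue measurable. The Borel version
    \<open>f'\<close> may be negative on a null set, which the maximum repairs, and the cut-off to
    \<open>H\<close> makes the weight globally integrable.\<close>
  define w where "w x = max 0 (f' x) * indicator H x" for x
  have w_eq: "AE x in lborel. x \<in> H \<longrightarrow> f x = w x"
    using f'(2)
  proof eventually_elim
    fix x assume "f x = f' x"
    then show "x \<in> H \<longrightarrow> f x = w x"
      using f0[of x] by (simp add: w_def)
  qed
  have w_eq': "AE x in lebesgue. x \<in> H \<longrightarrow> f x = w x"
    by (rule AE_completion[OF w_eq])
  have w_meas: "w \<in> borel_measurable borel"
    unfolding w_def using f'(1) by simp
  have "set_integrable lebesgue (cbox c (c + vec s)) f"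
    unfolding f_def by (rule opnorm_weight_integrable[OF W assms(1) compact_cbox])
  then have "set_integrable lebesgue H f"
    by (rule set_integrable_subset) (auto simp: H_def hc_subset_cbox)
  then have "integrable lebesgue (\<lambda>x. indicat_real H x *\<^sub>R f x)"
    by (simp add: set_integrable_def)
  moreover have "w \<in> borel_measurable lebesgue"
    using w_meas by (intro measurable_completion) simp
  moreover have "AE x in lebesgue. indicat_real H x *\<^sub>R f x = w x"
    using w_eq' by eventually_elim (auto simp: w_def indicator_def)
  ultimately have "integrable lebesgue w"
    by (rule integrable_cong_AE_imp)
  then have w_int: "integrable lborel w"
    using w_meas by (subst (asm) integrable_completion) auto
  interpret weight_density w
  proof
    show "0 \<le> w x" for x
      by (simp add: w_def)
  qed (rule w_int)
  \<comment> \<open>\<open>Q\<close> may contain any part of its faces; all choices lie between the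
    open and the closed cube, which differ by a null set.\<close>
  have N: "AE x in lebesgue. x \<in> Q \<longleftrightarrow> x \<in> H"
  proof -
    have "emeasure lborel (cbox c (c + vec s) - box c (c + vec s)) = 0"
      using s box_subset_cbox[of c "c + vec s"] by (subst emeasure_Diff) (auto simp: emeasure_cube_cart)
    then have "AE x in lborel. x \<notin> cbox c (c + vec s) - box c (c + vec s)"
      by (intro AE_not_in) (auto simp: null_sets_def)
    then have "AE x in lebesgue. x \<notin> cbox c (c + vec s) - box c (c + vec s)"
      by (rule AE_completion)
    then show ?thesis
      by (rule AE_mp) (use Q box_subset_hc[of c s] hc_subset_cbox[of c s] in \<open>auto intro!: AE_I2 simp: H_def\<close>)
  qed
  have Qm: "Q \<in> sets lebesgue"
  proof -
    have "cbox c (c + vec s) - box c (c + vec s) \<in> null_sets lborel"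
      using s box_subset_cbox[of c "c + vec s"]
      by (auto simp: null_sets_def emeasure_Diff emeasure_cube_cart)
    then have "Q - box c (c + vec s) \<in> null_sets lebesgue"
      using Q by (intro null_sets_completion_subset[OF _ null_sets_completionI]) auto
    then have "box c (c + vec s) \<union> (Q - box c (c + vec s)) \<in> sets lebesgue"
      by (intro sets.Un) auto
    then show ?thesis
      using Q by (simp add: Un_absorb1)
  qed
  have emQ: "emeasure lebesgue Q = ennreal (s ^ CARD('n))"
  proof -
    have "emeasure lebesgue Q = emeasure lebesgue H"
      by (rule emeasure_eq_AE[OF N Qm]) simp
    then show ?thesis
      using s by (simp add: H_def emeasure_hc)
  qed
  have avg_eq: "avg Q f = av w c s"
  proof -
    have "(LINT x:Q|lebesgue. f x) = (LINT x:H|lebesgue. w x)"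
      unfolding set_lebesgue_integral_def
    proof (rule integral_cong_AE)
      show "(\<lambda>x. indicat_real Q x *\<^sub>R f x) \<in> borel_measurable lebesgue"
        using Qm f_meas by (intro borel_measurable_scaleR borel_measurable_indicator)
      show "(\<lambda>x. indicat_real H x *\<^sub>R w x) \<in> borel_measurable lebesgue"
        using w_meas by (intro borel_measurable_scaleR borel_measurable_indicator measurable_completion) auto
      show "AE x in lebesgue. indicat_real Q x *\<^sub>R f x = indicat_real H x *\<^sub>R w x"
        using N w_eq' by eventually_elim (auto simp: indicator_def)
    qed
    also have "\<dots> = (LINT x:H|lborel. w x)"
      unfolding set_lebesgue_integral_def using w_meas
      by (intro integral_completion borel_measurable_scaleR borel_measurable_indicator) auto
    finally show ?thesis
      using s by (simp add: avg_def av_def H_def measure_def emQ)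
  qed
  have nn_eq: "nnavg Q (\<lambda>x. ennreal (opnorm (mat_powr (W x) (1 / p) ** M) powr (p * r))) =
      (\<integral>\<^sup>+x\<in>H. ennreal (w x powr r) \<partial>lborel) / ennreal (s ^ CARD('n))"
  proof -
    have "(\<integral>\<^sup>+x\<in>Q. ennreal (opnorm (mat_powr (W x) (1 / p) ** M) powr (p * r)) \<partial>lebesgue) =
        (\<integral>\<^sup>+x\<in>H. ennreal (w x powr r) \<partial>lebesgue)"
    proof (rule nn_integral_cong_AE)
      show "AE x in lebesgue. ennreal (opnorm (mat_powr (W x) (1 / p) ** M) powr (p * r)) * indicator Q x =
          ennreal (w x powr r) * indicator H x"
        using N w_eq'
      proof eventually_elim
        fix x assume "x \<in> Q \<longleftrightarrow> x \<in> H" "x \<in> H \<longrightarrow> f x = w x"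
        moreover have "opnorm (mat_powr (W x) (1 / p) ** M) powr (p * r) = f x powr r"
          by (simp add: f_def powr_powr)
        ultimately show "ennreal (opnorm (mat_powr (W x) (1 / p) ** M) powr (p * r)) * indicator Q x =
            ennreal (w x powr r) * indicator H x"
          by (cases "x \<in> H") auto
      qed
    qed
    then show ?thesis
      by (simp add: nnavg_def emQ nn_integral_completion)
  qed
  define m where "m = mass c s"
  have m0: "0 \<le> m"
    by (simp add: m_def mass_nonneg)
  have sn: "0 < s ^ CARD('n)"
    using s by simp
  have goal: ?thesis if "(\<integral>\<^sup>+x\<in>H. ennreal (w x powr r) \<partial>lborel) \<le> ennreal (2 * av w c s powr r * s ^ CARD('n))"
  proof -
    have "(\<integral>\<^sup>+x\<in>H. ennreal (w x powr r) \<partial>lborel) / ennreal (s ^ CARD('n)) \<le>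
        ennreal (2 * av w c s powr r * s ^ CARD('n)) / ennreal (s ^ CARD('n))"
      using that by (rule divide_right_mono_ennreal)
    also have "\<dots> = ennreal (2 * av w c s powr r)"
      using s by (subst divide_ennreal) auto
    finally show ?thesis
      unfolding nn_eq avg_eq[unfolded f_def] .
  qed
  \<comment> \<open>\<open>reverse_Hoelder\<close> needs positive mass and a positive exponent
    \<open>r - 1\<close>. Without mass both sides vanish, and for r = 1 the claim bounds the average
    by its double.\<close>
  consider "m = 0" | "0 < m" "r = 1" | "0 < m" "1 < r"
    using m0 assms(3) by linarith
  then show ?thesis
  proof cases
    case 1
    then have "(\<integral>\<^sup>+x\<in>H. ennreal (w x) \<partial>lborel) = 0"
      by (simp add: H_def nn_integral_w_hc m_def)
    then have "AE x in lborel. ennreal (w x) * indicator H x = 0"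
      by (subst (asm) nn_integral_0_iff_AE) auto
    then have "AE x in lborel. ennreal (w x powr r) * indicator H x = 0"
      by (rule AE_mp) (auto intro!: AE_I2 simp: indicator_def ennreal_eq_0_iff w_nonneg order_antisym)
    then have "(\<integral>\<^sup>+x\<in>H. ennreal (w x powr r) \<partial>lborel) = (\<integral>\<^sup>+x. 0 \<partial>(lborel :: (real ^ 'n) measure))"
      by (rule nn_integral_cong_AE)
    then show ?thesis
      by (intro goal) simp
  next
    case 2
    have a: "0 \<le> av w c s"
      by (rule av_nonneg[OF s])
    have "(\<integral>\<^sup>+x\<in>H. ennreal (w x powr r) \<partial>lborel) = ennreal m"
      using 2 w_nonneg by (simp add: H_def m_def nn_integral_w_hc)
    also have "\<dots> = ennreal (av w c s * s ^ CARD('n))"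
      by (simp add: m_def mass_av[OF s])
    also have "\<dots> \<le> ennreal (2 * av w c s powr r * s ^ CARD('n))"
      using 2 a sn by (intro ennreal_leI mult_right_mono) auto
    finally show ?thesis
      by (rule goal)
  next
    case 3
    define S where "S = Ap_infty_sc p W"
    \<comment> \<open>An infinite constant would leave only r = 1, because 1 / \<infinity> is 0 in
      \<open>ennreal\<close>.\<close>
    have "S \<noteq> \<infinity>"
    proof
      assume "S = \<infinity>"
      then have "ennreal r \<le> 1 + 1 / (2 ^ (CARD('n) + 1) * \<infinity> - 1)"
        using assms(4) by (simp only: S_def)
      also have "(2 ^ (CARD('n) + 1) * \<infinity> - 1 :: ennreal) = \<infinity>"
        by (simp add: ennreal_mult_top)
      finally have "ennreal r \<le> 1"
        by simp
      then show False
        using 3 by simp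
    qed
    then obtain A where A: "S = ennreal A" "0 \<le> A"
      by (cases S) auto
    \<comment> \<open>The supremum in \<open>Ap_infty_sc\<close> excludes the zero matrix; here
      positive mass does so too.\<close>
    have M: "M \<noteq> 0"
    proof
      assume "M = 0"
      then have "f x = 0" for x
        by (simp add: f_def)
      then have "avg Q f = 0"
        by (simp add: avg_def set_lebesgue_integral_def)
      then show False
        using avg_eq 3 s by (simp add: av_mass m_def)
    qed
    have star: "A_infty_star f \<le> ennreal A"
      unfolding A(1)[symmetric] S_def Ap_infty_sc_def f_def[abs_def]
      by (rule SUP_upper) (use M in simp)
    have "HL_bound A c s"
      unfolding HL_bound_def
    proof (intro allI impI)
      fix c' s' assume s': "0 < s'" and sub: "hc c' s' \<subseteq> hc c s"
      show "(\<integral>\<^sup>+x\<in>hc c' s'. HL c' s' x \<partial>lborel) \<le> ennreal (A * mass c' s')"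
      proof (cases "mass c' s' = 0")
        case True
        then show ?thesis
          by (simp add: HL_eq_0)
      next
        case False
        then have m': "0 < mass c' s'"
          using mass_nonneg[of c' s'] by linarith
        define X where "X = (\<integral>\<^sup>+x\<in>hc c' s'. HL c' s' x \<partial>lborel)"
        have eqAE: "AE x in lebesgue. x \<in> hc c' s' \<longrightarrow> f x = w x"
          using w_eq' by eventually_elim (use sub in \<open>auto simp: H_def\<close>)
        \<comment> \<open>Only integrals enter the maximal function, so equality almost everywhere
          of the weights gives equality of the maximal functions at every point.\<close>
        have "nnavg B (\<lambda>y. ennreal \<bar>f y * indicator (hc c' s') y\<bar>) = nnavg B (\<lambda>y. ennreal \<bar>w y * indicator (hc c' s') y\<bar>)" for B
        proof -
          have "(\<integral>\<^sup>+y\<in>B. ennreal \<bar>f y * indicator (hc c' s') y\<bar> \<partial>lebesgue) = (\<integral>\<^sup>+y\<in>B. ennreal \<bar>w y * indicator (hc c' s') y\<bar> \<partial>lebesgue)"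
            by (rule nn_integral_cong_AE) (use eqAE in \<open>eventually_elim, auto simp: indicator_def\<close>)
          then show ?thesis
            by (simp add: nnavg_def)
        qed
        then have HLeq: "HL_maximal (\<lambda>y. f y * indicator (hc c' s') y) = HL c' s'"
          unfolding HL_def HL_maximal_def by presburger
        have "(\<integral>\<^sup>+x\<in>hc c' s'. ennreal (f x) \<partial>lebesgue) = (\<integral>\<^sup>+x\<in>hc c' s'. ennreal (w x) \<partial>lebesgue)"
          by (rule nn_integral_cong_AE) (use eqAE in \<open>eventually_elim, auto simp: indicator_def\<close>)
        also have "\<dots> = ennreal (mass c' s')"
          by (simp add: nn_integral_completion nn_integral_w_hc)
        finally have den: "(\<integral>\<^sup>+x\<in>hc c' s'. ennreal (f x) \<partial>lebesgue) = ennreal (mass c' s')" .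
        have "(\<integral>\<^sup>+x\<in>hc c' s'. HL_maximal (\<lambda>y. f y * indicator (hc c' s') y) x \<partial>lebesgue) / (\<integral>\<^sup>+x\<in>hc c' s'. ennreal (f x) \<partial>lebesgue) \<le> A_infty_star f"
          unfolding A_infty_star_def by (rule SUP_upper) (simp add: cube_hc_mem[OF s'])
        then have "X / ennreal (mass c' s') \<le> ennreal A"
          using order_trans[OF _ star] unfolding HLeq den by (simp only: X_def nn_integral_completion)
        then have "X / ennreal (mass c' s') * ennreal (mass c' s') \<le> ennreal A * ennreal (mass c' s')"
          by (rule mult_right_mono) simp
        moreover have "X / ennreal (mass c' s') * ennreal (mass c' s') = X"
          using m' by (simp add: ennreal_divide_times ennreal_times_divide mult_divide_eq_ennreal)
        ultimately show ?thesis
          using A m' by (simp add: X_def ennreal_mult)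
      qed
    qed
    moreover have A1: "1 \<le> A"
      using HL_bound_ge_1[OF \<open>HL_bound A c s\<close> s] 3 by (simp add: m_def)
    moreover have "r - 1 \<le> 1 / (2 ^ (CARD('n) + 1) * A - 1)"
    proof -
      have "(2 :: real) ^ 1 \<le> 2 ^ (CARD('n) + 1)"
        by (intro power_increasing) auto
      then have "2 * 1 \<le> 2 ^ (CARD('n) + 1) * A"
        using A1 by (intro mult_mono) auto
      then have pos: "0 < 2 ^ (CARD('n) + 1) * A - 1"
        by linarith
      have "(2 ^ (CARD('n) + 1) * ennreal A - 1 :: ennreal) = ennreal (2 ^ (CARD('n) + 1) * A - 1)"
      proof -
        have "(2 ^ (CARD('n) + 1) :: ennreal) = ennreal (2 ^ (CARD('n) + 1))"
          by (metis ennreal_numeral ennreal_power zero_le_numeral)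
        then have "(2 ^ (CARD('n) + 1) * ennreal A :: ennreal) = ennreal (2 ^ (CARD('n) + 1)) * ennreal A"
          by (simp only:)
        also have "\<dots> = ennreal (2 ^ (CARD('n) + 1) * A)"
          by (rule ennreal_mult[symmetric]) (use A(2) in auto)
        finally have "(2 ^ (CARD('n) + 1) * ennreal A :: ennreal) = ennreal (2 ^ (CARD('n) + 1) * A)" .
        then show ?thesis
          by (simp only: ennreal_1[symmetric]) (rule ennreal_minus, simp)
      qed
      then have "ennreal r \<le> 1 + 1 / ennreal (2 ^ (CARD('n) + 1) * A - 1)"
        using assms(4) by (simp only: S_def[symmetric] A(1))
      also have "\<dots> = ennreal (1 + 1 / (2 ^ (CARD('n) + 1) * A - 1))"
      proof -
        have "1 / ennreal (2 ^ (CARD('n) + 1) * A - 1) = ennreal (1 / (2 ^ (CARD('n) + 1) * A - 1))"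
          using divide_ennreal[of 1 "2 ^ (CARD('n) + 1) * A - 1"] pos by simp
        then show ?thesis
          using pos by (simp only: ennreal_1[symmetric]) (rule ennreal_plus[symmetric], auto)
      qed
      finally have "r \<le> 1 + 1 / (2 ^ (CARD('n) + 1) * A - 1)"
        using pos by (subst (asm) ennreal_le_iff) (auto intro!: add_nonneg_nonneg divide_nonneg_pos)
      then show ?thesis
        by linarith
    qed
    ultimately have "(\<integral>\<^sup>+x\<in>hc c s. ennreal (w x powr (1 + (r - 1))) \<partial>lborel) \<le> ennreal (2 * av w c s powr (r - 1) * mass c s)"
      using 3 s unfolding m_def by (intro reverse_Hoelder) auto
    moreover have "2 * av w c s powr (r - 1) * mass c s = 2 * av w c s powr r * s ^ CARD('n)"
    proof -
      have "0 < av w c s"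
        using 3 s by (simp add: av_mass m_def)
      then have "av w c s powr r = av w c s powr (r - 1) * av w c s"
        by (simp add: powr_diff)
      then show ?thesis
        using mass_av[OF s, of c] by simp
    qed
    ultimately show ?thesis
      by (intro goal) (simp add: H_def)
  qed
qed

end
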